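(* In the setting and notation of the context, fix $(t,z,p)\in[0,T]\times\mathcal{Z}\times\mathbb{R}$ and suppose that conditions (C1)--(C6), (Z1)--(Z4), (I1)--(I2) and (R1)--(R2) listed in the context hold. (GDP1) If $(z,p)\in\Lambda(t)$, then there exist $\mathfrak{u}\in\mathfrak{U}$ and a family $\{M^{\nu},\nu\in\mathcal{V}\}\subset\mathcal{M}_{t,p}$ such that $$\bigl(Z^{\mathfrak{u},\nu}_{t,z}(\tau),M^{\nu}(\tau)\bigr)\in\bar\Lambda(\tau)\quad\mathbb{P}\text{-a.s. for all }\nu\in\mathcal{V}\text{ and }\tau\in\mathcal{T}_{t}.$$ (GDP2) Let $\iota>0$, $\mathfrak{u}\in\mathfrak{U}$, $\{M^{\nu},\nu\in\mathcal{V}\}\in\mathfrak{M}_{t,p}$ and $\{\tau^{\nu},\nu\in\mathcal{V}\}\in\mathfrak{T}_{t}$ be such that $$\bigl(Z^{\mathfrak{u},\nu}_{t,z}(\tau^{\nu}),M^{\nu}(\tau^{\nu})\bigr)\in\Lambda_{\iota}(\tau^{\nu})\quad\mathbb{P}\text{-a.s. for all }\nu\in\mathcal{V},$$ and suppose that $\{M^{\nu}(\tau^{\nu})^{+}:\nu\in\mathcal{V}\}$ and $\{L^{\mathfrak{u},\nu}_{t,z}(\tau')^{-}:\nu\in\mathcal{V},\tau'\in\mathcal{T}_{t}\}$ are uniformly integrable, where $L^{\mathfrak{u},\nu}_{t,z}$ is the process from (I2). Then $(z,p-\varepsilon)\in\Lambda(t)$ for all $\varepsilon>0$.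
   Context: **Setting.** Fix $T>0$ and a probability space $(\Omega,\mathcal{F},\mathbb{P})$ with a filtration $\mathbb{F}=(\mathcal{F}_t)_{t\in[0,T]}$ satisfying the usual conditions. $\mathcal{U}$ and $\mathcal{V}$ (controls) are sets of stochastic processes indexed by $[0,T]$ with values in sets $U$ and $V$, respectively. $\mathfrak{U}$ is a given set of mappings $\mathfrak{u}:\mathcal{V}\to\mathcal{U}$, $\nu\mapsto\mathfrak{u}[\nu]$ (strategies). $(\mathcal{Z},d_{\mathcal{Z}})$ is a metric space. For each $(t,z)\in[0,T]\times\mathcal{Z}$ and $(\mathfrak{u},\nu)\in\mathfrak{U}\times\mathcal{V}$ we are given an adapted càdlàg process $Z^{\mathfrak{u},\nu}_{t,z}=Z^{\mathfrak{u}[\nu],\nu}_{t,z}$ with values in $\mathcal{Z}$ and $Z^{\mathfrak{u},\nu}_{t,z}(t)=z$. $\ell:\mathcal{Z}\to\mathbb{R}$ is Borel measurable with $\mathbb{E}[|\ell(Z^{\mathfrak{u},\nu}_{t,z}(T))|]<\infty$ for all $(t,z,\mathfrak{u},\nu)$. Put $$I(t,z,\mathfrak{u},\nu)=\mathbb{E}[\ell(Z^{\mathfrak{u},\nu}_{t,z}(T))|\mathcal{F}_t],\qquad J(t,z,\mathfrak{u})=\operatorname{ess\,inf}_{\nu\in\mathcal{V}}I(t,z,\mathfrak{u},\nu),$$ $$\Lambda(t)=\{(z,p)\in\mathcal{Z}\times\mathbb{R}:\ \exists\,\mathfrak{u}\in\mathfrak{U}\text{ with }J(t,z,\mathfrak{u})\ge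 p\ \mathbb{P}\text{-a.s.}\}.$$ $\bar\Lambda(t)$ is the set of $(z,p)\in\mathcal{Z}\times\mathbb{R}$ for which there exist $(t_n,z_n,p_n)\to(t,z,p)$ with $(z_n,p_n)\in\Lambda(t_n)$ and $t_n\ge t$ for all $n\ge1$. For $\iota>0$, $\Lambda_\iota(t)$ is the set of $(z,p)\in\mathcal{Z}\times\mathbb{R}$ such that $(t',z',p')\in B_\iota(t,z,p)$ implies $(z',p')\in\Lambda(t')$, where $B_\iota(t,z,p)\subset[0,T]\times\mathcal{Z}\times\mathbb{R}$ is the open ball of radius $\iota$ for the distance $d_{\mathcal{Z}}(z,z')+|p-p'|+|t-t'|$. $\mathcal{M}_{t,p}$ is the set of all real-valued right-continuous martingales $M$ with $M(t)=p$ $\mathbb{P}$-a.s.; $\mathfrak{M}_{t,p}$ is a fixed set of families $\{M^\nu,\nu\in\mathcal{V}\}\subset\mathcal{M}_{t,p}$. $\mathcal{T}_t$ is the set of all stopping times with values in $[t,T]$. For each $t$, $\mathfrak{F}_t$ is a given set of families $\{A^\nu,\nu\in\mathcal{V}\}\subset\mathcal{F}_t$ of events, and $\mathfrak{T}_t$ a given set of families $\{\tau^\nu,\nu\in\mathcal{V}\}\subset\mathcal{T}_t$, containing every deterministic time $s\in[t,T]$ (as a constant family). **Notation.** $\nu\oplus_\tau\bar\nu=\nu\mathbf{1}_{[0,\tau]}+\bar\nu\mathbf{1}_{(\tau,T]}$ for controls $\nu,\bar\nu$ and a stopping time $\tau$; $\{\nu=_{(t,\tau]}\bar\nu\}=\{\omega:\nu_s(\omega)=\bar\nu_s(\omega)\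 \forall s\in(t,\tau(\omega)]\}$; likewise for elements of $\mathcal{U}$. $\mathfrak{u}\oplus_s\bar{\mathfrak{u}}$ is the map $\nu\mapsto\mathfrak{u}[\nu]\oplus_s\bar{\mathfrak{u}}[\nu]$, and $\mathfrak{u}[\nu\oplus_s\cdot]$ is the map $\bar\nu\mapsto\mathfrak{u}[\nu\oplus_s\bar\nu]$. **Conditions (C)**, for all $t\in[0,T]$: (C1) If $\nu_0,\nu_1,\nu_2\in\mathcal{V}$ and $A\in\mathcal{F}_t$, then $\nu_0\oplus_t(\nu_1\mathbf{1}_A+\nu_2\mathbf{1}_{A^c})\in\mathcal{V}$. (C2) If $(\mathfrak{u}_j)_{j\ge0}\subset\mathfrak{U}$ and $\{A^\nu_j,\nu\in\mathcal{V}\}_{j\ge1}\subset\mathfrak{F}_t$ is such that $\{A^\nu_j,j\ge1\}$ is a partition of $\Omega$ for each $\nu\in\mathcal{V}$, then $\mathfrak{u}\in\mathfrak{U}$ for $\mathfrak{u}[\nu]:=\mathfrak{u}_0[\nu]\oplus_t\sum_{j\ge1}\mathfrak{u}_j[\nu]\mathbf{1}_{A^\nu_j}$. (C3) If $\mathfrak{u}\in\mathfrak{U}$ and $\nu\in\mathcal{V}$, then $\mathfrak{u}[\nu\oplus_t\cdot]\in\mathfrak{U}$. (C4) If $\{A^\nu,\nu\in\mathcal{V}\}\subset\mathcal{F}_t$ satisfies $A^{\nu_1}\cap\{\nu_1=_{(0,t]}\nu_2\}=A^{\nu_2}\cap\{\nu_1=_{(0,t]}\nu_2\}$ for all $\nu_1,\nu_2\in\mathcal{V}$,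 then $\{A^\nu,\nu\in\mathcal{V}\}\in\mathfrak{F}_t$. (C5) If $\{\tau^\nu,\nu\in\mathcal{V}\}\in\mathfrak{T}_t$, then $\{\tau^{\nu_1}\le s\}\cap\{\nu_1=_{(0,s]}\nu_2\}=\{\tau^{\nu_2}\le s\}\cap\{\nu_1=_{(0,s]}\nu_2\}$ $\mathbb{P}$-a.s. for all $\nu_1,\nu_2\in\mathcal{V}$, $s\in[t,T]$. (C6) If $\{\tau^\nu,\nu\in\mathcal{V}\}\in\mathfrak{T}_t$, then for all $t\le s_1\le s_2\le T$ the families $\{\{\tau^\nu\in(s_1,s_2]\},\nu\in\mathcal{V}\}$ and $\{\{\tau^\nu\notin(s_1,s_2]\},\nu\in\mathcal{V}\}$ belong to $\mathfrak{F}_{s_2}$. **Conditions (Z)**, for all $(t,z,p)\in[0,T]\times\mathcal{Z}\times\mathbb{R}$ and $s\in[t,T]$: (Z1) $Z^{\mathfrak{u}_1,\nu}_{t,z}(s)=Z^{\mathfrak{u}_2,\nu}_{t,z}(s)$ $\mathbb{P}$-a.e. on $\{\mathfrak{u}_1[\nu]=_{(t,s]}\mathfrak{u}_2[\nu]\}$, for all $\nu\in\mathcal{V}$, $\mathfrak{u}_1,\mathfrak{u}_2\in\mathfrak{U}$. (Z2) $Z^{\mathfrak{u},\nu_1}_{t,z}(s)=Z^{\mathfrak{u},\nu_2}_{t,z}(s)$ $\mathbb{P}$-a.e. on $\{\nu_1=_{(0,s]}\nu_2\}$, for all $\mathfrak{u}\in\mathfrak{U}$, $\nu_1,\nu_2\in\mathcal{V}$.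 (Z3) $M^{\nu_1}(s)=M^{\nu_2}(s)$ $\mathbb{P}$-a.e. on $\{\nu_1=_{(0,s]}\nu_2\}$, for all $\{M^\nu,\nu\in\mathcal{V}\}\in\mathfrak{M}_{t,p}$, $\nu_1,\nu_2\in\mathcal{V}$. (Z4) There is a constant $K(t,z)\in\mathbb{R}$ with $\operatorname{ess\,sup}_{\mathfrak{u}\in\mathfrak{U}}\operatorname{ess\,inf}_{\nu\in\mathcal{V}}\mathbb{E}[\ell(Z^{\mathfrak{u},\nu}_{t,z}(T))|\mathcal{F}_t]=K(t,z)$ $\mathbb{P}$-a.s. **Conditions (I)**, for all $(t,z)\in[0,T]\times\mathcal{Z}$, $\mathfrak{u}\in\mathfrak{U}$, $\nu\in\mathcal{V}$: (I1) There is an adapted right-continuous process $N^{\mathfrak{u},\nu}_{t,z}$ of class (D) with $\operatorname{ess\,inf}_{\bar\nu\in\mathcal{V}}\mathbb{E}[\ell(Z^{\mathfrak{u},\nu\oplus_s\bar\nu}_{t,z}(T))|\mathcal{F}_s]\ge N^{\mathfrak{u},\nu}_{t,z}(s)$ $\mathbb{P}$-a.s. for all $s\in[t,T]$. (I2) There is an adapted right-continuous process $L^{\mathfrak{u},\nu}_{t,z}$ with $L^{\mathfrak{u},\nu}_{t,z}(s)\in L^1$ and $\operatorname{ess\,inf}_{\bar{\mathfrak{u}}\in\mathfrak{U}}\mathbb{E}[\ell(Z^{\mathfrak{u}\oplus_s\bar{\mathfrak{u}},\nu}_{t,z}(T))|\mathcal{F}_s]\ge L^{\mathfrak{u},\nu}_{t,z}(s)$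 $\mathbb{P}$-a.s. for all $s\in[t,T]$. Moreover $L^{\mathfrak{u},\nu_1}_{t,z}(s)=L^{\mathfrak{u},\nu_2}_{t,z}(s)$ $\mathbb{P}$-a.e. on $\{\nu_1=_{(0,s]}\nu_2\}$, for all $\mathfrak{u}\in\mathfrak{U}$, $\nu_1,\nu_2\in\mathcal{V}$. **Conditions (R)**, for all $(t,z)\in[0,T]\times\mathcal{Z}$: (R1) For every $s\in[t,T]$ and $\varepsilon>0$ there exist a Borel-measurable partition $(B_j)_{j\ge1}$ of $\mathcal{Z}$ and a sequence $(z_j)_{j\ge1}\subset\mathcal{Z}$ such that for all $\mathfrak{u}\in\mathfrak{U}$, $\nu\in\mathcal{V}$, $j\ge1$, $\mathbb{P}$-a.s. on $\{Z^{\mathfrak{u},\nu}_{t,z}(s)\in B_j\}$: $\mathbb{E}[\ell(Z^{\mathfrak{u},\nu}_{t,z}(T))|\mathcal{F}_s]\ge I(s,z_j,\mathfrak{u},\nu)-\varepsilon$; $\ \operatorname{ess\,inf}_{\bar\nu\in\mathcal{V}}\mathbb{E}[\ell(Z^{\mathfrak{u},\nu\oplus_s\bar\nu}_{t,z}(T))|\mathcal{F}_s]\le J(s,z_j,\mathfrak{u}[\nu\oplus_s\cdot])+\varepsilon$; $\ K(s,z_j)-\varepsilon\le K(s,Z^{\mathfrak{u},\nu}_{t,z}(s))\le K(s,z_j)+\varepsilon$. (R2) $\lim_{\delta\to0}\sup_{\nu\in\mathcal{V},\tau\in\mathcal{T}_t}\mathbb{P}\{\sup_{0\le h\le\delta}d_{\mathcal{Z}}(Z^{\mathfrak{u},\nu}_{t,z}(\tau+h),Z^{\mathfrak{u},\nu}_{t,z}(\tau))\ge\varepsilon\}=0$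 for all $\mathfrak{u}\in\mathfrak{U}$, $\varepsilon>0$ (where $\tau+h$ is read as $(\tau+h)\wedge T$).
   Formalization: In (C4) the equality of the events on {ν₁ =_(0,t] ν₂} is required only up to P-null sets (as in (C5)), so (C4) puts more families into 𝔉_t; with equality for every ω, (GDP2) can fail because (Z2) and (C5) hold only almost surely. *)

theory Defs
  imports "HOL-Probability.Probability"
begin

text \<open>The library has \<^const>\<open>esssup\<close> for the essential supremum of one function; the definitions
  below are the essential infimum and supremum of a family of random variables, i.e. its
  greatest lower (least upper) bound for the a.s. order. It is an extended-real random variable
  that exists in every probability space and is unique up to a null set; every use below
  is insensitive to the version that is chosen.\<close>

definition is_ess_inf :: "'w measure \<Rightarrow> 'i set \<Rightarrow> ('i \<Rightarrow> 'w \<Rightarrow> ereal) \<Rightarrow> ('w \<Rightarrow> ereal) \<Rightarrow> bool" where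
  "is_ess_inf P I X Y \<longleftrightarrow> Y \<in> borel_measurable P \<and> (\<forall>i\<in>I. AE \<omega> in P. Y \<omega> \<le> X i \<omega>) \<and>
    (\<forall>Y'\<in>borel_measurable P. (\<forall>i\<in>I. AE \<omega> in P. Y' \<omega> \<le> X i \<omega>) \<longrightarrow> (AE \<omega> in P. Y' \<omega> \<le> Y \<omega>))"

definition ess_inf :: "'w measure \<Rightarrow> 'i set \<Rightarrow> ('i \<Rightarrow> 'w \<Rightarrow> ereal) \<Rightarrow> 'w \<Rightarrow> ereal" where
  "ess_inf P I X = (SOME Y. is_ess_inf P I X Y)"

definition is_ess_sup :: "'w measure \<Rightarrow> 'i set \<Rightarrow> ('i \<Rightarrow> 'w \<Rightarrow> ereal) \<Rightarrow> ('w \<Rightarrow> ereal) \<Rightarrow> bool" where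
  "is_ess_sup P I X Y \<longleftrightarrow> Y \<in> borel_measurable P \<and> (\<forall>i\<in>I. AE \<omega> in P. X i \<omega> \<le> Y \<omega>) \<and>
    (\<forall>Y'\<in>borel_measurable P. (\<forall>i\<in>I. AE \<omega> in P. X i \<omega> \<le> Y' \<omega>) \<longrightarrow> (AE \<omega> in P. Y \<omega> \<le> Y' \<omega>))"

definition ess_sup :: "'w measure \<Rightarrow> 'i set \<Rightarrow> ('i \<Rightarrow> 'w \<Rightarrow> ereal) \<Rightarrow> 'w \<Rightarrow> ereal" where
  "ess_sup P I X = (SOME Y. is_ess_sup P I X Y)"

definition uniformly_integrable :: "'w measure \<Rightarrow> ('w \<Rightarrow> real) set \<Rightarrow> bool" where
  "uniformly_integrable P XS \<longleftrightarrow> XS \<subseteq> borel_measurable P \<and>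
    ((\<lambda>c. SUP X\<in>XS. \<integral>\<^sup>+\<omega>\<in>{\<omega>. c < \<bar>X \<omega>\<bar>}. ennreal \<bar>X \<omega>\<bar> \<partial>P) \<longlongrightarrow> 0) at_top"

definition right_cont_on :: "real \<Rightarrow> real \<Rightarrow> (real \<Rightarrow> 'a::topological_space) \<Rightarrow> bool" where
  "right_cont_on a b f \<longleftrightarrow> (\<forall>s\<in>{a..<b}. (f \<longlongrightarrow> f s) (at_right s))"

definition cadlag_on :: "real \<Rightarrow> real \<Rightarrow> (real \<Rightarrow> 'a::topological_space) \<Rightarrow> bool" where
  "cadlag_on a b f \<longleftrightarrow> right_cont_on a b f \<and> (\<forall>s\<in>{a<..b}. \<exists>l. (f \<longlongrightarrow> l) (at_left s))"


text \<open>A control is a process, written as a function of the pair \<open>(s, \<omega>)\<close>. To have one HOL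
  function per process, strategy or family, these are extensional functions (\<open>\<rightarrow>\<^sub>E\<close>): controls on
  \<open>[0,T] \<times> \<Omega>\<close>, strategies and families on the set of controls of the second player.\<close>

type_synonym ('w, 'a) control = "real \<times> 'w \<Rightarrow> 'a"
type_synonym ('w, 'u, 'v) strategy = "('w, 'v) control \<Rightarrow> ('w, 'u) control"

record ('w, 'u, 'v, 'z) target_game =
  horizon :: real
  Prob :: "'w measure"
  Filt :: "real \<Rightarrow> 'w measure"
  Uvals :: "'u set"
  Vvals :: "'v set"
  Uctrls :: "('w, 'u) control set"
  Vctrls :: "('w, 'v) control set"
  strats :: "('w, 'u, 'v) strategy set"
  state :: "real \<Rightarrow> 'z \<Rightarrow> ('w, 'u) control \<Rightarrow> ('w, 'v) control \<Rightarrow> real \<Rightarrow> 'w \<Rightarrow> 'z"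
    \<comment> \<open>\<open>state G t z \<mu> \<nu>\<close> is the process \<open>Z\<close> with start \<open>(t,z)\<close> under the pair of controls \<open>\<mu>, \<nu>\<close>\<close>
  loss :: "'z \<Rightarrow> real"
  mart_fams :: "real \<Rightarrow> real \<Rightarrow> (('w, 'v) control \<Rightarrow> real \<Rightarrow> 'w \<Rightarrow> real) set"
  event_fams :: "real \<Rightarrow> (('w, 'v) control \<Rightarrow> 'w set) set"
  time_fams :: "real \<Rightarrow> (('w, 'v) control \<Rightarrow> 'w \<Rightarrow> real) set"

definition adapted_on ::
    "('w, 'u, 'v, 'z) target_game \<Rightarrow> real \<Rightarrow> (real \<Rightarrow> 'w \<Rightarrow> 'a::topological_space) \<Rightarrow> bool" where
  "adapted_on G a X \<longleftrightarrow> (\<forall>s\<in>{a..horizon G}. X s \<in> Filt G s \<rightarrow>\<^sub>M borel)"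

text \<open>\<^const>\<open>stopping_time\<close> quantifies over all real times; for a time with values in
  \<open>[t,T]\<close> the conditions at times outside \<open>[t,T]\<close> hold trivially.\<close>

definition stop_times :: "('w, 'u, 'v, 'z) target_game \<Rightarrow> real \<Rightarrow> ('w \<Rightarrow> real) set" where
  "stop_times G t = {\<tau>. stopping_time (Filt G) \<tau> \<and> \<tau> \<in> space (Prob G) \<rightarrow> {t..horizon G}}"

definition marts ::
    "('w, 'u, 'v, 'z) target_game \<Rightarrow> real \<Rightarrow> real \<Rightarrow> (real \<Rightarrow> 'w \<Rightarrow> real) set" where
  "marts G t p = {M. adapted_on G 0 M \<and>
     (\<forall>s\<in>{0..horizon G}. integrable (Prob G) (M s)) \<and>
     (\<forall>s\<in>{0..horizon G}. \<forall>r\<in>{s..horizon G}.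
        AE \<omega> in Prob G. real_cond_exp (Prob G) (Filt G s) (M r) \<omega> = M s \<omega>) \<and>
     (\<forall>\<omega>\<in>space (Prob G). right_cont_on 0 (horizon G) (\<lambda>s. M s \<omega>)) \<and>
     (AE \<omega> in Prob G. M t \<omega> = p)}"

definition class_D :: "('w, 'u, 'v, 'z) target_game \<Rightarrow> real \<Rightarrow> (real \<Rightarrow> 'w \<Rightarrow> real) \<Rightarrow> bool" where
  "class_D G t X \<longleftrightarrow> uniformly_integrable (Prob G) ((\<lambda>\<tau> \<omega>. X (\<tau> \<omega>) \<omega>) ` stop_times G t)"

definition usual_conditions :: "('w, 'u, 'v, 'z) target_game \<Rightarrow> bool" where
  "usual_conditions G \<longleftrightarrow> complete_measure (Prob G) \<and> null_sets (Prob G) \<subseteq> sets (Filt G 0) \<and>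
    (\<forall>s\<in>{0..<horizon G}. sets (Filt G s) = (\<Inter>r\<in>{s<..horizon G}. sets (Filt G r)))"

abbreviation Zproc ::
    "('w, 'u, 'v, 'z) target_game \<Rightarrow> real \<Rightarrow> 'z \<Rightarrow> ('w, 'u, 'v) strategy \<Rightarrow> ('w, 'v) control
      \<Rightarrow> real \<Rightarrow> 'w \<Rightarrow> 'z" where
  "Zproc G t z u \<nu> \<equiv> state G t z (u \<nu>) \<nu>"

text \<open>The processes started at time \<open>t\<close> are only constrained on \<open>[t,T]\<close>. The library's
  \<^locale>\<open>filtration\<close> is indexed by the whole real line; a filtration on \<open>[0,T]\<close> extends to it by
  constants, and its values outside \<open>[0,T]\<close> play no role.\<close>

definition game_setting :: "('w, 'u, 'v, 'z::metric_space) target_game \<Rightarrow> bool" where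
  "game_setting G \<longleftrightarrow>
     0 < horizon G \<and> prob_space (Prob G) \<and> filtration (space (Prob G)) (Filt G) \<and>
     (\<forall>s\<in>{0..horizon G}. subalgebra (Prob G) (Filt G s)) \<and> usual_conditions G \<and>
     Uctrls G \<subseteq> ({0..horizon G} \<times> space (Prob G)) \<rightarrow>\<^sub>E Uvals G \<and>
     Vctrls G \<subseteq> ({0..horizon G} \<times> space (Prob G)) \<rightarrow>\<^sub>E Vvals G \<and>
     strats G \<subseteq> Vctrls G \<rightarrow>\<^sub>E Uctrls G \<and>
     loss G \<in> borel_measurable borel \<and>
     (\<forall>t\<in>{0..horizon G}. \<forall>z. \<forall>u\<in>strats G. \<forall>\<nu>\<in>Vctrls G.
        adapted_on G t (Zproc G t z u \<nu>) \<and>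
        (\<forall>\<omega>\<in>space (Prob G). cadlag_on t (horizon G) (\<lambda>s. Zproc G t z u \<nu> s \<omega>) \<and>
           Zproc G t z u \<nu> t \<omega> = z) \<and>
        integrable (Prob G) (\<lambda>\<omega>. loss G (Zproc G t z u \<nu> (horizon G) \<omega>))) \<and>
     (\<forall>t\<in>{0..horizon G}. \<forall>p. mart_fams G t p \<subseteq> Vctrls G \<rightarrow>\<^sub>E marts G t p) \<and>
     (\<forall>t\<in>{0..horizon G}. event_fams G t \<subseteq> Vctrls G \<rightarrow>\<^sub>E sets (Filt G t)) \<and>
     (\<forall>t\<in>{0..horizon G}. time_fams G t \<subseteq> Vctrls G \<rightarrow>\<^sub>E stop_times G t) \<and>
     (\<forall>t\<in>{0..horizon G}. \<forall>s\<in>{t..horizon G}. (\<lambda>\<nu>\<in>Vctrls G. \<lambda>\<omega>. s) \<in> time_fams G t)"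

definition exp_loss ::
    "('w, 'u, 'v, 'z) target_game \<Rightarrow> real \<Rightarrow> real \<Rightarrow> 'z \<Rightarrow> ('w, 'u, 'v) strategy \<Rightarrow> ('w, 'v) control
      \<Rightarrow> 'w \<Rightarrow> real" where
    \<comment> \<open>the conditional expectation of the terminal loss given \<open>\<F>\<^sub>s\<close>, for the start \<open>(t,z)\<close>\<close>
  "exp_loss G s t z u \<nu> =
     real_cond_exp (Prob G) (Filt G s) (\<lambda>\<omega>. loss G (Zproc G t z u \<nu> (horizon G) \<omega>))"

definition Iloss ::
    "('w, 'u, 'v, 'z) target_game \<Rightarrow> real \<Rightarrow> 'z \<Rightarrow> ('w, 'u, 'v) strategy \<Rightarrow> ('w, 'v) control
      \<Rightarrow> 'w \<Rightarrow> real" where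
  "Iloss G t z u \<nu> = exp_loss G t t z u \<nu>"

definition Jloss ::
    "('w, 'u, 'v, 'z) target_game \<Rightarrow> real \<Rightarrow> 'z \<Rightarrow> ('w, 'u, 'v) strategy \<Rightarrow> 'w \<Rightarrow> ereal" where
  "Jloss G t z u = ess_inf (Prob G) (Vctrls G) (\<lambda>\<nu> \<omega>. ereal (Iloss G t z u \<nu> \<omega>))"

definition Lam :: "('w, 'u, 'v, 'z) target_game \<Rightarrow> real \<Rightarrow> ('z \<times> real) set" where
  "Lam G t = {(z, p). \<exists>u\<in>strats G. AE \<omega> in Prob G. ereal p \<le> Jloss G t z u \<omega>}"

definition Lam_bar :: "('w, 'u, 'v, 'z::metric_space) target_game \<Rightarrow> real \<Rightarrow> ('z \<times> real) set" where
  "Lam_bar G t = {(z, p). \<exists>(tn :: nat \<Rightarrow> real) zn pn.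
     (\<lambda>n. (tn n, zn n, pn n)) \<longlonglongrightarrow> (t, z, p) \<and>
     (\<forall>n. tn n \<in> {t..horizon G} \<and> (zn n, pn n) \<in> Lam G (tn n))}"

definition Lam_iota ::
    "('w, 'u, 'v, 'z::metric_space) target_game \<Rightarrow> real \<Rightarrow> real \<Rightarrow> ('z \<times> real) set" where
  "Lam_iota G \<iota> t = {(z, p). \<forall>t'\<in>{0..horizon G}. \<forall>z' p'.
     dist z z' + \<bar>p - p'\<bar> + \<bar>t - t'\<bar> < \<iota> \<longrightarrow> (z', p') \<in> Lam G t'}"


definition concat_at :: "real \<Rightarrow> ('w, 'a) control \<Rightarrow> ('w, 'a) control \<Rightarrow> ('w, 'a) control" where
  "concat_at s \<nu> \<nu>' = (\<lambda>(r, \<omega>). if r \<le> s then \<nu> (r, \<omega>) else \<nu>' (r, \<omega>))"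

definition mix_on :: "'w set \<Rightarrow> ('w, 'a) control \<Rightarrow> ('w, 'a) control \<Rightarrow> ('w, 'a) control" where
  "mix_on A \<nu> \<nu>' = (\<lambda>(r, \<omega>). if \<omega> \<in> A then \<nu> (r, \<omega>) else \<nu>' (r, \<omega>))"

definition paste :: "(nat \<Rightarrow> ('w, 'a) control) \<Rightarrow> (nat \<Rightarrow> 'w set) \<Rightarrow> ('w, 'a) control" where
    \<comment> \<open>the sum \<open>\<Sum>\<^sub>j \<nu>\<^sub>j 1\<^bsub>A\<^sub>j\<^esub>\<close> for a partition \<open>(A\<^sub>j)\<close>; no addition is needed on the set of values\<close>
  "paste \<nu>s A = (\<lambda>(r, \<omega>). \<nu>s (THE j. \<omega> \<in> A j) (r, \<omega>))"

definition agree ::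
    "('w, 'u, 'v, 'z) target_game \<Rightarrow> real \<Rightarrow> real \<Rightarrow> ('w, 'a) control \<Rightarrow> ('w, 'a) control \<Rightarrow> 'w set" where
  "agree G a b \<nu> \<nu>' = {\<omega>\<in>space (Prob G). \<forall>r\<in>{a<..b}. \<nu> (r, \<omega>) = \<nu>' (r, \<omega>)}"

definition strat_concat ::
    "('w, 'u, 'v, 'z) target_game \<Rightarrow> real \<Rightarrow> ('w, 'u, 'v) strategy \<Rightarrow> ('w, 'u, 'v) strategy
      \<Rightarrow> ('w, 'u, 'v) strategy" where
  "strat_concat G s u u' = (\<lambda>\<nu>\<in>Vctrls G. concat_at s (u \<nu>) (u' \<nu>))"

definition strat_after ::
    "('w, 'u, 'v, 'z) target_game \<Rightarrow> real \<Rightarrow> ('w, 'u, 'v) strategy \<Rightarrow> ('w, 'v) control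
      \<Rightarrow> ('w, 'u, 'v) strategy" where
    \<comment> \<open>\<open>u[\<nu> \<oplus>\<^sub>s \<cdot>]\<close>\<close>
  "strat_after G s u \<nu> = (\<lambda>\<nu>'\<in>Vctrls G. u (concat_at s \<nu> \<nu>'))"


definition C1 :: "('w, 'u, 'v, 'z) target_game \<Rightarrow> bool" where
  "C1 G \<longleftrightarrow> (\<forall>t\<in>{0..horizon G}. \<forall>\<nu>0\<in>Vctrls G. \<forall>\<nu>1\<in>Vctrls G. \<forall>\<nu>2\<in>Vctrls G. \<forall>A\<in>sets (Filt G t).
     concat_at t \<nu>0 (mix_on A \<nu>1 \<nu>2) \<in> Vctrls G)"

definition C2 :: "('w, 'u, 'v, 'z) target_game \<Rightarrow> bool" where
    \<comment> \<open>members of the partitions may be empty\<close>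
  "C2 G \<longleftrightarrow> (\<forall>t\<in>{0..horizon G}. \<forall>u0\<in>strats G.
     \<forall>(u :: nat \<Rightarrow> ('w, 'u, 'v) strategy) (A :: nat \<Rightarrow> ('w, 'v) control \<Rightarrow> 'w set).
     (\<forall>j. u j \<in> strats G) \<and> (\<forall>j. A j \<in> event_fams G t) \<and>
     (\<forall>\<nu>\<in>Vctrls G. disjoint_family (\<lambda>j. A j \<nu>) \<and> (\<Union>j. A j \<nu>) = space (Prob G)) \<longrightarrow>
     (\<lambda>\<nu>\<in>Vctrls G. concat_at t (u0 \<nu>) (paste (\<lambda>j. u j \<nu>) (\<lambda>j. A j \<nu>))) \<in> strats G)"

definition C3 :: "('w, 'u, 'v, 'z) target_game \<Rightarrow> bool" where
  "C3 G \<longleftrightarrow> (\<forall>t\<in>{0..horizon G}. \<forall>u\<in>strats G. \<forall>\<nu>\<in>Vctrls G. strat_after G t u \<nu> \<in> strats G)"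

text \<open>As everywhere in this setting, the equality of the two events in \<open>C4\<close> is understood up to a
  null set. This is how \<open>C5\<close> is stated and how \<open>C4\<close> is used: the events it is meant for, such as
  \<open>{Z(s) \<in> B}\<close>, are functions of processes that by \<open>Z2\<close> and \<open>Z3\<close> agree almost everywhere on the
  set where the controls coincide, but not for every \<open>\<omega>\<close> in it.\<close>

definition C4 :: "('w, 'u, 'v, 'z) target_game \<Rightarrow> bool" where
  "C4 G \<longleftrightarrow> (\<forall>t\<in>{0..horizon G}. \<forall>A \<in> Vctrls G \<rightarrow>\<^sub>E sets (Filt G t).
     (\<forall>\<nu>1\<in>Vctrls G. \<forall>\<nu>2\<in>Vctrls G. AE \<omega> in Prob G.
        \<omega> \<in> A \<nu>1 \<inter> agree G 0 t \<nu>1 \<nu>2 \<longleftrightarrow> \<omega> \<in> A \<nu>2 \<inter> agree G 0 t \<nu>1 \<nu>2) \<longrightarrow>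
     A \<in> event_fams G t)"

definition C5 :: "('w, 'u, 'v, 'z) target_game \<Rightarrow> bool" where
  "C5 G \<longleftrightarrow> (\<forall>t\<in>{0..horizon G}. \<forall>\<tau>\<in>time_fams G t. \<forall>\<nu>1\<in>Vctrls G. \<forall>\<nu>2\<in>Vctrls G.
     \<forall>s\<in>{t..horizon G}. AE \<omega> in Prob G.
       \<omega> \<in> {\<omega>. \<tau> \<nu>1 \<omega> \<le> s} \<inter> agree G 0 s \<nu>1 \<nu>2 \<longleftrightarrow> \<omega> \<in> {\<omega>. \<tau> \<nu>2 \<omega> \<le> s} \<inter> agree G 0 s \<nu>1 \<nu>2)"

definition C6 :: "('w, 'u, 'v, 'z) target_game \<Rightarrow> bool" where
  "C6 G \<longleftrightarrow> (\<forall>t\<in>{0..horizon G}. \<forall>\<tau>\<in>time_fams G t. \<forall>s1 s2. t \<le> s1 \<and> s1 \<le> s2 \<and> s2 \<le> horizon G \<longrightarrow>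
     (\<lambda>\<nu>\<in>Vctrls G. {\<omega>\<in>space (Prob G). \<tau> \<nu> \<omega> \<in> {s1<..s2}}) \<in> event_fams G s2 \<and>
     (\<lambda>\<nu>\<in>Vctrls G. {\<omega>\<in>space (Prob G). \<tau> \<nu> \<omega> \<notin> {s1<..s2}}) \<in> event_fams G s2)"

definition Z1 :: "('w, 'u, 'v, 'z) target_game \<Rightarrow> bool" where
  "Z1 G \<longleftrightarrow> (\<forall>t\<in>{0..horizon G}. \<forall>z. \<forall>s\<in>{t..horizon G}.
     \<forall>\<nu>\<in>Vctrls G. \<forall>u1\<in>strats G. \<forall>u2\<in>strats G. AE \<omega> in Prob G.
       \<omega> \<in> agree G t s (u1 \<nu>) (u2 \<nu>) \<longrightarrow> Zproc G t z u1 \<nu> s \<omega> = Zproc G t z u2 \<nu> s \<omega>)"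

definition Z2 :: "('w, 'u, 'v, 'z) target_game \<Rightarrow> bool" where
  "Z2 G \<longleftrightarrow> (\<forall>t\<in>{0..horizon G}. \<forall>z. \<forall>s\<in>{t..horizon G}.
     \<forall>u\<in>strats G. \<forall>\<nu>1\<in>Vctrls G. \<forall>\<nu>2\<in>Vctrls G. AE \<omega> in Prob G.
       \<omega> \<in> agree G 0 s \<nu>1 \<nu>2 \<longrightarrow> Zproc G t z u \<nu>1 s \<omega> = Zproc G t z u \<nu>2 s \<omega>)"

definition Z3 :: "('w, 'u, 'v, 'z) target_game \<Rightarrow> bool" where
  "Z3 G \<longleftrightarrow> (\<forall>t\<in>{0..horizon G}. \<forall>p. \<forall>s\<in>{t..horizon G}.
     \<forall>M\<in>mart_fams G t p. \<forall>\<nu>1\<in>Vctrls G. \<forall>\<nu>2\<in>Vctrls G. AE \<omega> in Prob G.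
       \<omega> \<in> agree G 0 s \<nu>1 \<nu>2 \<longrightarrow> M \<nu>1 s \<omega> = M \<nu>2 s \<omega>)"

text \<open>The constants \<open>K(t,z)\<close> are an explicit argument because \<open>R1\<close> refers to them; \<open>Z4\<close>
  determines them uniquely for \<open>t \<in> [0,T]\<close>. The processes \<open>L\<close> of \<open>I2\<close> are an explicit argument
  because the uniform integrability assumption of the theorem refers to them.\<close>

definition Z4 :: "('w, 'u, 'v, 'z) target_game \<Rightarrow> (real \<Rightarrow> 'z \<Rightarrow> real) \<Rightarrow> bool" where
  "Z4 G K \<longleftrightarrow> (\<forall>t\<in>{0..horizon G}. \<forall>z. AE \<omega> in Prob G.
     ess_sup (Prob G) (strats G)
       (\<lambda>u. ess_inf (Prob G) (Vctrls G) (\<lambda>\<nu> \<omega>. ereal (exp_loss G t t z u \<nu> \<omega>))) \<omega> = ereal (K t z))"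

definition I1 :: "('w, 'u, 'v, 'z) target_game \<Rightarrow> bool" where
  "I1 G \<longleftrightarrow> (\<forall>t\<in>{0..horizon G}. \<forall>z. \<forall>u\<in>strats G. \<forall>\<nu>\<in>Vctrls G. \<exists>N.
     adapted_on G t N \<and> (\<forall>\<omega>\<in>space (Prob G). right_cont_on t (horizon G) (\<lambda>s. N s \<omega>)) \<and>
     class_D G t N \<and>
     (\<forall>s\<in>{t..horizon G}. AE \<omega> in Prob G.
        ess_inf (Prob G) (Vctrls G) (\<lambda>\<nu>' \<omega>. ereal (exp_loss G s t z u (concat_at s \<nu> \<nu>') \<omega>)) \<omega>
          \<ge> ereal (N s \<omega>)))"

definition I2 ::
    "('w, 'u, 'v, 'z) target_game
      \<Rightarrow> (real \<Rightarrow> 'z \<Rightarrow> ('w, 'u, 'v) strategy \<Rightarrow> ('w, 'v) control \<Rightarrow> real \<Rightarrow> 'w \<Rightarrow> real) \<Rightarrow> bool" where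
  "I2 G L \<longleftrightarrow> (\<forall>t\<in>{0..horizon G}. \<forall>z. \<forall>u\<in>strats G.
     (\<forall>\<nu>\<in>Vctrls G.
        adapted_on G t (L t z u \<nu>) \<and>
        (\<forall>\<omega>\<in>space (Prob G). right_cont_on t (horizon G) (\<lambda>s. L t z u \<nu> s \<omega>)) \<and>
        (\<forall>s\<in>{t..horizon G}. integrable (Prob G) (L t z u \<nu> s) \<and>
           (AE \<omega> in Prob G.
              ess_inf (Prob G) (strats G)
                (\<lambda>u' \<omega>. ereal (exp_loss G s t z (strat_concat G s u u') \<nu> \<omega>)) \<omega>
              \<ge> ereal (L t z u \<nu> s \<omega>)))) \<and>
     (\<forall>\<nu>1\<in>Vctrls G. \<forall>\<nu>2\<in>Vctrls G. \<forall>s\<in>{t..horizon G}. AE \<omega> in Prob G.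
        \<omega> \<in> agree G 0 s \<nu>1 \<nu>2 \<longrightarrow> L t z u \<nu>1 s \<omega> = L t z u \<nu>2 s \<omega>))"

definition R1 ::
    "('w, 'u, 'v, 'z::metric_space) target_game \<Rightarrow> (real \<Rightarrow> 'z \<Rightarrow> real) \<Rightarrow> bool" where
  "R1 G K \<longleftrightarrow> (\<forall>t\<in>{0..horizon G}. \<forall>z. \<forall>s\<in>{t..horizon G}. \<forall>\<epsilon>>0.
     \<exists>(B :: nat \<Rightarrow> 'z set) (zs :: nat \<Rightarrow> 'z).
       range B \<subseteq> sets borel \<and> disjoint_family B \<and> (\<Union>j. B j) = UNIV \<and>
       (\<forall>u\<in>strats G. \<forall>\<nu>\<in>Vctrls G. \<forall>j. AE \<omega> in Prob G. Zproc G t z u \<nu> s \<omega> \<in> B j \<longrightarrow>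
          exp_loss G s t z u \<nu> \<omega> \<ge> Iloss G s (zs j) u \<nu> \<omega> - \<epsilon> \<and>
          ess_inf (Prob G) (Vctrls G) (\<lambda>\<nu>' \<omega>. ereal (exp_loss G s t z u (concat_at s \<nu> \<nu>') \<omega>)) \<omega>
            \<le> Jloss G s (zs j) (strat_after G s u \<nu>) \<omega> + ereal \<epsilon> \<and>
          K s (zs j) - \<epsilon> \<le> K s (Zproc G t z u \<nu> s \<omega>) \<and>
          K s (Zproc G t z u \<nu> s \<omega>) \<le> K s (zs j) + \<epsilon>))"

text \<open>The probability in \<open>R2\<close> is written as an outer probability. It coincides with the probability
  whenever the set is an event; for a nonseparable state space it need not be one, and with \<^const>\<open>measure\<close>
  a non-measurable set would silently have probability 0.\<close>

definition R2 :: "('w, 'u, 'v, 'z::metric_space) target_game \<Rightarrow> bool" where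
  "R2 G \<longleftrightarrow> (\<forall>t\<in>{0..horizon G}. \<forall>z. \<forall>u\<in>strats G. \<forall>\<epsilon>>0.
     ((\<lambda>\<delta>. SUP (\<nu>, \<tau>) \<in> Vctrls G \<times> stop_times G t.
         outer_measure_of (Prob G) {\<omega>\<in>space (Prob G).
           (SUP h\<in>{0..\<delta>}. ennreal (dist (Zproc G t z u \<nu> (min (\<tau> \<omega> + h) (horizon G)) \<omega>)
                                         (Zproc G t z u \<nu> (\<tau> \<omega>) \<omega>))) \<ge> ennreal \<epsilon>})
       \<longlongrightarrow> 0) (at_right 0))"

end

theory Submission
  imports Defs
begin

text \<open>Write \<open>S\<^sup>\<nu>(s)\<close> for the essential infimum over \<open>\<nu>'\<close> of the conditional expected loss when the second
  player switches from \<open>\<nu>\<close> to \<open>\<nu>'\<close> at time \<open>s\<close>. The family is directed downwards by (C1), so \<open>S\<^sup>\<nu>\<close> is a submartingale, and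
  it is of class (D) by (I1). As in the existence proof of the Doob-Meyer decomposition, the discrete
  Doob martingales on dyadic grids lie below \<open>S\<^sup>\<nu>\<close>, and Komlos-type convex combinations of their terminal
  values converge in \<open>L\<^sup>1\<close> to a martingale below \<open>S\<^sup>\<nu>\<close> at all dyadic times. Since \<open>K(t,z)\<close> is deterministic, \<open>(z,p)\<close> belongs
  to \<open>\<Lambda>(t)\<close> if \<open>p < K(t,z)\<close> and only if \<open>p \<le> K(t,z)\<close>, and (R1) gives \<open>S\<^sup>\<nu>(s) \<le> K(s,Z(s))\<close>. So the right-continuous
  version \<open>M\<^sup>\<nu>\<close> satisfies \<open>M\<^sup>\<nu>(s) \<le> K(s,Z(s))\<close> simultaneously for all dyadic \<open>s\<close>, and approximating \<open>\<tau>(\<omega>)\<close> from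
  the right by dyadic times puts \<open>(Z(\<tau>), M\<^sup>\<nu>(\<tau>))\<close> into \<open>\<Lambda>\<close>-bar; this is the first half.

  For the second half, \<open>\<tau>\<^sup>\<nu>\<close> is rounded up to a dyadic grid and the strategy is switched there, according to
  the cell of the partition of (R1) that contains the state, to an almost optimal one. By (R2) the state
  has barely moved outside an event of small probability, where the uniform integrability assumptions
  control the loss. This bounds the expected loss from below by \<open>p\<close> minus a small constant for every \<open>\<nu>\<close>; a bound in
  expectation is enough because \<open>K(t,z)\<close> is deterministic.\<close>

subsection \<open>Essential infima and suprema\<close>

text \<open>Conditional expectations and essential infima are determined only up to null sets that
  depend on the time, and neither \<open>S\<^sup>\<nu>\<close> nor \<open>K\<close> comes with any
  regularity in time. Hence almost sure statements are made simultaneous on countable dyadic sets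
  only, (R1) is applied only at deterministic grid times, and continuous time is reached solely
  through the right-continuity of the martingale and of the state. For the same reason the
  decomposition is carried out on finite grids: it asks for no regular version of the submartingale,
  and the nonnegativity of the compensators, which is what puts the martingale below
  \<open>S\<^sup>\<nu>\<close>, survives convex combinations and limits in \<open>L\<^sup>1\<close>.

  In the second half the switched strategy has to stay nonanticipating: by (Z2) and (C5) the
  switching events depend only on the past of the control, up to null sets, and (C4) then admits
  them. On the small event left over by (R2), the process \<open>L\<close> bounds the loss from
  below and the positive part of the martingale is given up; this is where the two uniform
  integrability assumptions enter.\<close>

lemma is_ess_inf_unique:
  assumes "is_ess_inf P I X Y" "is_ess_inf P I X Y'"
  shows "AE w in P. Y w = Y' w"
proof -
  have "AE w in P. Y w \<le> Y' w" "AE w in P. Y' w \<le> Y w"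
    using assms unfolding is_ess_inf_def by blast+
  then show ?thesis by eventually_elim auto
qed

text \<open>Exhaustion: the measures of countable unions of members have a supremum, which is
  attained by merging countably many nearly optimal sequences into one. A further member cannot add
  mass to the optimal union, so it is covered up to a null set.\<close>

lemma (in finite_measure) essential_union:
  fixes A :: "'i \<Rightarrow> 'a set"
  assumes A: "\<And>i. i \<in> I \<Longrightarrow> A i \<in> sets M" and I: "I \<noteq> {}"
  shows "\<exists>f::nat \<Rightarrow> 'i. range f \<subseteq> I \<and>
    (\<forall>i\<in>I. AE w in M. w \<in> A i \<longrightarrow> (\<exists>n. w \<in> A (f n)))"
proof -
  define m where "m f = measure M (\<Union>n::nat. A (f n))" for f
  define \<F> where "\<F> = {f::nat \<Rightarrow> 'i. range f \<subseteq> I}"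
  define s where "s = (SUP f\<in>\<F>. m f)"
  obtain i0 where "i0 \<in> I" using I by auto
  then have ne: "\<F> \<noteq> {}" unfolding \<F>_def by (auto intro!: exI[of _ "\<lambda>_. i0"])
  have meas: "(\<Union>n. A (f n)) \<in> sets M" if "f \<in> \<F>" for f
    using that A unfolding \<F>_def by auto
  have bdd: "bdd_above (m ` \<F>)"
    unfolding bdd_above_def m_def by (auto intro!: exI[of _ "measure M (space M)"] bounded_measure)
  have le: "m f \<le> s" if "f \<in> \<F>" for f
    unfolding s_def using bdd that by (rule cSUP_upper2) simp
  have "\<exists>f\<in>\<F>. s - 1 / real (Suc k) < m f" for k
    using less_cSUP_iff[OF ne bdd, of "s - 1 / real (Suc k)"] unfolding s_def by simp
  then obtain F where F: "F k \<in> \<F>" "s - 1 / real (Suc k) < m (F k)" for k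
    by metis
  define g where "g n = F (fst (prod_decode n)) (snd (prod_decode n))" for n
  have g: "g \<in> \<F>" using F(1) unfolding \<F>_def g_def by (auto simp: image_subset_iff)
  have sub: "(\<Union>n. A (F k n)) \<subseteq> (\<Union>n. A (g n))" for k
  proof
    fix x assume "x \<in> (\<Union>n. A (F k n))"
    then obtain n where "x \<in> A (F k n)" by auto
    then have "x \<in> A (g (prod_encode (k,n)))" by (simp add: g_def)
    then show "x \<in> (\<Union>n. A (g n))" by auto
  qed
  have "s - 1 / real (Suc k) < m g" for k
    using F(2)[of k] finite_measure_mono[OF sub meas[OF g], of k] unfolding m_def by linarith
  then have mg: "s \<le> m g"
  proof (intro LIMSEQ_le_const2)
    show "(\<lambda>k. s - 1 / real (Suc k)) \<longlonglongrightarrow> s"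
      using tendsto_diff[OF tendsto_const LIMSEQ_inverse_real_of_nat, of s] by (simp add: inverse_eq_divide)
  qed (auto intro: less_imp_le)
  have "AE w in M. w \<in> A i \<longrightarrow> (\<exists>n. w \<in> A (g n))" if i: "i \<in> I" for i
  proof -
    \<comment> \<open>Prepend \<open>i\<close> to the optimal sequence; the union cannot gain
      measure, so the part of \<open>A i\<close> outside the old union is null.\<close>
    define h where "h = case_nat i g"
    have h: "h \<in> \<F>" using g i unfolding h_def \<F>_def by (auto simp: image_subset_iff split: nat.splits)
    have un: "(\<Union>n. A (h n)) = A i \<union> (\<Union>n. A (g n))"
    proof -
      have "(\<Union>n. A (h n)) = A (h 0) \<union> (\<Union>n. A (h (Suc n)))"
        by (metis (no_types) UN_absorb UNIV_nat_eq UN_insert image_image)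
      then show ?thesis by (simp add: h_def)
    qed
    have "measure M (\<Union>n. A (h n)) = measure M (\<Union>n. A (g n)) + measure M (A i - (\<Union>n. A (g n)))"
      unfolding un using finite_measure_Union[of "\<Union>n. A (g n)" "A i - (\<Union>n. A (g n))"] meas[OF g] A[OF i]
      by (auto simp: Un_commute)
    then have "measure M (A i - (\<Union>n. A (g n))) = 0"
      using le[OF h] mg measure_nonneg[of M "A i - (\<Union>n. A (g n))"] unfolding m_def by linarith
    then have "A i - (\<Union>n. A (g n)) \<in> null_sets M"
      using meas[OF g] A[OF i] by (auto simp: null_sets_def emeasure_eq_measure)
    from AE_not_in[OF this] show ?thesis by eventually_elim auto
  qed
  with g show ?thesis unfolding \<F>_def by blast
qed

text \<open>Rational level sets reduce the order on functions to inclusion of sets: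
  \<open>essential_union\<close> supplies one sequence per level, and together these are still
  countable. If \<open>X i\<close> were below the infimum of the merged sequence, a rational between
  the two would be undercut by a member of the sequence.\<close>

lemma (in finite_measure) ess_inf_countable:
  fixes X :: "'i \<Rightarrow> 'a \<Rightarrow> ereal"
  assumes X: "\<And>i. i \<in> I \<Longrightarrow> X i \<in> borel_measurable M" and I: "I \<noteq> {}"
  shows "\<exists>f::nat \<Rightarrow> 'i. range f \<subseteq> I \<and> is_ess_inf M I X (\<lambda>w. INF n. X (f n) w)"
proof -
  have "\<exists>f::nat \<Rightarrow> 'i. range f \<subseteq> I \<and>
    (\<forall>i\<in>I. AE w in M. w \<in> {w\<in>space M. X i w < ereal (real_of_rat q)} \<longrightarrow>
       (\<exists>n. w \<in> {w\<in>space M. X (f n) w < ereal (real_of_rat q)}))" for q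
    using X I by (intro essential_union) auto
  then have "\<exists>F::rat \<Rightarrow> nat \<Rightarrow> 'i. \<forall>q. range (F q) \<subseteq> I \<and>
    (\<forall>i\<in>I. AE w in M. w \<in> {w\<in>space M. X i w < ereal (real_of_rat q)} \<longrightarrow>
       (\<exists>n. w \<in> {w\<in>space M. X (F q n) w < ereal (real_of_rat q)}))"
    by (intro choice allI)
  then obtain F :: "rat \<Rightarrow> nat \<Rightarrow> 'i" where F: "\<And>q. range (F q) \<subseteq> I"
    "\<And>q i. i \<in> I \<Longrightarrow> AE w in M. w \<in> {w\<in>space M. X i w < ereal (real_of_rat q)} \<longrightarrow>
       (\<exists>n. w \<in> {w\<in>space M. X (F q n) w < ereal (real_of_rat q)})"
    by blast
  define f where "f n = F (fst (from_nat n :: rat \<times> nat)) (snd (from_nat n :: rat \<times> nat))" for n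
  have f: "range f \<subseteq> I" using F(1) unfolding f_def by auto
  have lower: "AE w in M. (INF n. X (f n) w) \<le> X i w" if i: "i \<in> I" for i
  proof -
    have "AE w in M. \<forall>q. w \<in> {w\<in>space M. X i w < ereal (real_of_rat q)} \<longrightarrow>
       (\<exists>n. w \<in> {w\<in>space M. X (F q n) w < ereal (real_of_rat q)})"
      unfolding AE_all_countable using F(2)[OF i] by blast
    then show ?thesis
      using AE_space
    proof eventually_elim
      case (elim w)
      show ?case
      proof (rule ccontr)
        assume "\<not> ?thesis"
        then obtain q where q: "X i w < ereal (real_of_rat q)" "ereal (real_of_rat q) < (INF n. X (f n) w)"
          using ereal_dense3[of "X i w" "INF n. X (f n) w"] by (auto simp: not_le)
        then obtain n where n: "X (F q n) w < ereal (real_of_rat q)" using elim by auto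
        have "f (to_nat (q, n)) = F q n" unfolding f_def by simp
        then have "(INF n. X (f n) w) \<le> X (F q n) w" by (metis INF_lower UNIV_I)
        with n q(2) show False by auto
      qed
    qed
  qed
  have meas: "(\<lambda>w. INF n. X (f n) w) \<in> borel_measurable M"
    using X f by (intro borel_measurable_INF) auto
  have "AE w in M. Y' w \<le> (INF n. X (f n) w)" if "\<forall>i\<in>I. AE w in M. Y' w \<le> X i w" for Y'
  proof -
    have "AE w in M. \<forall>n. Y' w \<le> X (f n) w"
      unfolding AE_all_countable using that f by auto
    then show ?thesis by eventually_elim (auto intro: INF_greatest)
  qed
  then show ?thesis unfolding is_ess_inf_def using f lower meas by blast
qed

lemma (in finite_measure) ess_inf_is_ess_inf:
  assumes "\<And>i. i \<in> I \<Longrightarrow> X i \<in> borel_measurable M" "I \<noteq> {}"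
  shows "is_ess_inf M I X (ess_inf M I X)"
proof -
  obtain Y where "is_ess_inf M I X Y" using ess_inf_countable[of I X] assms by blast
  then show ?thesis unfolding ess_inf_def by (rule someI[of "is_ess_inf M I X"])
qed

text \<open>Serves to show that both players have at least one choice: an empty infimum or supremum
  is infinite, while the constants \<open>K\<close> of (Z4) are real.\<close>

lemma ess_inf_empty:
  assumes "I = {}"
  shows "AE w in M. ess_inf M I X w = \<infinity>"
proof -
  have top: "is_ess_inf M I X (\<lambda>_. \<infinity>)" unfolding is_ess_inf_def using assms by auto
  then have "is_ess_inf M I X (ess_inf M I X)" unfolding ess_inf_def by (rule someI[of "is_ess_inf M I X"])
  from is_ess_inf_unique[OF this top] show ?thesis .
qed

lemma ereal_le_uminus_iff: "x \<le> - y \<longleftrightarrow> y \<le> - x" for x y :: ereal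
  by (metis ereal_minus_le_minus ereal_uminus_uminus)

lemma is_ess_sup_uminus:
  "is_ess_sup P I X Y \<longleftrightarrow> is_ess_inf P I (\<lambda>i w. - X i w) (\<lambda>w. - Y w)"
proof -
  have "(\<forall>Y'\<in>borel_measurable P. (\<forall>i\<in>I. AE \<omega> in P. X i \<omega> \<le> Y' \<omega>) \<longrightarrow> (AE \<omega> in P. Y \<omega> \<le> Y' \<omega>)) \<longleftrightarrow>
    (\<forall>Y'\<in>borel_measurable P. (\<forall>i\<in>I. AE \<omega> in P. Y' \<omega> \<le> - X i \<omega>) \<longrightarrow> (AE \<omega> in P. Y' \<omega> \<le> - Y \<omega>))"
    (is "?l \<longleftrightarrow> ?r")
  proof
    assume l: ?l
    show ?r
    proof (intro ballI impI)
      fix Y' :: "'a \<Rightarrow> ereal" assume [measurable]: "Y' \<in> borel_measurable P" and *: "\<forall>i\<in>I. AE \<omega> in P. Y' \<omega> \<le> - X i \<omega>"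
      have "AE \<omega> in P. Y \<omega> \<le> - Y' \<omega>"
        using * by (intro l[rule_format]) (auto simp: ereal_le_uminus_iff[of "X _ _"])
      then show "AE \<omega> in P. Y' \<omega> \<le> - Y \<omega>" by (simp add: ereal_le_uminus_iff[of "Y _"])
    qed
  next
    assume r: ?r
    show ?l
    proof (intro ballI impI)
      fix Y' :: "'a \<Rightarrow> ereal" assume [measurable]: "Y' \<in> borel_measurable P" and *: "\<forall>i\<in>I. AE \<omega> in P. X i \<omega> \<le> Y' \<omega>"
      have "AE \<omega> in P. - Y' \<omega> \<le> - Y \<omega>"
        using * by (intro r[rule_format]) auto
      then show "AE \<omega> in P. Y \<omega> \<le> Y' \<omega>" by simp
    qed
  qed
  then show ?thesis unfolding is_ess_sup_def is_ess_inf_def by simp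
qed

lemma is_ess_sup_unique:
  assumes "is_ess_sup P I X Y" "is_ess_sup P I X Y'"
  shows "AE w in P. Y w = Y' w"
  using is_ess_inf_unique[OF assms[unfolded is_ess_sup_uminus]] by simp

lemma (in finite_measure) ess_sup_countable:
  fixes X :: "'i \<Rightarrow> 'a \<Rightarrow> ereal"
  assumes X: "\<And>i. i \<in> I \<Longrightarrow> X i \<in> borel_measurable M" and I: "I \<noteq> {}"
  shows "\<exists>f::nat \<Rightarrow> 'i. range f \<subseteq> I \<and> is_ess_sup M I X (\<lambda>w. SUP n. X (f n) w)"
proof -
  have *: "(\<lambda>w. X i w) \<in> borel_measurable M" if "i \<in> I" for i using X[OF that] .
  obtain f :: "nat \<Rightarrow> 'i" where "range f \<subseteq> I" "is_ess_inf M I (\<lambda>i w. - X i w) (\<lambda>w. INF n. - X (f n) w)"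
    using ess_inf_countable[of I "\<lambda>i w. - X i w"] * I by (auto intro: borel_measurable_uminus_ereal)
  then show ?thesis unfolding is_ess_sup_uminus ereal_INF_uminus_eq by blast
qed

lemma (in finite_measure) ess_sup_is_ess_sup:
  assumes "\<And>i. i \<in> I \<Longrightarrow> X i \<in> borel_measurable M" "I \<noteq> {}"
  shows "is_ess_sup M I X (ess_sup M I X)"
proof -
  obtain Y where "is_ess_sup M I X Y" using ess_sup_countable[of I X] assms by blast
  then show ?thesis unfolding ess_sup_def by (rule someI[of "is_ess_sup M I X"])
qed

lemma ess_sup_empty:
  assumes "I = {}"
  shows "AE w in M. ess_sup M I X w = -\<infinity>"
proof -
  have bot: "is_ess_sup M I X (\<lambda>_. -\<infinity>)" unfolding is_ess_sup_def using assms by auto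
  then have "is_ess_sup M I X (ess_sup M I X)" unfolding ess_sup_def by (rule someI[of "is_ess_sup M I X"])
  from is_ess_sup_unique[OF this bot] show ?thesis .
qed

text \<open>The countable family that realises the essential infimum is made decreasing by replacing
  each member with one that lies below it and below its predecessor.\<close>

lemma (in finite_measure) ess_inf_directed:
  fixes X :: "'i \<Rightarrow> 'a \<Rightarrow> real"
  assumes X: "\<And>i. i \<in> I \<Longrightarrow> X i \<in> borel_measurable M" and I: "I \<noteq> {}"
    and dir: "\<And>i j. i \<in> I \<Longrightarrow> j \<in> I \<Longrightarrow> \<exists>k\<in>I. AE w in M. X k w \<le> X i w \<and> X k w \<le> X j w"
  shows "\<exists>f::nat \<Rightarrow> 'i. range f \<subseteq> I \<and> (AE w in M. decseq (\<lambda>n. X (f n) w) \<and>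
     (\<lambda>n. ereal (X (f n) w)) \<longlonglongrightarrow> ess_inf M I (\<lambda>i w. ereal (X i w)) w)"
proof -
  define E where "E = ess_inf M I (\<lambda>i w. ereal (X i w))"
  have mX: "(\<lambda>w. ereal (X i w)) \<in> borel_measurable M" if "i \<in> I" for i
    using X[OF that] by measurable
  obtain f :: "nat \<Rightarrow> 'i" where f: "range f \<subseteq> I" "is_ess_inf M I (\<lambda>i w. ereal (X i w)) (\<lambda>w. INF n. ereal (X (f n) w))"
    using ess_inf_countable[of I "\<lambda>i w. ereal (X i w)"] mX I by blast
  have E: "is_ess_inf M I (\<lambda>i w. ereal (X i w)) E"
    unfolding E_def using mX I by (intro ess_inf_is_ess_inf)
  obtain k where k: "\<And>i j. i \<in> I \<Longrightarrow> j \<in> I \<Longrightarrow> k i j \<in> I \<and> (AE w in M. X (k i j) w \<le> X i w \<and> X (k i j) w \<le> X j w)"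
    using dir by metis
  define g where "g = rec_nat (f 0) (\<lambda>n y. k y (f (Suc n)))"
  have g0: "g 0 = f 0" and gS: "g (Suc n) = k (g n) (f (Suc n))" for n by (auto simp: g_def)
  have gI: "g n \<in> I" for n
    by (induction n) (use f k in \<open>auto simp: g0 gS\<close>)
  have "AE w in M. \<forall>n. X (g (Suc n)) w \<le> X (g n) w \<and> X (g (Suc n)) w \<le> X (f (Suc n)) w"
    unfolding AE_all_countable gS using k gI f by blast
  moreover have "AE w in M. \<forall>n. E w \<le> ereal (X (g n) w)"
    unfolding AE_all_countable using gI E by (auto simp: is_ess_inf_def)
  moreover have "AE w in M. E w = (INF n. ereal (X (f n) w))"
    using is_ess_inf_unique[OF E f(2)] .
  ultimately have "AE w in M. decseq (\<lambda>n. X (g n) w) \<and> (\<lambda>n. ereal (X (g n) w)) \<longlonglongrightarrow> E w"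
  proof eventually_elim
    case (elim w)
    have dec: "decseq (\<lambda>n. X (g n) w)" using elim(1) by (auto intro: decseq_SucI)
    have le: "X (g n) w \<le> X (f n) w" for n
      by (cases n) (use elim(1) g0 in auto)
    have "(INF n. ereal (X (g n) w)) = E w"
    proof (rule antisym)
      show "(INF n. ereal (X (g n) w)) \<le> E w"
        unfolding elim(3) by (rule INF_mono) (use le in auto)
      show "E w \<le> (INF n. ereal (X (g n) w))" using elim(2) by (auto intro: INF_greatest)
    qed
    moreover have "(\<lambda>n. ereal (X (g n) w)) \<longlonglongrightarrow> (INF n. ereal (X (g n) w))"
      using dec by (intro LIMSEQ_INF) (auto simp: decseq_def)
    ultimately show ?case using dec by simp
  qed
  then show ?thesis using gI unfolding E_def by blast
qed

subsection \<open>Uniform integrability\<close>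

text \<open>The excess \<open>max 0 (\<bar>f x\<bar> - c)\<close> measures tails in place of the
  integral of \<open>\<bar>f x\<bar>\<close> over \<open>{\<bar>f x\<bar> > c}\<close>. Being convex
  and continuous in \<open>f x\<close>, it passes through conditional expectations, midpoints and
  almost sure limits.\<close>

lemma (in finite_measure) integrable_excess:
  fixes f :: "'a \<Rightarrow> real"
  assumes [measurable]: "integrable M f"
  shows "integrable M (\<lambda>x. max 0 (\<bar>f x\<bar> - c))"
  by (rule Bochner_Integration.integrable_bound[of _ "\<lambda>x. \<bar>f x\<bar> + \<bar>c\<bar>"]) (use assms in auto)

lemma (in finite_measure) excess_small:
  fixes f :: "'a \<Rightarrow> real"
  assumes f: "integrable M f" and e: "e > 0"
  shows "\<exists>c\<ge>0. (\<integral>x. max 0 (\<bar>f x\<bar> - c) \<partial>M) \<le> e"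
proof -
  have [measurable]: "f \<in> borel_measurable M" using f by auto
  have "(\<lambda>n::nat. \<integral>x. max 0 (\<bar>f x\<bar> - real n) \<partial>M) \<longlonglongrightarrow> (\<integral>x. 0 \<partial>M)"
  proof (rule integral_dominated_convergence[where w="\<lambda>x. \<bar>f x\<bar>"])
    show "AE x in M. (\<lambda>n::nat. max 0 (\<bar>f x\<bar> - real n)) \<longlonglongrightarrow> 0"
    proof (rule AE_I2, rule tendsto_eventually)
      fix x
      obtain N :: nat where "\<bar>f x\<bar> \<le> real N" using real_arch_simple by blast
      then show "\<forall>\<^sub>F n in sequentially. max 0 (\<bar>f x\<bar> - real n) = 0"
        by (auto intro!: eventually_sequentiallyI[of N])
    qed
  qed (use f in auto)
  then have "\<forall>\<^sub>F n::nat in sequentially. (\<integral>x. max 0 (\<bar>f x\<bar> - real n) \<partial>M) < e"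
    using e by (auto dest: order_tendstoD(2))
  then obtain n :: nat where "(\<integral>x. max 0 (\<bar>f x\<bar> - real n) \<partial>M) < e"
    using eventually_happens by fastforce
  then show ?thesis by (intro exI[of _ "real n"]) auto
qed

text \<open>Pointwise, \<open>\<bar>f x\<bar>\<close> is at most its excess over \<open>c\<close>
  plus \<open>c\<close>. With a common \<open>c\<close> this bounds the integrals of a whole family
  over an event of small probability.\<close>

lemma (in finite_measure) set_integral_le_excess:
  fixes f :: "'a \<Rightarrow> real"
  assumes f: "integrable M f" and B: "B \<in> sets M" and c: "c \<ge> 0"
  shows "(\<integral>x\<in>B. \<bar>f x\<bar> \<partial>M) \<le> (\<integral>x. max 0 (\<bar>f x\<bar> - c) \<partial>M) + c * measure M B"
proof -
  have "(\<integral>x\<in>B. \<bar>f x\<bar> \<partial>M) \<le> (\<integral>x. max 0 (\<bar>f x\<bar> - c) + c * indicator B x \<partial>M)"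
    unfolding set_lebesgue_integral_def
  proof (rule integral_mono)
    show "integrable M (\<lambda>x. indicat_real B x *\<^sub>R \<bar>f x\<bar>)"
      using integrable_real_mult_indicator[OF B, of "\<lambda>x. \<bar>f x\<bar>"] f by (simp add: mult.commute)
    show "integrable M (\<lambda>x. max 0 (\<bar>f x\<bar> - c) + c * indicat_real B x)"
      using integrable_excess[OF f] B by (auto simp: emeasure_eq_measure)
  qed (auto simp: indicator_def)
  also have "\<dots> = (\<integral>x. max 0 (\<bar>f x\<bar> - c) \<partial>M) + c * measure M B"
    using integrable_excess[OF f] B by (subst Bochner_Integration.integral_add) (auto simp: emeasure_eq_measure)
  finally show ?thesis .
qed

lemma (in finite_measure) uniformly_integrable_excess:
  assumes ui: "uniformly_integrable M XS" and e: "e > 0"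
  shows "\<exists>c\<ge>0. \<forall>X\<in>XS. integrable M X \<and> (\<integral>x. max 0 (\<bar>X x\<bar> - c) \<partial>M) \<le> e"
proof -
  define \<Phi> where "\<Phi> c = (SUP X\<in>XS. \<integral>\<^sup>+\<omega>\<in>{\<omega>. c < \<bar>X \<omega>\<bar>}. ennreal \<bar>X \<omega>\<bar> \<partial>M)" for c
  have "(\<Phi> \<longlongrightarrow> 0) at_top" using ui unfolding uniformly_integrable_def \<Phi>_def by blast
  then have "\<forall>\<^sub>F c in at_top. \<Phi> c < ennreal e" using e by (auto dest!: order_tendstoD(2)[where a="ennreal e"])
  then have "\<forall>\<^sub>F c in at_top. \<Phi> c < ennreal e \<and> (0::real) \<le> c"
    using eventually_ge_at_top[of 0] by eventually_elim auto
  then obtain c :: real where c: "\<Phi> c < ennreal e" "c \<ge> 0"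
    using eventually_happens by fastforce
  have "integrable M X \<and> (\<integral>x. max 0 (\<bar>X x\<bar> - c) \<partial>M) \<le> e" if X: "X \<in> XS" for X
  proof -
    have [measurable]: "X \<in> borel_measurable M" using ui X unfolding uniformly_integrable_def by blast
    have "(\<integral>\<^sup>+\<omega>\<in>{\<omega>. c < \<bar>X \<omega>\<bar>}. ennreal \<bar>X \<omega>\<bar> \<partial>M) \<le> \<Phi> c"
      unfolding \<Phi>_def using X by (rule SUP_upper)
    then have small: "(\<integral>\<^sup>+\<omega>\<in>{\<omega>. c < \<bar>X \<omega>\<bar>}. ennreal \<bar>X \<omega>\<bar> \<partial>M) < ennreal e" using c(1) by simp
    have "(\<integral>\<^sup>+\<omega>. ennreal (norm (X \<omega>)) \<partial>M) \<le> (\<integral>\<^sup>+\<omega>. ennreal \<bar>X \<omega>\<bar> * indicator {\<omega>. c < \<bar>X \<omega>\<bar>} \<omega> + ennreal c \<partial>M)"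
      by (rule nn_integral_mono) (auto simp: indicator_def intro!: ennreal_leI)
    also have "\<dots> = (\<integral>\<^sup>+\<omega>\<in>{\<omega>. c < \<bar>X \<omega>\<bar>}. ennreal \<bar>X \<omega>\<bar> \<partial>M) + ennreal c * emeasure M (space M)"
      by (subst nn_integral_add) auto
    also have "\<dots> < \<infinity>" using small by (auto simp: emeasure_eq_measure ennreal_mult_less_top intro: less_trans)
    finally have int: "integrable M X" by (intro integrableI_bounded) auto
    have "ennreal (\<integral>x. max 0 (\<bar>X x\<bar> - c) \<partial>M) = (\<integral>\<^sup>+x. ennreal (max 0 (\<bar>X x\<bar> - c)) \<partial>M)"
      using integrable_excess[OF int] by (subst nn_integral_eq_integral) auto
    also have "\<dots> \<le> (\<integral>\<^sup>+\<omega>\<in>{\<omega>. c < \<bar>X \<omega>\<bar>}. ennreal \<bar>X \<omega>\<bar> \<partial>M)"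
      using c(2) by (intro nn_integral_mono) (auto simp: indicator_def max_def intro!: ennreal_leI)
    also have "\<dots> \<le> ennreal e" using small by simp
    finally show ?thesis using int e by (simp add: ennreal_le_iff)
  qed
  then show ?thesis using c(2) by blast
qed

text \<open>Vitali's convergence theorem. Fatou's lemma passes the excess bound on to the limit;
  clipping to \<open>[-c, c]\<close> costs at most the two excesses, and the clipped functions
  converge by dominated convergence.\<close>

lemma (in finite_measure) vitali_excess:
  fixes f :: "nat \<Rightarrow> 'a \<Rightarrow> real"
  assumes int: "\<And>n. integrable M (f n)" and [measurable]: "g \<in> borel_measurable M"
    and lim: "AE x in M. (\<lambda>n. f n x) \<longlonglongrightarrow> g x"
    and ui: "\<And>e. e > 0 \<Longrightarrow> \<exists>c\<ge>0. \<forall>n. (\<integral>x. max 0 (\<bar>f n x\<bar> - c) \<partial>M) \<le> e"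
  shows "integrable M g" "(\<lambda>n. \<integral>x. \<bar>f n x - g x\<bar> \<partial>M) \<longlonglongrightarrow> 0"
proof -
  have [measurable]: "f n \<in> borel_measurable M" for n using int by auto
  have tail: "(\<integral>\<^sup>+x. ennreal (max 0 (\<bar>g x\<bar> - c)) \<partial>M) \<le> ennreal e"
    if c: "\<forall>n. (\<integral>x. max 0 (\<bar>f n x\<bar> - c) \<partial>M) \<le> e" for c e
  proof -
    have "(\<integral>\<^sup>+x. ennreal (max 0 (\<bar>g x\<bar> - c)) \<partial>M) = (\<integral>\<^sup>+x. liminf (\<lambda>n. ennreal (max 0 (\<bar>f n x\<bar> - c))) \<partial>M)"
    proof (rule nn_integral_cong_AE, use lim in eventually_elim)
      case (elim x)
      have "(\<lambda>n. ennreal (max 0 (\<bar>f n x\<bar> - c))) \<longlonglongrightarrow> ennreal (max 0 (\<bar>g x\<bar> - c))"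
        by (intro tendsto_ennrealI tendsto_intros elim)
      then show ?case by (simp add: lim_imp_Liminf)
    qed
    also have "\<dots> \<le> liminf (\<lambda>n. \<integral>\<^sup>+x. ennreal (max 0 (\<bar>f n x\<bar> - c)) \<partial>M)"
      by (rule nn_integral_liminf) auto
    also have "\<dots> \<le> liminf (\<lambda>n::nat. ennreal e)"
    proof (rule Liminf_mono, rule always_eventually, rule allI)
      fix n
      have "(\<integral>\<^sup>+x. ennreal (max 0 (\<bar>f n x\<bar> - c)) \<partial>M) = ennreal (\<integral>x. max 0 (\<bar>f n x\<bar> - c) \<partial>M)"
        using integrable_excess[OF int] by (subst nn_integral_eq_integral) auto
      then show "(\<integral>\<^sup>+x. ennreal (max 0 (\<bar>f n x\<bar> - c)) \<partial>M) \<le> ennreal e"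
        using c by (auto intro: ennreal_leI)
    qed
    finally show ?thesis by (simp add: Liminf_const)
  qed
  show g: "integrable M g"
  proof -
    obtain c where c: "c \<ge> 0" "\<forall>n. (\<integral>x. max 0 (\<bar>f n x\<bar> - c) \<partial>M) \<le> 1" using ui[of 1] by auto
    have "(\<integral>\<^sup>+x. ennreal (norm (g x)) \<partial>M) \<le> (\<integral>\<^sup>+x. ennreal (max 0 (\<bar>g x\<bar> - c)) + ennreal c \<partial>M)"
      using c(1) by (intro nn_integral_mono) (auto simp: max_def ennreal_plus[symmetric] simp del: ennreal_plus intro!: ennreal_leI)
    also have "\<dots> = (\<integral>\<^sup>+x. ennreal (max 0 (\<bar>g x\<bar> - c)) \<partial>M) + ennreal c * emeasure M (space M)"
      by (subst nn_integral_add) auto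
    also have "\<dots> < \<infinity>" using tail[OF c(2)] by (auto simp: emeasure_eq_measure ennreal_mult_less_top intro: le_less_trans)
    finally show ?thesis by (intro integrableI_bounded) auto
  qed
  show "(\<lambda>n. \<integral>x. \<bar>f n x - g x\<bar> \<partial>M) \<longlonglongrightarrow> 0"
  proof (rule LIMSEQ_I)
    fix e :: real assume e: "e > 0"
    obtain c where c: "c \<ge> 0" "\<forall>n. (\<integral>x. max 0 (\<bar>f n x\<bar> - c) \<partial>M) \<le> e / 4" using ui[of "e/4"] e by auto
    have gt: "(\<integral>x. max 0 (\<bar>g x\<bar> - c) \<partial>M) \<le> e / 4"
    proof -
      have "ennreal (\<integral>x. max 0 (\<bar>g x\<bar> - c) \<partial>M) \<le> ennreal (e/4)"
        using tail[OF c(2)] integrable_excess[OF g] by (subst nn_integral_eq_integral[symmetric]) auto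
      then show ?thesis using e by (simp add: ennreal_le_iff)
    qed
    define cl where "cl x = max (- c) (min c x)" for x :: real
    have [measurable]: "cl \<in> borel_measurable borel" unfolding cl_def by measurable
    have cl_bd: "\<bar>cl x\<bar> \<le> c" for x using c(1) by (auto simp: cl_def)
    have cl_split: "\<bar>x - y\<bar> \<le> \<bar>cl x - cl y\<bar> + (max 0 (\<bar>x\<bar> - c) + max 0 (\<bar>y\<bar> - c))" for x y
      using c(1) unfolding cl_def by (auto simp: max_def min_def abs_if)
    have cl_diff: "\<bar>cl x - cl y\<bar> \<le> 2 * c" for x y using cl_bd[of x] cl_bd[of y] by linarith
    have icl: "integrable M (\<lambda>x. \<bar>cl (f n x) - cl (g x)\<bar>)" for n
      by (rule integrable_const_bound[where B="2*c"]) (auto intro!: AE_I2 simp: cl_diff)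
    have "(\<lambda>n. \<integral>x. \<bar>cl (f n x) - cl (g x)\<bar> \<partial>M) \<longlonglongrightarrow> (\<integral>x. 0 \<partial>M)"
    proof (rule integral_dominated_convergence[where w="\<lambda>x. 2*c"])
      show "AE x in M. (\<lambda>n. \<bar>cl (f n x) - cl (g x)\<bar>) \<longlonglongrightarrow> 0"
        using lim
      proof eventually_elim
        case (elim x)
        have "(\<lambda>n. \<bar>cl (f n x) - cl (g x)\<bar>) \<longlonglongrightarrow> \<bar>cl (g x) - cl (g x)\<bar>"
          unfolding cl_def by (intro tendsto_intros elim)
        then show ?case by simp
      qed
      show "AE x in M. norm \<bar>cl (f n x) - cl (g x)\<bar> \<le> 2 * c" for n
        by (auto intro!: AE_I2 simp: cl_diff)
    qed auto
    then have "\<forall>\<^sub>F n in sequentially. (\<integral>x. \<bar>cl (f n x) - cl (g x)\<bar> \<partial>M) < e / 4"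
      using e by (auto dest!: order_tendstoD(2)[where a="e/4"])
    then obtain N where N: "\<And>n. n \<ge> N \<Longrightarrow> (\<integral>x. \<bar>cl (f n x) - cl (g x)\<bar> \<partial>M) < e / 4"
      unfolding eventually_sequentially by blast
    have "norm ((\<integral>x. \<bar>f n x - g x\<bar> \<partial>M) - 0) < e" if n: "n \<ge> N" for n
    proof -
      have "(\<integral>x. \<bar>f n x - g x\<bar> \<partial>M) \<le> (\<integral>x. \<bar>cl (f n x) - cl (g x)\<bar> + (max 0 (\<bar>f n x\<bar> - c) + max 0 (\<bar>g x\<bar> - c)) \<partial>M)"
        using icl int g integrable_excess cl_split
        by (intro integral_mono) auto
      also have "\<dots> = (\<integral>x. \<bar>cl (f n x) - cl (g x)\<bar> \<partial>M) + ((\<integral>x. max 0 (\<bar>f n x\<bar> - c) \<partial>M) + (\<integral>x. max 0 (\<bar>g x\<bar> - c) \<partial>M))"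
        using icl int g integrable_excess by simp
      also have "\<dots> < e" using N[OF n] c(2)[rule_format, of n] gt e by linarith
      finally show ?thesis by (simp add: integral_nonneg_AE)
    qed
    then show "\<exists>no. \<forall>n\<ge>no. norm ((\<integral>x. \<bar>f n x - g x\<bar> \<partial>M) - 0) < e" by blast
  qed
qed

lemma set_integral_tendsto_L1:
  fixes f :: "nat \<Rightarrow> 'a \<Rightarrow> real"
  assumes int: "\<And>n. integrable M (f n)" "integrable M g"
    and lim: "(\<lambda>n. \<integral>x. \<bar>f n x - g x\<bar> \<partial>M) \<longlonglongrightarrow> 0" and B: "B \<in> sets M"
  shows "(\<lambda>n. \<integral>x\<in>B. f n x \<partial>M) \<longlonglongrightarrow> (\<integral>x\<in>B. g x \<partial>M)"
proof -
  have i: "integrable M (\<lambda>x. indicat_real B x *\<^sub>R h x)" if "integrable M h" for h :: "'a \<Rightarrow> real"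
    using integrable_real_mult_indicator[OF B that] by (simp add: mult.commute)
  have "\<bar>(\<integral>x\<in>B. f n x \<partial>M) - (\<integral>x\<in>B. g x \<partial>M)\<bar> \<le> (\<integral>x. \<bar>f n x - g x\<bar> \<partial>M)" for n
  proof -
    have "(\<integral>x\<in>B. f n x \<partial>M) - (\<integral>x\<in>B. g x \<partial>M) = (\<integral>x\<in>B. f n x - g x \<partial>M)"
      unfolding set_lebesgue_integral_def using i[OF int(1)[of n]] i[OF int(2)]
      by (simp add: right_diff_distrib)
    also have "\<bar>\<dots>\<bar> \<le> (\<integral>x. \<bar>indicat_real B x *\<^sub>R (f n x - g x)\<bar> \<partial>M)"
      unfolding set_lebesgue_integral_def using integral_norm_bound by fastforce
    also have "\<dots> \<le> (\<integral>x. \<bar>f n x - g x\<bar> \<partial>M)"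
      using i int by (intro integral_mono integrable_abs) (auto simp: indicator_def)
    finally show ?thesis .
  qed
  then have "(\<lambda>n. (\<integral>x\<in>B. f n x \<partial>M) - (\<integral>x\<in>B. g x \<partial>M)) \<longlonglongrightarrow> 0"
    by (intro tendsto_rabs_zero_cancel[OF real_tendsto_sandwich[OF _ _ tendsto_const lim]]) auto
  then show ?thesis by (simp add: LIM_zero_iff)
qed

lemma (in finite_measure) sigma_finite_subalgebraI:
  "subalgebra M F \<Longrightarrow> sigma_finite_subalgebra M F"
  by (intro finite_measure_subalgebra_is_sigma_finite finite_measure_subalgebra.intro
      finite_measure_subalgebra_axioms.intro finite_measure_axioms)

lemma convex_on_excess: "convex_on UNIV (\<lambda>x::real. max 0 (\<bar>x\<bar> - c))"
proof (rule convex_onI)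
  fix t x y :: real assume t: "0 < t" "t < 1"
  have *: "(1 - t) * a + t * b \<le> (1 - t) * max 0 a + t * max 0 b" for a b
    using t by (intro add_mono mult_left_mono) auto
  have "\<bar>(1 - t) * x + t * y\<bar> \<le> (1 - t) * \<bar>x\<bar> + t * \<bar>y\<bar>"
    using t abs_triangle_ineq[of "(1 - t) * x" "t * y"] by (simp add: abs_mult)
  then have "\<bar>(1 - t) * x + t * y\<bar> - c \<le> (1 - t) * (\<bar>x\<bar> - c) + t * (\<bar>y\<bar> - c)"
    by (simp add: algebra_simps)
  moreover have "0 \<le> (1 - t) * max 0 (\<bar>x\<bar> - c) + t * max 0 (\<bar>y\<bar> - c)" using t by simp
  ultimately show "max 0 (\<bar>(1 - t) *\<^sub>R x + t *\<^sub>R y\<bar> - c) \<le> (1 - t) * max 0 (\<bar>x\<bar> - c) + t * max 0 (\<bar>y\<bar> - c)"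
    using *[of "\<bar>x\<bar> - c" "\<bar>y\<bar> - c"] by simp
qed simp

text \<open>Jensen's inequality for the convex excess, localised to \<open>B\<close>. It makes all
  conditional expectations of one variable uniformly integrable, and \<open>c = 0\<close> gives the
  contraction property in \<open>L\<^sup>1\<close>.\<close>

lemma (in finite_measure) cond_exp_excess:
  assumes sub: "subalgebra M F" and f: "integrable M f" and B: "B \<in> sets F"
  shows "(\<integral>x\<in>B. max 0 (\<bar>real_cond_exp M F f x\<bar> - c) \<partial>M) \<le> (\<integral>x\<in>B. max 0 (\<bar>f x\<bar> - c) \<partial>M)"
proof -
  interpret sigma_finite_subalgebra M F by (rule sigma_finite_subalgebraI[OF sub])
  have BM: "B \<in> sets M" using B sub by (auto simp: subalgebra_def)
  have "AE x in M. max 0 (\<bar>real_cond_exp M F f x\<bar> - c) \<le> real_cond_exp M F (\<lambda>x. max 0 (\<bar>f x\<bar> - c)) x"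
    by (rule real_cond_exp_jensens_inequality(2)[OF f _ _ _ convex_on_excess])
       (use integrable_excess[OF f] in auto)
  then have "(\<integral>x\<in>B. max 0 (\<bar>real_cond_exp M F f x\<bar> - c) \<partial>M) \<le> (\<integral>x\<in>B. real_cond_exp M F (\<lambda>x. max 0 (\<bar>f x\<bar> - c)) x \<partial>M)"
    unfolding set_lebesgue_integral_def
    using integrable_mult_indicator[OF BM integrable_excess[OF real_cond_exp_int(1)[OF f]]]
      integrable_mult_indicator[OF BM real_cond_exp_int(1)[OF integrable_excess[OF f]]]
    by (intro integral_mono_AE) (auto elim: AE_mp simp: indicator_def)
  also have "\<dots> = (\<integral>x\<in>B. max 0 (\<bar>f x\<bar> - c) \<partial>M)"
    using real_cond_exp_intA[OF integrable_excess[OF f] B] by simp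
  finally show ?thesis .
qed

text \<open>The event \<open>{g < f}\<close> belongs to \<open>F\<close>; testing the assumption on
  it leaves a nonnegative function whose integral is at most zero.\<close>

lemma (in finite_measure) AE_le_of_set_integral_le:
  fixes f g :: "'a \<Rightarrow> real"
  assumes sub: "subalgebra M F" and int: "integrable M f" "integrable M g"
    and meas: "f \<in> borel_measurable F" "g \<in> borel_measurable F"
    and le: "\<And>B. B \<in> sets F \<Longrightarrow> (\<integral>x\<in>B. f x \<partial>M) \<le> (\<integral>x\<in>B. g x \<partial>M)"
  shows "AE x in M. f x \<le> g x"
proof -
  define B where "B = {x\<in>space F. g x < f x}"
  have B: "B \<in> sets F" unfolding B_def using meas by auto
  have BM: "B \<in> sets M" and sp: "space F = space M" using B sub by (auto simp: subalgebra_def)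
  have i: "integrable M (\<lambda>x. indicat_real B x * (f x - g x))"
    using integrable_mult_indicator[OF BM, of "\<lambda>x. f x - g x"] int by auto
  have "(\<integral>x. indicat_real B x * (f x - g x) \<partial>M) = (\<integral>x\<in>B. f x \<partial>M) - (\<integral>x\<in>B. g x \<partial>M)"
    unfolding set_lebesgue_integral_def
    using integrable_mult_indicator[OF BM int(1)] integrable_mult_indicator[OF BM int(2)]
    by (simp add: right_diff_distrib)
  moreover have nn: "AE x in M. 0 \<le> indicat_real B x * (f x - g x)"
    by (auto simp: B_def indicator_def)
  ultimately have "(\<integral>x. indicat_real B x * (f x - g x) \<partial>M) = 0"
    using le[OF B] integral_nonneg_AE[OF nn] by linarith
  then have "AE x in M. indicat_real B x * (f x - g x) = 0"
    using integral_nonneg_eq_0_iff_AE[OF i nn] by simp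
  then show ?thesis using AE_space
    by eventually_elim (auto simp: B_def sp indicator_def split: if_splits)
qed

subsection \<open>Convergence of convex combinations\<close>

text \<open>Midpoints suffice because the minimisation in \<open>komlos\<close> compares two
  near-minimisers only with their midpoint. Affine relations and convex bounds then pass to the hull
  by induction over two rules.\<close>

inductive_set mid_hull :: "('a \<Rightarrow> real) set \<Rightarrow> ('a \<Rightarrow> real) set" for S where
  base: "f \<in> S \<Longrightarrow> f \<in> mid_hull S"
| mid: "f \<in> mid_hull S \<Longrightarrow> g \<in> mid_hull S \<Longrightarrow> (\<lambda>x. (f x + g x) / 2) \<in> mid_hull S"

lemma mid_hull_mono: "f \<in> mid_hull S \<Longrightarrow> S \<subseteq> T \<Longrightarrow> f \<in> mid_hull T"
  by (induction rule: mid_hull.induct) (auto intro: mid_hull.intros)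

lemma exp_midpoint_gap:
  "exp (- x) + exp (- y) - 2 * exp (- ((x + y) / 2)) = (exp (- x / 2) - exp (- y / 2))\<^sup>2" for x y :: real
proof -
  have "exp (- x) = (exp (- x / 2))\<^sup>2" "exp (- y) = (exp (- y / 2))\<^sup>2"
    by (simp_all add: power2_eq_square flip: exp_add)
  moreover have "exp (- ((x + y) / 2)) = exp (- x / 2) * exp (- y / 2)"
    by (simp add: add_divide_distrib flip: exp_add)
  ultimately show ?thesis by (simp add: power2_eq_square algebra_simps)
qed

text \<open>Minimising \<open>\<integral> exp (- u)\<close> over the midpoint combinations \<open>u\<close> of the tails makes \<open>exp (- u / 2)\<close> a
  Cauchy sequence in \<open>L\<^sup>2\<close>, by the identity above. The exponential replaces the square of the Hilbert space
  argument because the \<open>f n\<close> are only integrable.\<close>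

lemma (in prob_space) komlos:
  fixes f :: "nat \<Rightarrow> 'a \<Rightarrow> real"
  assumes int: "\<And>n. integrable M (f n)" and nn: "\<And>n x. 0 \<le> f n x"
    and ui: "\<And>e. e > 0 \<Longrightarrow> \<exists>c\<ge>0. \<forall>n. (\<integral>x. max 0 (\<bar>f n x\<bar> - c) \<partial>M) \<le> e"
  shows "\<exists>g h. (\<forall>n. g n \<in> mid_hull (f ` {n..})) \<and> integrable M h \<and> (\<forall>n. integrable M (g n)) \<and>
    (\<lambda>n. \<integral>x. \<bar>g n x - h x\<bar> \<partial>M) \<longlonglongrightarrow> 0"
proof -
  define C where "C n = mid_hull (f ` {n..})" for n
  \<comment> \<open>Integrability, sign and excess bounds are preserved by midpoints, so the whole
    hull inherits them with the same constants.\<close>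
  have C_prop: "integrable M u \<and> (\<forall>x. 0 \<le> u x) \<and>
      (\<forall>c\<ge>0. \<forall>e. (\<forall>n. (\<integral>x. max 0 (\<bar>f n x\<bar> - c) \<partial>M) \<le> e) \<longrightarrow> (\<integral>x. max 0 (\<bar>u x\<bar> - c) \<partial>M) \<le> e)"
    if "u \<in> C n" for u n
    using that unfolding C_def
  proof (induction rule: mid_hull.induct)
    case (mid u v)
    have "(\<integral>x. max 0 (\<bar>(u x + v x)/2\<bar> - c) \<partial>M) \<le> e"
      if c: "c \<ge> 0" and e: "\<forall>n. (\<integral>x. max 0 (\<bar>f n x\<bar> - c) \<partial>M) \<le> e" for c e
    proof -
      have iu: "integrable M (\<lambda>x. max 0 (\<bar>u x\<bar> - c))" "integrable M (\<lambda>x. max 0 (\<bar>v x\<bar> - c))"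
        using mid by (auto intro: integrable_excess)
      have "(\<integral>x. max 0 (\<bar>(u x + v x)/2\<bar> - c) \<partial>M) \<le> (\<integral>x. (max 0 (\<bar>u x\<bar> - c) + max 0 (\<bar>v x\<bar> - c)) / 2 \<partial>M)"
        using mid iu by (intro integral_mono integrable_excess) (auto simp: max_def field_simps abs_if)
      also have "\<dots> = ((\<integral>x. max 0 (\<bar>u x\<bar> - c) \<partial>M) + (\<integral>x. max 0 (\<bar>v x\<bar> - c) \<partial>M)) / 2"
        using iu by simp
      also have "\<dots> \<le> (e + e) / 2" using mid c e by (intro divide_right_mono add_mono) auto
      finally show ?thesis by simp
    qed
    with mid show ?case by auto
  qed (use int nn in auto)
  have C_int: "integrable M u" and C_nn: "0 \<le> u x" if "u \<in> C n" for u n x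
    using C_prop[OF that] by blast+
  have C_mono: "C m \<subseteq> C n" if "n \<le> m" for m n
    unfolding C_def using that by (auto intro: mid_hull_mono)
  have C_ne: "C n \<noteq> {}" for n unfolding C_def by (auto intro: mid_hull.base)
  define \<phi> where "\<phi> u = (\<integral>x. exp (- u x) \<partial>M)" for u :: "'a \<Rightarrow> real"
  have exp_int: "integrable M (\<lambda>x. exp (- u x))" if "u \<in> C n" for u n
    using C_int[OF that] C_nn[OF that] by (intro integrable_const_bound[where B=1]) auto
  have phi0: "0 \<le> \<phi> u" for u unfolding \<phi>_def by (simp add: integral_nonneg_AE)
  have phi1: "\<phi> u \<le> 1" if "u \<in> C n" for u n
    unfolding \<phi>_def using exp_int[OF that] C_nn[OF that] integral_le_const[of "\<lambda>x. exp (- u x)" 1] by auto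
  define i where "i n = (INF u\<in>C n. \<phi> u)" for n
  have bdd: "bdd_below (\<phi> ` C n)" for n using phi0 by (auto simp: bdd_below_def)
  have i_le: "i n \<le> \<phi> u" if "u \<in> C n" for u n
    unfolding i_def by (rule cINF_lower[OF bdd that])
  have i_mono: "i n \<le> i m" if "n \<le> m" for n m
    unfolding i_def by (rule cINF_superset_mono[OF C_ne bdd C_mono[OF that]]) auto
  have i_bd: "i n \<le> 1" for n using C_ne[of n] i_le phi1 by (meson all_not_in_conv order_trans)
  obtain i' where "i \<longlonglongrightarrow> i'"
    using incseq_convergent[of i 1] i_mono i_bd unfolding incseq_def by metis
  then have i_Cauchy: "Cauchy i" by (rule LIMSEQ_imp_Cauchy)
  have "\<exists>u\<in>C n. \<phi> u < i n + d" if "d > 0" for n d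
    using cInf_lessD[of "\<phi> ` C n" "i n + d"] C_ne[of n] that unfolding i_def by auto
  \<comment> \<open>The rate \<open>1/16\<close> is the square of \<open>1/4\<close>: squared
    \<open>L\<^sup>2\<close> distances of order \<open>(1/16)^k\<close> will give summable
    \<open>L\<^sup>1\<close> distances of order \<open>(1/4)^k\<close>.\<close>
  then have "\<exists>u. u \<in> C n \<and> \<phi> u < i n + (1/16)^n" for n
    by (metis zero_less_divide_1_iff zero_less_numeral zero_less_power)
  then obtain u where u: "\<And>n. u n \<in> C n" "\<And>n. \<phi> (u n) < i n + (1/16)^n" by metis
  define w where "w n x = exp (- u n x / 2)" for n x
  have w_meas[measurable]: "w n \<in> borel_measurable M" for n
    unfolding w_def using C_int[OF u(1)[of n]] by measurable
  have w01: "0 < w n x" "w n x \<le> 1" for n x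
    unfolding w_def using C_nn[OF u(1)[of n]] by auto
  have w_int: "integrable M (\<lambda>x. (w n x - w m x)\<^sup>2)" "integrable M (\<lambda>x. \<bar>w n x - w m x\<bar>)" for m n
  proof -
    have "\<bar>w n x - w m x\<bar> \<le> 1" for x using w01[of n x] w01[of m x] by auto
    then show "integrable M (\<lambda>x. (w n x - w m x)\<^sup>2)" "integrable M (\<lambda>x. \<bar>w n x - w m x\<bar>)"
      by (auto intro!: integrable_const_bound[where B=1] simp: abs_square_le_1)
  qed
  \<comment> \<open>The midpoint \<open>v\<close> lies in \<open>C n\<close>, so
    \<open>\<phi> v\<close> is at least \<open>i n\<close>, while \<open>u n\<close> and
    \<open>u m\<close> are nearly optimal. By \<open>exp_midpoint_gap\<close> the defect in
    convexity is exactly the squared distance.\<close>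
  have gap: "(\<integral>x. (w n x - w m x)\<^sup>2 \<partial>M) \<le> (i m - i n) + 2 * (1/16)^n" if nm: "n \<le> m" for n m
  proof -
    define v where "v x = (u n x + u m x) / 2" for x
    have v: "v \<in> C n" unfolding v_def[abs_def] C_def
      using u(1) C_mono[OF nm] by (auto intro!: mid_hull.mid simp: C_def)
    have "(\<integral>x. (w n x - w m x)\<^sup>2 \<partial>M) = (\<integral>x. (exp (- u n x) + exp (- u m x)) - 2 * exp (- v x) \<partial>M)"
    proof (intro Bochner_Integration.integral_cong refl)
      fix x
      show "(w n x - w m x)\<^sup>2 = (exp (- u n x) + exp (- u m x)) - 2 * exp (- v x)"
        using exp_midpoint_gap[of "u n x" "u m x"] unfolding w_def v_def by simp
    qed
    also have "\<dots> = \<phi> (u n) + \<phi> (u m) - 2 * \<phi> v"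
      unfolding \<phi>_def using exp_int[OF u(1)] exp_int[OF v] by simp
    also have "\<dots> \<le> (i m - i n) + 2 * (1/16)^n"
      using u(2)[of n] u(2)[of m] i_le[OF v] power_decreasing[OF nm, of "1/16::real"] by linarith
    finally show ?thesis .
  qed
  have "\<exists>N\<ge>k. \<forall>n\<ge>N. i n - i N < (1/16)^k" for k
  proof -
    obtain N where N: "\<And>m n. m \<ge> N \<Longrightarrow> n \<ge> N \<Longrightarrow> dist (i m) (i n) < (1/16)^k"
      using i_Cauchy[unfolded Cauchy_def, rule_format, of "(1/16)^k"] by auto
    show ?thesis using N[of _ "max N k"] by (intro exI[of _ "max N k"]) (auto simp: dist_real_def abs_less_iff)
  qed
  then obtain N where N: "\<And>k. N k \<ge> k" "\<And>k n. n \<ge> N k \<Longrightarrow> i n - i (N k) < (1/16)^k" by metis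
  \<comment> \<open>The running maximum makes the selected indices nondecreasing and keeps them at
    or beyond \<open>N k\<close>.\<close>
  define r where "r k = Max (N ` {..k})" for k
  have r_ge: "N k \<le> r k" for k unfolding r_def by auto
  have r_mono: "r k \<le> r (Suc k)" for k unfolding r_def by (intro Max_mono) auto
  have r_k: "k \<le> r k" for k using r_ge N(1) le_trans by blast
  have step: "(\<integral>x. \<bar>w (r (Suc k)) x - w (r k) x\<bar> \<partial>M) \<le> 2 * (1/4)^k" for k
  proof -
    have "i (r (Suc k)) - i (r k) \<le> (1/16)^k"
      using N(2)[of k "r (Suc k)"] i_mono[OF r_ge[of k]] r_mono[of k] r_ge[of k] by linarith
    moreover have "(1/16::real)^(r k) \<le> (1/16)^k" using r_k by (intro power_decreasing) auto
    ultimately have sq: "(\<integral>x. (w (r k) x - w (r (Suc k)) x)\<^sup>2 \<partial>M) \<le> 3 * (1/16)^k"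
      using gap[OF r_mono[of k]] by linarith
    \<comment> \<open>The inequality of arithmetic and geometric means with weight
      \<open>(1/4)^k\<close>; it converts the bound \<open>3 * (1/16)^k\<close> on the mean square
      into one of order \<open>(1/4)^k\<close> on the mean modulus.\<close>
    have am: "\<bar>y\<bar> \<le> ((1/4)^k + y\<^sup>2 * 4^k) / 2" for y :: real
    proof -
      define q q' :: real where "q = (1/4)^k" and "q' = 4^k"
      have qq: "q * q' = 1" unfolding q_def q'_def by (simp add: power_one_over)
      have "0 \<le> (q - \<bar>y\<bar>)\<^sup>2" by simp
      then have "0 \<le> q\<^sup>2 + \<bar>y\<bar>\<^sup>2 - 2 * q * \<bar>y\<bar>" by (simp only: power2_diff)
      then have "2 * \<bar>y\<bar> * q \<le> q * q + y\<^sup>2" by (simp add: mult_ac power2_eq_square)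
      then have "2 * \<bar>y\<bar> * q * q' \<le> (q * q + y\<^sup>2) * q'" by (intro mult_right_mono) (auto simp: q'_def)
      also have "\<dots> = q * (q * q') + y\<^sup>2 * q'" by (simp add: algebra_simps)
      also have "2 * \<bar>y\<bar> * q * q' = 2 * \<bar>y\<bar>" using qq by (simp add: mult.assoc)
      finally show ?thesis using qq unfolding q_def[symmetric] q'_def[symmetric] by simp
    qed
    have "(\<integral>x. \<bar>w (r (Suc k)) x - w (r k) x\<bar> \<partial>M) \<le> (\<integral>x. ((1/4)^k + (w (r k) x - w (r (Suc k)) x)\<^sup>2 * 4^k) / 2 \<partial>M)"
    proof (rule integral_mono)
      show "\<bar>w (r (Suc k)) x - w (r k) x\<bar> \<le> ((1/4)^k + (w (r k) x - w (r (Suc k)) x)\<^sup>2 * 4^k) / 2" for x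
        using am[of "w (r k) x - w (r (Suc k)) x"] by (simp add: abs_minus_commute)
      show "integrable M (\<lambda>x. ((1/4)^k + (w (r k) x - w (r (Suc k)) x)\<^sup>2 * 4^k) / 2)"
        by (intro integrable_divide Bochner_Integration.integrable_add integrable_mult_left w_int integrable_const)
    qed (rule w_int)
    also have "\<dots> = ((1/4)^k + (\<integral>x. (w (r k) x - w (r (Suc k)) x)\<^sup>2 \<partial>M) * 4^k) / 2"
      using w_int by (simp add: prob_space)
    also have "\<dots> \<le> ((1/4)^k + 3 * (1/16)^k * 4^k) / 2"
      using sq by (intro divide_right_mono add_left_mono mult_right_mono) auto
    also have "(1/16::real)^k * 4^k = (1/4)^k" by (simp flip: power_mult_distrib)
    then have "((1/4)^k + 3 * (1/16)^k * 4^k) / 2 = 2 * (1/4::real)^k" by simp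
    finally show ?thesis .
  qed
  have "AE x in M. summable (\<lambda>k. norm (w (r (Suc k)) x - w (r k) x))"
  proof -
    have "(\<integral>\<^sup>+x. (\<Sum>k. ennreal \<bar>w (r (Suc k)) x - w (r k) x\<bar>) \<partial>M) = (\<Sum>k. \<integral>\<^sup>+x. ennreal \<bar>w (r (Suc k)) x - w (r k) x\<bar> \<partial>M)"
      by (rule nn_integral_suminf) auto
    also have "\<dots> \<le> (\<Sum>k. ennreal (2 * (1/4)^k))"
      using w_int step by (intro suminf_le) (auto simp: nn_integral_eq_integral intro!: ennreal_leI)
    also have "\<dots> < \<infinity>"
      by (subst suminf_ennreal2) (auto intro!: summable_mult summable_geometric)
    finally have "AE x in M. (\<Sum>k. ennreal \<bar>w (r (Suc k)) x - w (r k) x\<bar>) \<noteq> \<infinity>"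
      by (intro nn_integral_PInf_AE) auto
    then show ?thesis by eventually_elim (auto intro!: summable_suminf_not_top)
  qed
  then have conv: "AE x in M. convergent (\<lambda>k. w (r k) x)"
  proof eventually_elim
    case (elim x)
    have "summable (\<lambda>k. w (r (Suc k)) x - w (r k) x)" by (rule summable_norm_cancel[OF elim])
    then show ?case 
      by (simp add: summable_iff_convergent sum_lessThan_telescope[of "\<lambda>k. w (r k) x"] convergent_diff_const_right_iff)
  qed
  define W where "W x = lim (\<lambda>k. w (r k) x)" for x
  have [measurable]: "W \<in> borel_measurable M" unfolding W_def by measurable
  have W: "AE x in M. (\<lambda>k. w (r k) x) \<longlonglongrightarrow> W x"
    using conv by eventually_elim (simp add: W_def convergent_LIMSEQ_iff)
  define g where "g k = u (r k)" for k
  have gC: "g k \<in> C (r k)" for k unfolding g_def by (rule u)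
  have g_int: "integrable M (g k)" for k using C_int[OF gC] .
  have g_ui: "\<exists>c\<ge>0. \<forall>n. (\<integral>x. max 0 (\<bar>g n x\<bar> - c) \<partial>M) \<le> e" if e: "e > 0" for e
    using ui[OF e] C_prop[OF gC] by blast
  have g_w: "g k x = - 2 * ln (w (r k) x)" for k x unfolding g_def w_def by simp
  \<comment> \<open>At a zero of \<open>W\<close> the values \<open>g k x\<close> would tend to
    infinity. Fatou's lemma excludes this almost surely, because the means of the \<open>g k\<close>
    are bounded.\<close>
  have Wpos: "AE x in M. W x > 0"
  proof -
    obtain c where c: "c \<ge> 0" "\<forall>n. (\<integral>x. max 0 (\<bar>g n x\<bar> - c) \<partial>M) \<le> 1" using g_ui[of 1] by auto
    have bd: "(\<integral>\<^sup>+x. ennreal (g n x) \<partial>M) \<le> ennreal (1 + c)" for n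
    proof -
      have "(\<integral>x. g n x \<partial>M) \<le> (\<integral>x. max 0 (\<bar>g n x\<bar> - c) + c \<partial>M)"
        using g_int integrable_excess by (intro integral_mono) auto
      also have "\<dots> \<le> 1 + c" using c g_int integrable_excess by (simp add: prob_space)
      finally show ?thesis using g_int[of n] C_nn[OF gC[of n]]
        by (subst nn_integral_eq_integral) (auto intro!: ennreal_leI)
    qed
    have [measurable]: "g k \<in> borel_measurable M" for k using g_int by auto
    have "(\<integral>\<^sup>+x. liminf (\<lambda>n. ennreal (g n x)) \<partial>M) \<le> liminf (\<lambda>n. \<integral>\<^sup>+x. ennreal (g n x) \<partial>M)"
      by (rule nn_integral_liminf) auto
    also have "\<dots> \<le> liminf (\<lambda>n::nat. ennreal (1 + c))"
      by (rule Liminf_mono) (use bd in auto)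
    also have "\<dots> < \<infinity>" by (simp add: Liminf_const)
    finally have "AE x in M. liminf (\<lambda>n. ennreal (g n x)) \<noteq> \<infinity>"
      by (intro nn_integral_PInf_AE) auto
    with W show ?thesis
    proof eventually_elim
      case (elim x)
      have "W x \<ge> 0" using elim(1) w01(1) by (intro LIMSEQ_le_const[OF elim(1)]) (auto intro: less_imp_le)
      moreover have "W x \<noteq> 0"
      proof
        assume "W x = 0"
        then have "filterlim (\<lambda>k. w (r k) x) (at_right 0) sequentially"
          using elim(1) w01(1) by (auto simp: filterlim_at intro!: always_eventually) (metis less_irrefl)
        then have "filterlim (\<lambda>k. ln (w (r k) x)) at_bot sequentially"
          by (rule filterlim_compose[OF ln_at_0])
        then have "filterlim (\<lambda>k. g k x) at_top sequentially"
          using filterlim_tendsto_pos_mult_at_bot[OF tendsto_const, of 2] unfolding g_w filterlim_uminus_at_top by simp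
        then have "(\<lambda>k. ennreal (g k x)) \<longlonglongrightarrow> \<infinity>"
          by (simp add: ennreal_tendsto_top_eq_at_top)
        then have "liminf (\<lambda>k. ennreal (g k x)) = \<infinity>" by (intro lim_imp_Liminf) auto
        with elim(2) show False by simp
      qed
      ultimately show ?case by simp
    qed
  qed
  define h where "h x = - 2 * ln (W x)" for x
  have [measurable]: "h \<in> borel_measurable M" unfolding h_def by measurable
  have lim: "AE x in M. (\<lambda>k. g k x) \<longlonglongrightarrow> h x"
    using W Wpos by eventually_elim (auto simp: g_w h_def intro!: tendsto_intros)
  have "g n \<in> mid_hull (f ` {n..})" for n
    using gC C_mono[OF r_k] unfolding C_def by blast
  then show ?thesis using vitali_excess[OF g_int _ lim g_ui] g_int by (intro exI[of _ g] exI[of _ h]) auto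
qed

subsection \<open>Martingales below a submartingale\<close>

lemma set_integral_mono_real:
  fixes f g :: "'a \<Rightarrow> real"
  assumes "integrable M f" "integrable M g" "B \<in> sets M" "AE x in M. x \<in> B \<longrightarrow> f x \<le> g x"
  shows "(\<integral>x\<in>B. f x \<partial>M) \<le> (\<integral>x\<in>B. g x \<partial>M)"
  unfolding set_lebesgue_integral_def
  using assms integrable_mult_indicator[of B M f] integrable_mult_indicator[of B M g]
  by (intro integral_mono_AE) (auto elim!: AE_mp simp: indicator_def)

lemma set_integral_diff_real:
  fixes f g :: "'a \<Rightarrow> real"
  assumes "integrable M f" "integrable M g" "B \<in> sets M"
  shows "(\<integral>x\<in>B. f x - g x \<partial>M) = (\<integral>x\<in>B. f x \<partial>M) - (\<integral>x\<in>B. g x \<partial>M)"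
  unfolding set_lebesgue_integral_def
  using assms integrable_mult_indicator[of B M f] integrable_mult_indicator[of B M g]
  by (simp add: right_diff_distrib)

lemma set_integral_add_real:
  fixes f g :: "'a \<Rightarrow> real"
  assumes "integrable M f" "integrable M g" "B \<in> sets M"
  shows "(\<integral>x\<in>B. f x + g x \<partial>M) = (\<integral>x\<in>B. f x \<partial>M) + (\<integral>x\<in>B. g x \<partial>M)"
  unfolding set_lebesgue_integral_def
  using assms integrable_mult_indicator[of B M f] integrable_mult_indicator[of B M g]
  by (simp add: distrib_left)

section \<open>Doob decomposition in discrete time\<close>

locale discrete_submartingale = prob_space +
  fixes G :: "nat \<Rightarrow> 'a measure" and S :: "nat \<Rightarrow> 'a \<Rightarrow> real" and m :: nat
  assumes sub: "\<And>k. k \<le> m \<Longrightarrow> subalgebra M (G k)"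
    and mono: "\<And>k l. k \<le> l \<Longrightarrow> l \<le> m \<Longrightarrow> sets (G k) \<subseteq> sets (G l)"
    and S_meas: "\<And>k. k \<le> m \<Longrightarrow> S k \<in> borel_measurable (G k)"
    and S_int: "\<And>k. k \<le> m \<Longrightarrow> integrable M (S k)"
    and submart: "\<And>k B. k < m \<Longrightarrow> B \<in> sets (G k) \<Longrightarrow> (\<integral>x\<in>B. S k x \<partial>M) \<le> (\<integral>x\<in>B. S (Suc k) x \<partial>M)"
begin

text \<open>The positive part changes the increment only on a null set, see
  \<open>increment_AE\<close>, and makes the compensator nonnegative and nondecreasing for every
  \<open>x\<close>.\<close>

definition increment :: "nat \<Rightarrow> 'a \<Rightarrow> real" where
  "increment k x = max 0 (real_cond_exp M (G k) (S (Suc k)) x - S k x)"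

definition compensator :: "nat \<Rightarrow> 'a \<Rightarrow> real" where
  "compensator k x = (\<Sum>i<k. increment i x)"

lemma compensator_nonneg: "0 \<le> compensator k x"
  unfolding compensator_def increment_def by (intro sum_nonneg) auto

lemma compensator_mono: "k \<le> l \<Longrightarrow> compensator k x \<le> compensator l x"
  unfolding compensator_def by (intro sum_mono2) (auto simp: increment_def)

lemma sets_G: "k \<le> m \<Longrightarrow> B \<in> sets (G k) \<Longrightarrow> B \<in> sets M"
  using sub by (auto simp: subalgebra_def)

lemma space_G: "k \<le> m \<Longrightarrow> space (G k) = space M"
  using sub by (auto simp: subalgebra_def)

lemma increment_AE:
  assumes k: "k < m"
  shows "AE x in M. increment k x = real_cond_exp M (G k) (S (Suc k)) x - S k x"
proof -
  interpret sigma_finite_subalgebra M "G k" using k by (intro sigma_finite_subalgebraI sub) auto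
  have "AE x in M. S k x \<le> real_cond_exp M (G k) (S (Suc k)) x"
  proof (rule AE_le_of_set_integral_le)
    fix B assume B: "B \<in> sets (G k)"
    show "(\<integral>x\<in>B. S k x \<partial>M) \<le> (\<integral>x\<in>B. real_cond_exp M (G k) (S (Suc k)) x \<partial>M)"
      using submart[OF k B] real_cond_exp_intA[OF S_int[of "Suc k"] B] k by simp
  qed (use k S_int S_meas subalg in \<open>auto intro!: real_cond_exp_int\<close>)
  then show ?thesis by eventually_elim (auto simp: increment_def)
qed

lemma increment_meas: "k < m \<Longrightarrow> increment k \<in> borel_measurable (G k)"
  unfolding increment_def[abs_def] using S_meas[of k] by measurable

lemma increment_int: "k < m \<Longrightarrow> integrable M (increment k)"
proof -
  assume k: "k < m"
  interpret sigma_finite_subalgebra M "G k" using k by (intro sigma_finite_subalgebraI sub) auto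
  show ?thesis unfolding increment_def[abs_def]
    using S_int[of k] real_cond_exp_int(1)[OF S_int, of "Suc k"] k by auto
qed

text \<open>Predictability: the value with index \<open>Suc l\<close> is already known at
  \<open>l\<close>. This is what lets a stopping rule act before the compensator passes a
  level.\<close>

lemma compensator_meas: "k \<le> m \<Longrightarrow> l < k \<or> l = k \<Longrightarrow> compensator (Suc l) \<in> borel_measurable (G k)" if "l < m"
proof -
  assume k: "k \<le> m" and l: "l < k \<or> l = k"
  have "increment i \<in> borel_measurable (G k)" if i: "i < Suc l" for i
    using increment_meas[of i] i l k \<open>l < m\<close> mono[of i k] space_G[of i] space_G[of k]
    by (intro borel_measurable_subalgebra[of "G i" "G k"]) auto
  then show ?thesis unfolding compensator_def[abs_def] by (intro borel_measurable_sum) auto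
qed

lemma compensator_int: "k \<le> m \<Longrightarrow> integrable M (compensator k)"
  unfolding compensator_def[abs_def] by (intro Bochner_Integration.integrable_sum increment_int) auto

text \<open>Submartingale minus compensator is a martingale, here in integrated form:
  \<open>B\<close> stays measurable at later times, so over \<open>B\<close> each increment of the
  compensator has the same integral as the increment of \<open>S\<close>.\<close>

lemma doob_decomposition:
  assumes "k \<le> l" "l \<le> m" "B \<in> sets (G k)"
  shows "(\<integral>x\<in>B. S l x \<partial>M) - (\<integral>x\<in>B. compensator l x \<partial>M) = (\<integral>x\<in>B. S k x \<partial>M) - (\<integral>x\<in>B. compensator k x \<partial>M)"
  using assms
proof (induction l rule: dec_induct)
  case (step j)
  have j: "j < m" using step by auto
  interpret sigma_finite_subalgebra M "G j" using j by (intro sigma_finite_subalgebraI sub) auto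
  have Bj: "B \<in> sets (G j)" using mono[of k j] step by auto
  have BM: "B \<in> sets M" using sets_G[OF _ Bj] j by simp
  have "(\<integral>x\<in>B. increment j x \<partial>M) = (\<integral>x\<in>B. real_cond_exp M (G j) (S (Suc j)) x - S j x \<partial>M)"
    using increment_AE[OF j] unfolding set_lebesgue_integral_def
    by (intro integral_cong_AE) (use increment_int[OF j] S_int[of j] j BM in \<open>auto elim: AE_mp\<close>)
  also have "\<dots> = (\<integral>x\<in>B. S (Suc j) x \<partial>M) - (\<integral>x\<in>B. S j x \<partial>M)"
    using j S_int[of j] S_int[of "Suc j"] BM real_cond_exp_int(1)[of "S (Suc j)"] real_cond_exp_intA[OF _ Bj, of "S (Suc j)"]
    by (subst set_integral_diff_real) auto
  finally have *: "(\<integral>x\<in>B. increment j x \<partial>M) = (\<integral>x\<in>B. S (Suc j) x \<partial>M) - (\<integral>x\<in>B. S j x \<partial>M)" .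
  have "(\<integral>x\<in>B. compensator (Suc j) x \<partial>M) = (\<integral>x\<in>B. compensator j x \<partial>M) + (\<integral>x\<in>B. increment j x \<partial>M)"
    using set_integral_add_real[OF compensator_int[of j] increment_int[OF j] BM] j by (simp add: compensator_def)
  with * step show ?case by simp
qed simp

text \<open>Stopping when the (predictable) compensator is about to exceed \<open>c\<close>; this reduces its uniform
  integrability to that of the submartingale at stopping times.\<close>

lemma compensator_excess:
  assumes c: "c \<ge> 0"
  shows "\<exists>\<kappa>::'a \<Rightarrow> nat. (\<forall>x. \<kappa> x \<le> m) \<and> (\<forall>k\<le>m. {x\<in>space M. \<kappa> x \<le> k} \<in> sets (G k)) \<and>
    (\<forall>x. \<kappa> x < m \<longleftrightarrow> compensator m x > c) \<and>
    (\<integral>x. max 0 (compensator m x - c) \<partial>M) \<le> (\<Sum>k<m. \<integral>x\<in>{x\<in>space M. \<kappa> x = k}. S m x - S k x \<partial>M)"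
proof -
  \<comment> \<open>Stop one step before the level is passed: the next value is known in advance, so
    this is a stopping time, and \<open>compensator (\<kappa> x) x\<close> is still at most
    \<open>c\<close>. The alternative \<open>k = m\<close> is the default when the level is never
    passed.\<close>
  define \<kappa> where "\<kappa> x = (LEAST k. k = m \<or> compensator (Suc k) x > c)" for x
  have \<kappa>P: "\<kappa> x = m \<or> compensator (Suc (\<kappa> x)) x > c" for x
    unfolding \<kappa>_def by (rule LeastI[of _ m]) simp
  have \<kappa>m: "\<kappa> x \<le> m" for x unfolding \<kappa>_def by (rule Least_le) simp
  have \<kappa>_iff: "\<kappa> x \<le> k \<longleftrightarrow> compensator (Suc k) x > c" if k: "k < m" for k x
  proof
    assume "\<kappa> x \<le> k"
    then show "compensator (Suc k) x > c" using \<kappa>P[of x] k compensator_mono[of "Suc (\<kappa> x)" "Suc k" x] by auto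
  next
    assume "compensator (Suc k) x > c"
    then show "\<kappa> x \<le> k" unfolding \<kappa>_def by (intro Least_le) auto
  qed
  have \<kappa>_le_c: "compensator (\<kappa> x) x \<le> c" for x
  proof (cases "\<kappa> x")
    case 0
    then show ?thesis using c by (simp add: compensator_def)
  next
    case (Suc j)
    then have "\<not> (j = m \<or> compensator (Suc j) x > c)" unfolding \<kappa>_def by (intro not_less_Least) auto
    then show ?thesis using Suc by auto
  qed
  have \<kappa>_lt: "\<kappa> x < m \<longleftrightarrow> compensator m x > c" for x
  proof (cases m)
    case 0
    then show ?thesis using c by (simp add: compensator_def)
  next
    case (Suc j)
    then show ?thesis using \<kappa>_iff[of j x] by (auto simp: less_Suc_eq_le)
  qed
  have \<kappa>_sets: "{x\<in>space M. \<kappa> x \<le> k} \<in> sets (G k)" if k: "k \<le> m" for k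
  proof (cases "k = m")
    case True
    then have "{x\<in>space M. \<kappa> x \<le> k} = space (G k)" using \<kappa>m space_G[OF k] by auto
    then show ?thesis by simp
  next
    case False
    then have "{x\<in>space M. \<kappa> x \<le> k} = {x\<in>space (G k). compensator (Suc k) x > c}"
      using k \<kappa>_iff space_G[OF k] by auto
    moreover have "compensator (Suc k) \<in> borel_measurable (G k)" using compensator_meas[of k k] k False by auto
    ultimately show ?thesis by simp
  qed
  have \<kappa>_eq: "{x\<in>space M. \<kappa> x = k} \<in> sets (G k)" if k: "k \<le> m" for k
  proof (cases k)
    case 0
    then show ?thesis using \<kappa>_sets[OF k] by simp
  next
    case (Suc j)
    have "{x\<in>space M. \<kappa> x = k} = {x\<in>space M. \<kappa> x \<le> k} - {x\<in>space M. \<kappa> x \<le> j}" using Suc by auto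
    moreover have "{x\<in>space M. \<kappa> x \<le> j} \<in> sets (G k)"
      using \<kappa>_sets[of j] mono[of j k] Suc k by auto
    ultimately show ?thesis using \<kappa>_sets[OF k] by auto
  qed
  define B where "B k = {x\<in>space M. \<kappa> x = k}" for k
  have BM: "B k \<in> sets M" if "k < m" for k unfolding B_def using that by (intro sets_G[OF _ \<kappa>_eq]) auto
  have ind: "indicat_real (B k) x = (if \<kappa> x = k then 1 else 0)" if "x \<in> space M" for k x
    using that by (auto simp: B_def)
  \<comment> \<open>Where \<open>\<kappa> x < m\<close>, replacing \<open>c\<close> by the stopped
    compensator, which is at most \<open>c\<close>, only enlarges the integrand. Afterwards
    \<open>doob_decomposition\<close> exchanges both compensators for the submartingale.\<close>
  have "(\<integral>x. max 0 (compensator m x - c) \<partial>M) \<le> (\<integral>x. (\<Sum>k<m. indicat_real (B k) x *\<^sub>R (compensator m x - compensator k x)) \<partial>M)"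
  proof (rule integral_mono)
    show "integrable M (\<lambda>x. max 0 (compensator m x - c))" using compensator_int by auto
    show "integrable M (\<lambda>x. \<Sum>k<m. indicat_real (B k) x *\<^sub>R (compensator m x - compensator k x))"
      using compensator_int BM by (intro Bochner_Integration.integrable_sum integrable_mult_indicator Bochner_Integration.integrable_diff) auto
    fix x assume x: "x \<in> space M"
    show "max 0 (compensator m x - c) \<le> (\<Sum>k<m. indicat_real (B k) x *\<^sub>R (compensator m x - compensator k x))"
    proof (cases "\<kappa> x < m")
      case True
      have "(\<Sum>k<m. indicat_real (B k) x *\<^sub>R (compensator m x - compensator k x)) = compensator m x - compensator (\<kappa> x) x"
        using x True by (simp add: ind if_distrib[of "\<lambda>y. y * _"] cong: if_cong)
      then show ?thesis using \<kappa>_le_c[of x] compensator_mono[OF \<kappa>m, of x] by auto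
    next
      case False
      then have "max 0 (compensator m x - c) = 0" using \<kappa>_lt[of x] by auto
      moreover have "0 \<le> (\<Sum>k<m. indicat_real (B k) x *\<^sub>R (compensator m x - compensator k x))"
        by (intro sum_nonneg) (auto simp: compensator_mono less_imp_le)
      ultimately show ?thesis by simp
    qed
  qed
  also have "\<dots> = (\<Sum>k<m. \<integral>x\<in>B k. compensator m x - compensator k x \<partial>M)"
    unfolding set_lebesgue_integral_def using compensator_int BM
    by (intro Bochner_Integration.integral_sum integrable_mult_indicator Bochner_Integration.integrable_diff) auto
  also have "\<dots> = (\<Sum>k<m. \<integral>x\<in>B k. S m x - S k x \<partial>M)"
  proof (rule sum.cong[OF refl])
    fix k assume "k \<in> {..<m}"
    then have k: "k < m" by simp
    show "(\<integral>x\<in>B k. compensator m x - compensator k x \<partial>M) = (\<integral>x\<in>B k. S m x - S k x \<partial>M)"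
      using doob_decomposition[of k m "B k"] k \<kappa>_eq[of k] BM[OF k] compensator_int[of k] compensator_int[of m] S_int[of k] S_int[of m]
      by (simp add: set_integral_diff_real B_def)
  qed
  finally show ?thesis using \<kappa>m \<kappa>_sets \<kappa>_lt unfolding B_def by (intro exI[of _ \<kappa>]) auto
qed

end

section \<open>Dyadic grids and the passage to finer grids\<close>

definition dyad :: "real \<Rightarrow> real \<Rightarrow> nat \<Rightarrow> nat \<Rightarrow> real" where
  "dyad t T n k = t + (T - t) * real k / 2 ^ n"

lemma dyad_refine: "n \<le> n' \<Longrightarrow> dyad t T n k = dyad t T n' (k * 2 ^ (n' - n))"
  using power_add[of "2::real" n "n' - n"] unfolding dyad_def by simp

lemma dyad_mono: "t \<le> T \<Longrightarrow> k \<le> l \<Longrightarrow> dyad t T n k \<le> dyad t T n l"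
  unfolding dyad_def by (intro add_left_mono divide_right_mono mult_left_mono) auto

lemma dyad_0[simp]: "dyad t T n 0 = t"
  and dyad_top[simp]: "dyad t T n (2 ^ n) = T"
  unfolding dyad_def by auto

lemma dyad_in: "t \<le> T \<Longrightarrow> k \<le> 2 ^ n \<Longrightarrow> dyad t T n k \<in> {t..T}"
  using dyad_mono[of t T 0 k n] dyad_mono[of t T k "2^n" n] by simp

lemma stopping_time_dyad:
  assumes tT: "t \<le> T"
    and space_F: "\<And>s. space (F s) = \<Omega>"
    and mono: "\<And>s r. s \<le> r \<Longrightarrow> sets (F s) \<subseteq> sets (F r)"
    and \<kappa>: "\<And>x. x \<in> \<Omega> \<Longrightarrow> \<kappa> x \<le> 2 ^ n"
      "\<And>k. k \<le> 2 ^ n \<Longrightarrow> {x\<in>\<Omega>. \<kappa> x \<le> k} \<in> sets (F (dyad t T n k))"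
  shows "stopping_time F (\<lambda>x. dyad t T n (\<kappa> x))"
proof (rule stopping_timeI)
  fix s
  have "{x\<in>space (F s). dyad t T n (\<kappa> x) \<le> s} = (\<Union>k\<in>{k. k \<le> 2^n \<and> dyad t T n k \<le> s}. {x\<in>\<Omega>. \<kappa> x \<le> k})" (is "_ = ?R")
  proof safe
    fix x assume "x \<in> space (F s)" "dyad t T n (\<kappa> x) \<le> s"
    then show "x \<in> ?R" using \<kappa>(1)[of x] by (auto simp: space_F)
  next
    fix x k assume "dyad t T n k \<le> s" "\<kappa> x \<le> k"
    then show "dyad t T n (\<kappa> x) \<le> s" using dyad_mono[OF tT, of "\<kappa> x" k n] by auto
  qed (auto simp: space_F)
  moreover have "?R \<in> sets (F s)"
  proof (rule sets.finite_UN)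
    show "finite {k. k \<le> 2^n \<and> dyad t T n k \<le> s}" by (rule finite_subset[of _ "{..2^n}"]) auto
    show "{x\<in>\<Omega>. \<kappa> x \<le> k} \<in> sets (F s)" if "k \<in> {k. k \<le> 2^n \<and> dyad t T n k \<le> s}" for k
      using that \<kappa>(2)[of k] mono[of "dyad t T n k" s] by blast
  qed
  ultimately show "Measurable.pred (F s) (\<lambda>x. dyad t T n (\<kappa> x) \<le> s)" by (simp add: pred_def)
qed

text \<open>The candidate is \<open>X = S T - h\<close>, where \<open>h\<close> is the
  \<open>L\<^sup>1\<close> limit of convex combinations of terminal compensators on ever finer
  grids. At a dyadic time all sufficiently fine grids have a compensator, and its nonnegativity
  keeps the integrals of \<open>X\<close> below those of \<open>S\<close>; at time \<open>t\<close>
  all compensators vanish, whence equality there.\<close>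

theorem (in prob_space) martingale_below_submartingale:
  fixes F :: "real \<Rightarrow> 'a measure" and S N :: "real \<Rightarrow> 'a \<Rightarrow> real"
  assumes tT: "t \<le> T"
    and sub: "\<And>s. s \<in> {t..T} \<Longrightarrow> subalgebra M (F s)"
    and space_F: "\<And>s. space (F s) = space M"
    and mono: "\<And>s r. s \<le> r \<Longrightarrow> sets (F s) \<subseteq> sets (F r)"
    and S_meas: "\<And>s. s \<in> {t..T} \<Longrightarrow> S s \<in> borel_measurable (F s)"
    and S_int: "\<And>s. s \<in> {t..T} \<Longrightarrow> integrable M (S s)"
    and submart: "\<And>s r B. t \<le> s \<Longrightarrow> s \<le> r \<Longrightarrow> r \<le> T \<Longrightarrow> B \<in> sets (F s) \<Longrightarrow>
      (\<integral>x\<in>B. S s x \<partial>M) \<le> (\<integral>x\<in>B. S r x \<partial>M)"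
    and N_le: "\<And>s. s \<in> {t..T} \<Longrightarrow> AE x in M. N s x \<le> S s x"
    and N_int: "\<And>s. s \<in> {t..T} \<Longrightarrow> integrable M (N s)"
    and N_ui: "\<And>e. e > 0 \<Longrightarrow> \<exists>c\<ge>0. \<forall>\<tau>. stopping_time F \<tau> \<and> \<tau> \<in> space M \<rightarrow> {t..T} \<longrightarrow>
      integrable M (\<lambda>x. N (\<tau> x) x) \<and> (\<integral>x. max 0 (\<bar>N (\<tau> x) x\<bar> - c) \<partial>M) \<le> e"
  shows "\<exists>X. integrable M X \<and>
    (\<forall>n k. k \<le> 2 ^ n \<longrightarrow> (AE x in M. real_cond_exp M (F (dyad t T n k)) X x \<le> S (dyad t T n k) x)) \<and>
    (AE x in M. real_cond_exp M (F t) X x = S t x)"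
proof -
  note dy = dyad_in[OF tT] and dym = dyad_mono[OF tT]
  have D: "discrete_submartingale M (\<lambda>k. F (dyad t T n k)) (\<lambda>k. S (dyad t T n k)) (2 ^ n)" for n
  proof
    fix k B assume "k < 2 ^ n" "B \<in> sets (F (dyad t T n k))"
    then show "(\<integral>x\<in>B. S (dyad t T n k) x \<partial>M) \<le> (\<integral>x\<in>B. S (dyad t T n (Suc k)) x \<partial>M)"
      using dy[of k n] dy[of "Suc k" n] dym[of k "Suc k" n] by (intro submart) auto
  qed (use sub dy S_meas S_int mono dym in auto)
  define A where "A n k = discrete_submartingale.compensator M (\<lambda>k. F (dyad t T n k)) (\<lambda>k. S (dyad t T n k)) k" for n k
  note A_int = discrete_submartingale.compensator_int[OF D, folded A_def]
    and A_nn = discrete_submartingale.compensator_nonneg[OF D, folded A_def]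
    and A_doob = discrete_submartingale.doob_decomposition[OF D, folded A_def]
    and A_exc = discrete_submartingale.compensator_excess[OF D, folded A_def]
  have A0: "A n 0 = (\<lambda>_. 0)" for n
    unfolding A_def discrete_submartingale.compensator_def[OF D, abs_def] by simp
  define f where "f n = A n (2 ^ n)" for n
  have f_int: "integrable M (f n)" for n unfolding f_def by (rule A_int) simp
  have f_nn: "0 \<le> f n x" for n x unfolding f_def by (rule A_nn)
  have doob: "(\<integral>x\<in>B. S T x \<partial>M) - (\<integral>x\<in>B. f n x \<partial>M) = (\<integral>x\<in>B. S (dyad t T n k) x \<partial>M) - (\<integral>x\<in>B. A n k x \<partial>M)"
    if "k \<le> 2 ^ n" "B \<in> sets (F (dyad t T n k))" for n k B
    using A_doob[OF that(1) order_refl that(2)] by (simp add: f_def)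
  \<comment> \<open>By the decomposition between \<open>t\<close> and \<open>T\<close> this is the
    common mean of all terminal compensators; it enters Markov's inequality below.\<close>
  define \<Delta> where "\<Delta> = (\<integral>x. S T x \<partial>M) - (\<integral>x. S t x \<partial>M)"
  have full: "(\<integral>x\<in>space M. h x \<partial>M) = (\<integral>x. h x \<partial>M)" for h :: "'a \<Rightarrow> real"
    unfolding set_lebesgue_integral_def by (intro Bochner_Integration.integral_cong) auto
  have f_mean: "(\<integral>x. f n x \<partial>M) = \<Delta>" for n
    using doob[of 0 n "space M"] sets.top[of "F t"] unfolding \<Delta>_def full by (simp add: A0 space_F)
  have \<Delta>0: "0 \<le> \<Delta>" using f_mean[of 0] f_nn[of 0] integral_nonneg_AE[of "f 0" M] by auto
  have T: "T \<in> {t..T}" using tT by auto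
  have f_ui: "\<exists>c\<ge>0. \<forall>n. (\<integral>x. max 0 (\<bar>f n x\<bar> - c) \<partial>M) \<le> e" if e: "e > 0" for e
  proof -
    obtain c1 where c1: "c1 \<ge> 0" "(\<integral>x. max 0 (\<bar>S T x\<bar> - c1) \<partial>M) \<le> e / 4"
      using excess_small[OF S_int[OF T], of "e/4"] e by auto
    obtain c2 where c2: "c2 \<ge> 0" "\<And>\<tau>. stopping_time F \<tau> \<Longrightarrow> \<tau> \<in> space M \<rightarrow> {t..T} \<Longrightarrow>
      integrable M (\<lambda>x. N (\<tau> x) x) \<and> (\<integral>x. max 0 (\<bar>N (\<tau> x) x\<bar> - c2) \<partial>M) \<le> e / 4"
      using N_ui[of "e/4"] e by auto
    \<comment> \<open>Markov's inequality gives \<open>f n > c\<close> a probability of at most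
      \<open>\<Delta> / c\<close>, so this choice yields
      \<open>(c1 + c2) * measure M B \<le> e / 2\<close>. The summand 1 keeps \<open>c\<close>
      positive when \<open>\<Delta>\<close> is zero.\<close>
    define c where "c = 2 * (c1 + c2) * \<Delta> / e + 1"
    have c_pos: "c > 0" unfolding c_def using c1 c2 \<Delta>0 e by (simp add: add_nonneg_pos)
    have "(\<integral>x. max 0 (\<bar>f n x\<bar> - c) \<partial>M) \<le> e" for n
    proof -
      obtain \<kappa> :: "'a \<Rightarrow> nat" where \<kappa>: "\<And>x. \<kappa> x \<le> 2 ^ n"
        "\<And>k. k \<le> 2 ^ n \<Longrightarrow> {x\<in>space M. \<kappa> x \<le> k} \<in> sets (F (dyad t T n k))"
        "\<And>x. \<kappa> x < 2 ^ n \<longleftrightarrow> f n x > c"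
        "(\<integral>x. max 0 (f n x - c) \<partial>M) \<le> (\<Sum>k<2^n. \<integral>x\<in>{x\<in>space M. \<kappa> x = k}. S T x - S (dyad t T n k) x \<partial>M)"
        using A_exc[of c n] c_pos unfolding f_def by auto
      define \<tau> where "\<tau> x = dyad t T n (\<kappa> x)" for x
      have \<tau>_in: "\<tau> \<in> space M \<rightarrow> {t..T}" unfolding \<tau>_def using dy \<kappa>(1) by auto
      have \<tau>_st: "stopping_time F \<tau>"
        unfolding \<tau>_def using \<kappa>(1,2) by (intro stopping_time_dyad[OF tT space_F mono])
      note N\<tau> = c2(2)[OF \<tau>_st \<tau>_in]
      define B where "B = {x\<in>space M. \<kappa> x < 2 ^ n}"
      have Beq: "B = {x\<in>space M. f n x > c}" unfolding B_def using \<kappa>(3) by auto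
      have BM: "B \<in> sets M" unfolding Beq using f_int[of n] by auto
      have mk: "{x\<in>space M. \<kappa> x \<le> k} \<in> sets M" if "k \<le> 2^n" for k
        using \<kappa>(2)[OF that] sub[OF dy[OF that]] by (auto simp: subalgebra_def)
      have mke: "{x\<in>space M. \<kappa> x = k} \<in> sets M" if k: "k \<le> 2^n" for k
      proof (cases k)
        case 0 then show ?thesis using mk[OF k] by simp
      next
        case (Suc j)
        have "{x\<in>space M. \<kappa> x = k} = {x\<in>space M. \<kappa> x \<le> k} - {x\<in>space M. \<kappa> x \<le> j}" using Suc by auto
        then show ?thesis using mk[OF k] mk[of j] k Suc by auto
      qed
      have "c * measure M B \<le> \<Delta>"
      proof -
        have "c * measure M B = (\<integral>x. c * indicat_real B x \<partial>M)" using BM by simp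
        also have "\<dots> \<le> (\<integral>x. f n x \<partial>M)"
        proof (rule integral_mono)
          show "integrable M (\<lambda>x. c * indicat_real B x)" using BM by (simp add: emeasure_eq_measure)
          show "c * indicat_real B x \<le> f n x" for x
            using f_nn[of n x] c_pos by (simp add: Beq indicator_def)
        qed (rule f_int)
        finally show ?thesis by (simp add: f_mean)
      qed
      then have PB: "(c1 + c2) * measure M B \<le> e / 2"
      proof -
        have "2 * (c1 + c2) * \<Delta> / e * measure M B \<le> c * measure M B"
          unfolding c_def by (intro mult_right_mono) auto
        also have "\<dots> \<le> \<Delta>" by fact
        finally have *: "2 * (c1 + c2) * \<Delta> * measure M B \<le> \<Delta> * e" using e by (simp add: field_simps)
        show ?thesis
        proof (cases "\<Delta> = 0")
          case True
          then have "measure M B = 0" using \<open>c * measure M B \<le> \<Delta>\<close> c_pos measure_nonneg[of M B]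
            by (smt (verit) mult_pos_pos)
          then show ?thesis using e by simp
        next
          case False
          then have "2 * (c1 + c2) * measure M B \<le> e" using * \<Delta>0
            by (simp add: mult.commute mult.left_commute)
          then show ?thesis by (simp add: algebra_simps)
        qed
      qed
      \<comment> \<open>At stopping times only the lower bound \<open>N\<close> is under control. It
        suffices because the stopped value of \<open>S\<close> enters with a minus sign, and
        \<open>- S\<close> is at most \<open>\<bar>N\<bar>\<close>.\<close>
      have "(\<Sum>k<2^n. \<integral>x\<in>{x\<in>space M. \<kappa> x = k}. S T x - S (dyad t T n k) x \<partial>M)
         \<le> (\<Sum>k<2^n. \<integral>x\<in>{x\<in>space M. \<kappa> x = k}. \<bar>S T x\<bar> + \<bar>N (dyad t T n k) x\<bar> \<partial>M)"
      proof (intro sum_mono set_integral_mono_real)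
        fix k assume "k \<in> {..<(2::nat)^n}"
        then have k: "k \<le> 2^n" by auto
        show "AE x in M. x \<in> {x\<in>space M. \<kappa> x = k} \<longrightarrow> S T x - S (dyad t T n k) x \<le> \<bar>S T x\<bar> + \<bar>N (dyad t T n k) x\<bar>"
          using N_le[OF dy[OF k]] by eventually_elim auto
        show "integrable M (\<lambda>x. \<bar>S T x\<bar> + \<bar>N (dyad t T n k) x\<bar>)"
          using S_int[OF T] N_int[OF dy[OF k]] by auto
        show "integrable M (\<lambda>x. S T x - S (dyad t T n k) x)"
          using S_int[OF T] S_int[OF dy[OF k]] by auto
        show "{x\<in>space M. \<kappa> x = k} \<in> sets M" by (rule mke[OF k])
      qed
      also have "\<dots> = (\<integral>x. (\<Sum>k<2^n. indicat_real {x\<in>space M. \<kappa> x = k} x *\<^sub>R (\<bar>S T x\<bar> + \<bar>N (dyad t T n k) x\<bar>)) \<partial>M)"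
        unfolding set_lebesgue_integral_def using S_int[OF T] N_int dy mke
        by (intro Bochner_Integration.integral_sum[symmetric] integrable_mult_indicator Bochner_Integration.integrable_add integrable_abs) auto
      also have "\<dots> = (\<integral>x\<in>B. \<bar>S T x\<bar> + \<bar>N (\<tau> x) x\<bar> \<partial>M)"
        unfolding set_lebesgue_integral_def
      proof (rule Bochner_Integration.integral_cong[OF refl])
        fix x assume x: "x \<in> space M"
        have "indicat_real {x\<in>space M. \<kappa> x = k} x = (if \<kappa> x = k then 1 else 0)" for k using x by auto
        then show "(\<Sum>k<2^n. indicat_real {x\<in>space M. \<kappa> x = k} x *\<^sub>R (\<bar>S T x\<bar> + \<bar>N (dyad t T n k) x\<bar>)) =
          indicat_real B x *\<^sub>R (\<bar>S T x\<bar> + \<bar>N (\<tau> x) x\<bar>)"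
          using x by (auto simp: if_distrib[of "\<lambda>y. y * _"] B_def \<tau>_def cong: if_cong)
      qed
      also have "\<dots> = (\<integral>x\<in>B. \<bar>S T x\<bar> \<partial>M) + (\<integral>x\<in>B. \<bar>N (\<tau> x) x\<bar> \<partial>M)"
        using S_int[OF T] N\<tau> BM by (intro set_integral_add_real) auto
      also have "\<dots> \<le> (e / 4 + c1 * measure M B) + (e / 4 + c2 * measure M B)"
        using set_integral_le_excess[OF S_int[OF T] BM c1(1)] set_integral_le_excess[OF _ BM c2(1), of "\<lambda>x. N (\<tau> x) x"] N\<tau> c1(2)
        by linarith
      also have "\<dots> \<le> e" using PB by (simp add: algebra_simps)
      finally show ?thesis using \<kappa>(4) f_nn[of n] by simp
    qed
    then show ?thesis using c_pos by (intro exI[of _ c]) auto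
  qed
  obtain g h where g: "\<And>n. g n \<in> mid_hull (f ` {n..})" and h: "integrable M h" and g_int: "\<And>n. integrable M (g n)"
    and lim: "(\<lambda>n. \<integral>x. \<bar>g n x - h x\<bar> \<partial>M) \<longlonglongrightarrow> 0"
    using komlos[OF f_int f_nn f_ui] by blast
  define X where "X x = S T x - h x" for x
  have X: "integrable M X" unfolding X_def using S_int[OF T] h by auto
  have dyF: "B \<in> sets M" if "B \<in> sets (F (dyad t T n k))" "k \<le> 2^n" for B n k
    using that sub[OF dy[OF that(2)]] by (auto simp: subalgebra_def)
  \<comment> \<open>Over \<open>B\<close> the integral of \<open>f j\<close> with
    \<open>j \<ge> n\<close> exceeds the growth of \<open>S\<close> up to \<open>T\<close> by the
    integral of the compensator at the grid time, which is nonnegative, and zero for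
    \<open>k = 0\<close>. Both relations are stable under midpoints.\<close>
  have hull: "(\<integral>x\<in>B. u x \<partial>M) \<ge> (\<integral>x\<in>B. S T x \<partial>M) - (\<integral>x\<in>B. S (dyad t T n k) x \<partial>M) \<and>
      (k = 0 \<longrightarrow> (\<integral>x\<in>B. u x \<partial>M) = (\<integral>x\<in>B. S T x \<partial>M) - (\<integral>x\<in>B. S (dyad t T n k) x \<partial>M)) \<and> integrable M u"
    if u: "u \<in> mid_hull (f ` {n..})" and B: "B \<in> sets (F (dyad t T n k))" and k: "k \<le> 2 ^ n" for u B n k
    using u
  proof (induction rule: mid_hull.induct)
    case (base u)
    then obtain j where j: "n \<le> j" "u = f j" by auto
    have kj: "k * 2 ^ (j - n) \<le> 2 ^ j"
    proof -
      have "k * 2 ^ (j - n) \<le> 2 ^ n * 2 ^ (j - n)" using k by (rule mult_right_mono) simp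
      also have "\<dots> = 2 ^ j" using j by (simp flip: power_add)
      finally show ?thesis .
    qed
    have d: "(\<integral>x\<in>B. S T x \<partial>M) - (\<integral>x\<in>B. f j x \<partial>M) = (\<integral>x\<in>B. S (dyad t T n k) x \<partial>M) - (\<integral>x\<in>B. A j (k * 2 ^ (j - n)) x \<partial>M)"
      using doob[OF kj, of B] B by (simp flip: dyad_refine[OF j(1)])
    have "0 \<le> (\<integral>x\<in>B. A j (k * 2 ^ (j - n)) x \<partial>M)"
      unfolding set_lebesgue_integral_def using A_nn by (intro integral_nonneg_AE) auto
    with d show ?case using j f_int by (auto simp: A0 set_lebesgue_integral_def)
  next
    case (mid u v)
    have "(\<integral>x\<in>B. (u x + v x) / 2 \<partial>M) = ((\<integral>x\<in>B. u x \<partial>M) + (\<integral>x\<in>B. v x \<partial>M)) / 2"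
      using mid dyF[OF B k] by (subst set_integral_add_real[symmetric]) (auto simp: set_lebesgue_integral_def)
    with mid show ?case by auto
  qed
  have XB: "(\<integral>x\<in>B. X x \<partial>M) \<le> (\<integral>x\<in>B. S (dyad t T n k) x \<partial>M)"
    "k = 0 \<Longrightarrow> (\<integral>x\<in>B. X x \<partial>M) = (\<integral>x\<in>B. S (dyad t T n k) x \<partial>M)"
    if B: "B \<in> sets (F (dyad t T n k))" and k: "k \<le> 2 ^ n" for B n k
  proof -
    have l: "(\<lambda>n. \<integral>x\<in>B. g n x \<partial>M) \<longlonglongrightarrow> (\<integral>x\<in>B. h x \<partial>M)"
      by (rule set_integral_tendsto_L1[OF g_int h lim dyF[OF B k]])
    have gj: "g j \<in> mid_hull (f ` {n..})" if "n \<le> j" for j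
      by (rule mid_hull_mono[OF g]) (use that in auto)
    have "(\<integral>x\<in>B. S T x \<partial>M) - (\<integral>x\<in>B. S (dyad t T n k) x \<partial>M) \<le> (\<integral>x\<in>B. h x \<partial>M)"
      using hull[OF gj B k] by (intro LIMSEQ_le_const[OF l]) auto
    moreover have "(\<integral>x\<in>B. X x \<partial>M) = (\<integral>x\<in>B. S T x \<partial>M) - (\<integral>x\<in>B. h x \<partial>M)"
      unfolding X_def using S_int[OF T] h dyF[OF B k] by (rule set_integral_diff_real)
    ultimately show "(\<integral>x\<in>B. X x \<partial>M) \<le> (\<integral>x\<in>B. S (dyad t T n k) x \<partial>M)" by simp
    assume "k = 0"
    then have "(\<integral>x\<in>B. h x \<partial>M) \<le> (\<integral>x\<in>B. S T x \<partial>M) - (\<integral>x\<in>B. S (dyad t T n k) x \<partial>M)"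
      using hull[OF gj B k] by (intro LIMSEQ_le_const2[OF l]) (auto intro!: exI[of _ n])
    with \<open>(\<integral>x\<in>B. X x \<partial>M) = _\<close> \<open>(\<integral>x\<in>B. X x \<partial>M) \<le> _\<close>
    show "(\<integral>x\<in>B. X x \<partial>M) = (\<integral>x\<in>B. S (dyad t T n k) x \<partial>M)" by linarith
  qed
  have "AE x in M. real_cond_exp M (F (dyad t T n k)) X x \<le> S (dyad t T n k) x" if k: "k \<le> 2 ^ n" for n k
  proof -
    interpret sigma_finite_subalgebra M "F (dyad t T n k)" by (intro sigma_finite_subalgebraI sub dy k)
    show ?thesis
    proof (rule AE_le_of_set_integral_le[OF subalg])
      fix B assume B: "B \<in> sets (F (dyad t T n k))"
      show "(\<integral>x\<in>B. real_cond_exp M (F (dyad t T n k)) X x \<partial>M) \<le> (\<integral>x\<in>B. S (dyad t T n k) x \<partial>M)"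
        using XB(1)[OF B k] real_cond_exp_intA[OF X B] by simp
    qed (use X S_int S_meas dy[OF k] in \<open>auto intro!: real_cond_exp_int\<close>)
  qed
  moreover have "AE x in M. real_cond_exp M (F t) X x = S t x"
  proof -
    have t: "t \<in> {t..T}" using tT by auto
    interpret sigma_finite_subalgebra M "F t" by (intro sigma_finite_subalgebraI sub t)
    show ?thesis
      using XB(2)[of _ 0 0] X S_int[OF t] S_meas[OF t] by (intro real_cond_exp_charact) auto
  qed
  ultimately show ?thesis using X by blast
qed

subsection \<open>Right-continuous versions of martingales\<close>

text \<open>The asset is bought when \<open>y\<close> is at most \<open>a\<close> and sold when \<open>y\<close> is at least \<open>b\<close>.\<close>

fun holding :: "real \<Rightarrow> real \<Rightarrow> (nat \<Rightarrow> real) \<Rightarrow> nat \<Rightarrow> bool" where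
  "holding a b y 0 \<longleftrightarrow> y 0 \<le> a"
| "holding a b y (Suc k) \<longleftrightarrow> (if holding a b y k then y (Suc k) < b else y (Suc k) \<le> a)"

fun upcross :: "real \<Rightarrow> real \<Rightarrow> (nat \<Rightarrow> real) \<Rightarrow> nat \<Rightarrow> nat" where
  "upcross a b y 0 = 0"
| "upcross a b y (Suc k) = upcross a b y k + (if holding a b y k \<and> b \<le> y (Suc k) then 1 else 0)"

lemma upcross_mono: "k \<le> l \<Longrightarrow> upcross a b y k \<le> upcross a b y l"
  by (induction l rule: dec_induct) auto

text \<open>Invariant of the trading rule: each completed round trip earns at least
  \<open>b - a\<close>, and an asset still held was bought at \<open>a\<close> or less, so its
  running gain is at least \<open>y k - a\<close>.\<close>

lemma upcross_gain:
  "(b - a) * real (upcross a b y k) + (if holding a b y k then y k - a else 0)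
    \<le> (\<Sum>j<k. of_bool (holding a b y j) * (y (Suc j) - y j))"
proof (induction k)
  case (Suc k)
  show ?case
  proof (cases "holding a b y k \<and> b \<le> y (Suc k)")
    case True
    then have "\<not> holding a b y (Suc k)" by simp
    then show ?thesis using Suc True by (simp add: distrib_left)
  next
    case False
    then show ?thesis using Suc by auto
  qed
qed auto

text \<open>Whatever happened before, the asset is held at \<open>i\<close>, because
  \<open>y i \<le> a < b\<close>; at \<open>j\<close> it is not, so it was sold in between.\<close>

lemma upcross_between:
  assumes ab: "a < b" and ij: "i < j" and y: "y i \<le> a" "b \<le> y j"
  shows "Suc (upcross a b y i) \<le> upcross a b y j"
proof -
  have hi: "holding a b y i" using y(1) ab by (cases i) auto
  have "Suc (upcross a b y i) \<le> upcross a b y k \<or> (holding a b y k \<and> upcross a b y i \<le> upcross a b y k)"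
    if "i \<le> k" for k
    using that hi by (induction k rule: dec_induct) auto
  moreover have "\<not> holding a b y j" using y(2) ij ab by (cases j) auto
  ultimately show ?thesis using less_imp_le[OF ij] by blast
qed

text \<open>If lower and upper limit differed, two rational levels would fit strictly between them
  and neither alternative of \<open>no\<close> could hold. Boundedness makes the limit
  finite.\<close>

lemma tendsto_of_no_oscillation:
  fixes f :: "'b \<Rightarrow> real"
  assumes bd: "eventually (\<lambda>q. \<bar>f q\<bar> \<le> C) F"
    and no: "\<And>a b::rat. a < b \<Longrightarrow> eventually (\<lambda>q. of_rat a \<le> f q) F \<or> eventually (\<lambda>q. f q \<le> of_rat b) F"
  shows "\<exists>l. (f \<longlongrightarrow> l) F"
proof (cases "F = bot")
  case True
  then show ?thesis by (auto simp: tendsto_bot)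
next
  case False
  let ?f = "\<lambda>q. ereal (f q)"
  have le: "Liminf F ?f \<le> Limsup F ?f" by (rule Liminf_le_Limsup[OF False])
  have "Liminf F ?f = Limsup F ?f"
  proof (rule ccontr)
    assume "Liminf F ?f \<noteq> Limsup F ?f"
    then have lt: "Liminf F ?f < Limsup F ?f" using le by simp
    obtain a :: rat where a: "Liminf F ?f < ereal (of_rat a)" "ereal (of_rat a) < Limsup F ?f"
      using ereal_dense3[OF lt] by blast
    obtain b :: rat where b: "ereal (of_rat a) < ereal (of_rat b)" "ereal (of_rat b) < Limsup F ?f"
      using ereal_dense3[OF a(2)] by blast
    have "a < b" using b(1) by (simp add: of_rat_less)
    from no[OF this] show False
    proof
      assume "eventually (\<lambda>q. of_rat a \<le> f q) F"
      then have "ereal (of_rat a) \<le> Liminf F ?f" by (intro Liminf_bounded) simp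
      with a(1) show False by simp
    next
      assume "eventually (\<lambda>q. f q \<le> of_rat b) F"
      then have "Limsup F ?f \<le> ereal (of_rat b)" by (intro Limsup_bounded) simp
      with b(2) show False by simp
    qed
  qed
  then have lim: "(?f \<longlongrightarrow> Limsup F ?f) F"
    using tendsto_iff_Liminf_eq_Limsup[OF False] by metis
  have "Limsup F ?f \<le> ereal C"
    by (rule Limsup_bounded) (use bd in \<open>auto elim: eventually_mono\<close>)
  moreover have "ereal (- C) \<le> Liminf F ?f"
    by (rule Liminf_bounded) (use bd in \<open>auto elim!: eventually_mono\<close>)
  ultimately obtain l where "Limsup F ?f = ereal l"
    using \<open>Liminf F ?f = Limsup F ?f\<close> by (cases "Limsup F ?f") auto
  with lim show ?thesis by auto
qed

section \<open>Upcrossing and maximal inequalities for a closed martingale in discrete time\<close>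

locale discrete_closed_martingale = prob_space +
  fixes G :: "nat \<Rightarrow> 'a measure" and X :: "'a \<Rightarrow> real" and m :: nat
  assumes sub: "\<And>k. k \<le> m \<Longrightarrow> subalgebra M (G k)"
    and mono: "\<And>k l. k \<le> l \<Longrightarrow> l \<le> m \<Longrightarrow> sets (G k) \<subseteq> sets (G l)"
    and X: "integrable M X"
begin

definition cexp :: "nat \<Rightarrow> 'a \<Rightarrow> real" where
  "cexp k = real_cond_exp M (G k) X"

lemma space_G: "k \<le> m \<Longrightarrow> space (G k) = space M"
  using sub by (auto simp: subalgebra_def)

lemma sets_G: "k \<le> m \<Longrightarrow> B \<in> sets (G k) \<Longrightarrow> B \<in> sets M"
  using sub by (auto simp: subalgebra_def)

lemma cexp_meas: "k \<le> l \<Longrightarrow> l \<le> m \<Longrightarrow> cexp k \<in> borel_measurable (G l)"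
  using mono[of k l] space_G[of k] space_G[of l]
  by (intro borel_measurable_subalgebra[of "G k" "G l"]) (auto simp: cexp_def)

lemma cexp_int: "k \<le> m \<Longrightarrow> integrable M (cexp k)"
  unfolding cexp_def using sigma_finite_subalgebra.real_cond_exp_int(1)[OF sigma_finite_subalgebraI[OF sub] X] .

lemma cexp_set: "k \<le> m \<Longrightarrow> B \<in> sets (G k) \<Longrightarrow> (\<integral>x\<in>B. cexp k x \<partial>M) = (\<integral>x\<in>B. X x \<partial>M)"
  unfolding cexp_def using sigma_finite_subalgebra.real_cond_exp_intA[OF sigma_finite_subalgebraI[OF sub] X] by simp

lemma holding_sets:
  "k \<le> l \<Longrightarrow> l \<le> m \<Longrightarrow> {x\<in>space M. holding a b (\<lambda>k. cexp k x) k} \<in> sets (G l)"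
proof (induction k)
  case 0
  then show ?case using cexp_meas[of 0 l] space_G[of l] by (simp flip: space_G[of l])
next
  case (Suc k)
  have "{x\<in>space M. holding a b (\<lambda>k. cexp k x) (Suc k)} =
     ({x\<in>space M. holding a b (\<lambda>k. cexp k x) k} \<inter> {x\<in>space (G l). cexp (Suc k) x < b}) \<union>
     ({x\<in>space (G l). cexp (Suc k) x \<le> a} - {x\<in>space M. holding a b (\<lambda>k. cexp k x) k})"
    using space_G[of l] Suc by auto
  moreover have "{x\<in>space (G l). cexp (Suc k) x < b} \<in> sets (G l)" "{x\<in>space (G l). cexp (Suc k) x \<le> a} \<in> sets (G l)"
    using cexp_meas[of "Suc k" l] Suc by auto
  ultimately show ?case using Suc by auto
qed

lemma upcross_meas: "k \<le> m \<Longrightarrow> (\<lambda>x. real (upcross a b (\<lambda>k. cexp k x) k)) \<in> borel_measurable M"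
proof (induction k)
  case (Suc k)
  have "{x\<in>space M. holding a b (\<lambda>k. cexp k x) k} \<in> sets M"
    using sets_G[OF _ holding_sets[of k k]] Suc by simp
  then have [measurable]: "Measurable.pred M (\<lambda>x. holding a b (\<lambda>k. cexp k x) k)" by (simp add: pred_def)
  have [measurable]: "cexp (Suc k) \<in> borel_measurable M" using cexp_int[of "Suc k"] Suc by auto
  have [measurable]: "(\<lambda>x. real (upcross a b (\<lambda>k. cexp k x) k)) \<in> borel_measurable M" using Suc by simp
  show ?case by (simp add: of_nat_add) measurable
qed simp

text \<open>The trading gains have mean zero, since the decision to hold is taken before the
  increment. By \<open>upcross_gain\<close> only the loss on an open position remains to be covered;
  it is at most \<open>\<bar>a\<bar>\<close> plus the modulus of the last value, whose mean is at
  most that of \<open>\<bar>X\<bar>\<close>.\<close>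

lemma upcross_expectation:
  assumes ab: "a < b"
  shows "ennreal (b - a) * (\<integral>\<^sup>+x. ennreal (real (upcross a b (\<lambda>k. cexp k x) m)) \<partial>M) \<le> ennreal (\<bar>a\<bar> + (\<integral>x. \<bar>X x\<bar> \<partial>M))"
proof -
  define H where "H j = {x\<in>space M. holding a b (\<lambda>k. cexp k x) j}" for j
  have HG: "H j \<in> sets (G j)" if "j \<le> m" for j unfolding H_def using holding_sets[of j j] that by auto
  have HM: "H j \<in> sets M" if "j \<le> m" for j using sets_G[OF that HG[OF that]] .
  have gain_int: "integrable M (\<lambda>x. indicat_real (H j) x *\<^sub>R (cexp (Suc j) x - cexp j x))" if "j < m" for j
    using cexp_int[of j] cexp_int[of "Suc j"] HM[of j] that by (intro integrable_mult_indicator) auto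
  have gain0: "(\<integral>x. indicat_real (H j) x *\<^sub>R (cexp (Suc j) x - cexp j x) \<partial>M) = 0" if j: "j < m" for j
  proof -
    have "(\<integral>x. indicat_real (H j) x *\<^sub>R (cexp (Suc j) x - cexp j x) \<partial>M) = (\<integral>x\<in>H j. cexp (Suc j) x - cexp j x \<partial>M)"
      by (simp add: set_lebesgue_integral_def)
    also have "\<dots> = (\<integral>x\<in>H j. cexp (Suc j) x \<partial>M) - (\<integral>x\<in>H j. cexp j x \<partial>M)"
      using cexp_int[of j] cexp_int[of "Suc j"] HM[of j] j by (intro set_integral_diff_real) auto
    also have "\<dots> = 0"
      using cexp_set[of j "H j"] cexp_set[of "Suc j" "H j"] HG[of j] mono[of j "Suc j"] j by auto
    finally show ?thesis .
  qed
  define g where "g x = (\<Sum>j<m. indicat_real (H j) x *\<^sub>R (cexp (Suc j) x - cexp j x)) + (\<bar>a\<bar> + \<bar>cexp m x\<bar>)" for x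
  have g_int: "integrable M g"
    unfolding g_def using gain_int cexp_int[of m] by (intro Bochner_Integration.integrable_add Bochner_Integration.integrable_sum) auto
  have le: "(b - a) * real (upcross a b (\<lambda>k. cexp k x) m) \<le> g x" if "x \<in> space M" for x
  proof -
    have "indicat_real (H j) x = of_bool (holding a b (\<lambda>k. cexp k x) j)" for j
      using that by (simp add: H_def indicator_def)
    then show ?thesis unfolding g_def using upcross_gain[of b a "\<lambda>k. cexp k x" m]
      by (auto split: if_splits)
  qed
  have "ennreal (b - a) * (\<integral>\<^sup>+x. ennreal (real (upcross a b (\<lambda>k. cexp k x) m)) \<partial>M) =
      (\<integral>\<^sup>+x. ennreal ((b - a) * real (upcross a b (\<lambda>k. cexp k x) m)) \<partial>M)"
    using ab upcross_meas[of m] by (subst nn_integral_cmult[symmetric]) (auto simp: ennreal_mult)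
  also have "\<dots> \<le> (\<integral>\<^sup>+x. ennreal (g x) \<partial>M)"
    by (rule nn_integral_mono) (use le in \<open>auto intro: ennreal_leI\<close>)
  also have "\<dots> = ennreal (\<integral>x. g x \<partial>M)"
  proof (rule nn_integral_eq_integral[OF g_int])
    have "0 \<le> g x" if "x \<in> space M" for x
      using mult_nonneg_nonneg[of "b - a" "real (upcross a b (\<lambda>k. cexp k x) m)"] le[OF that] ab by linarith
    then show "AE x in M. 0 \<le> g x" by auto
  qed
  also have "(\<integral>x. g x \<partial>M) = (\<integral>x. (\<Sum>j<m. indicat_real (H j) x *\<^sub>R (cexp (Suc j) x - cexp j x)) \<partial>M) + (\<integral>x. \<bar>a\<bar> + \<bar>cexp m x\<bar> \<partial>M)"
    unfolding g_def using gain_int cexp_int[of m] by (intro Bochner_Integration.integral_add Bochner_Integration.integrable_sum) auto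
  also have "(\<integral>x. (\<Sum>j<m. indicat_real (H j) x *\<^sub>R (cexp (Suc j) x - cexp j x)) \<partial>M) = 0"
    using gain_int gain0 by (subst Bochner_Integration.integral_sum) auto
  also have "0 + (\<integral>x. \<bar>a\<bar> + \<bar>cexp m x\<bar> \<partial>M) = \<bar>a\<bar> + (\<integral>x. \<bar>cexp m x\<bar> \<partial>M)"
    using cexp_int[of m] by (simp add: prob_space)
  also have "(\<integral>x. \<bar>cexp m x\<bar> \<partial>M) \<le> (\<integral>x. \<bar>X x\<bar> \<partial>M)"
    using cond_exp_excess[OF sub[of m] X sets.top, of 0] unfolding cexp_def
    by (simp add: set_lebesgue_integral_def space_G cong: Bochner_Integration.integral_cong)
  finally show ?thesis by (simp add: ennreal_leI)
qed

text \<open>Decompose by the first index at which the modulus reaches \<open>l\<close>. That event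
  belongs to \<open>G k\<close>, so Jensen's inequality on it passes from \<open>cexp k\<close> to
  \<open>X\<close>.\<close>

lemma maximal_inequality:
  assumes l: "l > 0"
  shows "l * prob {x\<in>space M. \<exists>k\<le>m. l \<le> \<bar>cexp k x\<bar>} \<le> (\<integral>x. \<bar>X x\<bar> \<partial>M)"
proof -
  define B where "B k = {x\<in>space M. l \<le> \<bar>cexp k x\<bar> \<and> (\<forall>j<k. \<bar>cexp j x\<bar> < l)}" for k
  have BG: "B k \<in> sets (G k)" if k: "k \<le> m" for k
  proof -
    have "cexp k \<in> borel_measurable (G k)" using cexp_meas[OF order_refl k] .
    then have yk: "{x\<in>space (G k). l \<le> \<bar>cexp k x\<bar>} \<in> sets (G k)" by measurable
    have yj: "{x\<in>space (G k). \<bar>cexp j x\<bar> < l} \<in> sets (G k)" if "j \<le> k" for j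
      using cexp_meas[OF that k] by measurable
    have "B k = {x\<in>space (G k). l \<le> \<bar>cexp k x\<bar>} \<inter> (space (G k) \<inter> (\<Inter>j\<in>{..<k}. {x\<in>space (G k). \<bar>cexp j x\<bar> < l}))"
      using space_G[OF k] by (auto simp: B_def)
    also have "\<dots> \<in> sets (G k)"
    proof (cases "k = 0")
      case False
      then have "(\<Inter>j\<in>{..<k}. {x\<in>space (G k). \<bar>cexp j x\<bar> < l}) \<in> sets (G k)"
        using yj by (intro sets.finite_INT) auto
      then show ?thesis using yk by auto
    qed (use yk in auto)
    finally show ?thesis .
  qed
  have BM: "B k \<in> sets M" if "k \<le> m" for k using sets_G[OF that BG[OF that]] .
  have "B i \<inter> B j = {}" if "i < j" for i j using that by (auto simp: B_def)
  then have disj: "disjoint_family_on B {..m}"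
    unfolding disjoint_family_on_def by (metis Int_commute linorder_neqE_nat)
  have un: "{x\<in>space M. \<exists>k\<le>m. l \<le> \<bar>cexp k x\<bar>} = (\<Union>k\<le>m. B k)"
  proof safe
    fix x k assume x: "x \<in> space M" and k: "k \<le> m" "l \<le> \<bar>cexp k x\<bar>"
    define k0 where "k0 = (LEAST k. l \<le> \<bar>cexp k x\<bar>)"
    have "l \<le> \<bar>cexp k0 x\<bar>" unfolding k0_def using k(2) by (rule LeastI)
    moreover have "k0 \<le> k" unfolding k0_def using k(2) by (rule Least_le)
    moreover have "\<bar>cexp j x\<bar> < l" if "j < k0" for j using not_less_Least[of j "\<lambda>k. l \<le> \<bar>cexp k x\<bar>"] that unfolding k0_def by auto
    ultimately show "x \<in> (\<Union>k\<le>m. B k)" using x k by (auto simp: B_def intro!: bexI[of _ k0])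
  qed (auto simp: B_def)
  have step: "l * prob (B k) \<le> (\<integral>x\<in>B k. \<bar>X x\<bar> \<partial>M)" if k: "k \<le> m" for k
  proof -
    have "l * prob (B k) = (\<integral>x\<in>B k. l \<partial>M)"
      using BM[OF k] by (simp add: set_lebesgue_integral_def)
    also have "\<dots> \<le> (\<integral>x\<in>B k. \<bar>cexp k x\<bar> \<partial>M)"
    proof (rule set_integral_mono_real[OF _ _ BM[OF k]])
      show "AE x in M. x \<in> B k \<longrightarrow> l \<le> \<bar>cexp k x\<bar>" by (auto simp: B_def)
    qed (use cexp_int[OF k] in auto)
    also have "\<dots> \<le> (\<integral>x\<in>B k. \<bar>X x\<bar> \<partial>M)"
      using cond_exp_excess[OF sub[OF k] X BG[OF k], of 0] unfolding cexp_def by simp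
    finally show ?thesis .
  qed
  have "prob (\<Union>k\<le>m. B k) = (\<Sum>k\<le>m. prob (B k))"
    by (rule finite_measure_finite_Union[OF _ _ disj]) (use BM in auto)
  then have "l * prob (\<Union>k\<le>m. B k) = (\<Sum>k\<le>m. l * prob (B k))"
    by (simp add: sum_distrib_left)
  also have "\<dots> \<le> (\<Sum>k\<le>m. \<integral>x\<in>B k. \<bar>X x\<bar> \<partial>M)"
    by (intro sum_mono step) auto
  also have "\<dots> = (\<integral>x\<in>(\<Union>k\<le>m. B k). \<bar>X x\<bar> \<partial>M)"
    using disj X BM by (intro set_integral_finite_Union[symmetric]) (auto simp: set_integrable_def simp del: real_scaleR_def intro!: integrable_mult_indicator)
  also have "\<dots> \<le> (\<integral>x. \<bar>X x\<bar> \<partial>M)"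
    unfolding set_lebesgue_integral_def using X BM
    by (intro integral_mono integrable_mult_indicator) (auto simp: indicator_def)
  finally show ?thesis unfolding un .
qed

end

section \<open>Dyadic times approaching a given time from the right\<close>

definition dyads :: "real \<Rightarrow> real \<Rightarrow> real set" where
  "dyads t T = {dyad t T n k | n k. k \<le> 2 ^ n}"

lemma T_in_dyads: "T \<in> dyads t T"
  unfolding dyads_def using dyad_top[of t T 0] by (intro CollectI exI[of _ 0] exI[of _ 1]) (auto simp: dyad_def)

lemma countable_dyads: "countable (dyads t T)"
proof -
  have "dyads t T \<subseteq> (\<lambda>(n, k). dyad t T n k) ` (UNIV \<times> UNIV)" by (auto simp: dyads_def)
  then show ?thesis by (rule countable_subset) auto
qed

text \<open>The minima below exist for \<open>s < T\<close> and \<open>s \<le> T\<close>, respectively, since \<open>dyad t T n (2 ^ n) = T\<close>.\<close>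

definition dy_gt :: "real \<Rightarrow> real \<Rightarrow> nat \<Rightarrow> real \<Rightarrow> real" where
  "dy_gt t T n s = dyad t T n (LEAST k. s < dyad t T n k)"

definition dy_ge_ix :: "real \<Rightarrow> real \<Rightarrow> nat \<Rightarrow> real \<Rightarrow> nat" where
  "dy_ge_ix t T n s = (LEAST k. s \<le> dyad t T n k)"

lemma dyad_Suc: "dyad t T n (Suc k) = dyad t T n k + (T - t) / 2 ^ n"
  unfolding dyad_def by (simp add: distrib_left add_divide_distrib)

lemma dy_gt:
  assumes s: "t \<le> s" "s < T"
  shows "s < dy_gt t T n s" "dy_gt t T n s \<le> T" "dy_gt t T n s \<le> s + (T - t) / 2 ^ n" "dy_gt t T n s \<in> dyads t T"
proof -
  define k where "k = (LEAST k. s < dyad t T n k)"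
  have eq: "dy_gt t T n s = dyad t T n k" by (simp add: dy_gt_def k_def)
  have top: "s < dyad t T n (2 ^ n)" using s by simp
  show 1: "s < dy_gt t T n s" unfolding eq k_def by (rule LeastI[of _ "2^n"]) (rule top)
  have k2: "k \<le> 2 ^ n" unfolding k_def by (rule Least_le) (rule top)
  then show "dy_gt t T n s \<le> T" "dy_gt t T n s \<in> dyads t T"
    using dyad_in[of t T k n] s unfolding eq dyads_def by auto
  obtain j where j: "k = Suc j" using 1 s unfolding eq by (cases k) auto
  then have "\<not> s < dyad t T n j" unfolding k_def by (intro not_less_Least) auto
  then show "dy_gt t T n s \<le> s + (T - t) / 2 ^ n" unfolding eq j dyad_Suc by simp
qed

lemma dy_ge_ix:
  assumes s: "t \<le> s" "s \<le> T"
  shows "s \<le> dyad t T n (dy_ge_ix t T n s)" "dy_ge_ix t T n s \<le> 2 ^ n"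
    "dyad t T n (dy_ge_ix t T n s) \<le> s + (T - t) / 2 ^ n"
proof -
  define k where "k = (LEAST k. s \<le> dyad t T n k)"
  have eq: "dy_ge_ix t T n s = k" by (simp add: dy_ge_ix_def k_def)
  have top: "s \<le> dyad t T n (2 ^ n)" using s by simp
  show 1: "s \<le> dyad t T n (dy_ge_ix t T n s)" unfolding eq k_def by (rule LeastI[of _ "2^n"]) (rule top)
  show "dy_ge_ix t T n s \<le> 2 ^ n" unfolding eq k_def by (rule Least_le) (rule top)
  show "dyad t T n (dy_ge_ix t T n s) \<le> s + (T - t) / 2 ^ n"
  proof (cases k)
    case 0
    moreover have "0 \<le> (T - t) / 2 ^ n" using s by simp
    ultimately show ?thesis unfolding eq using s(1) by simp
  next
    case (Suc j)
    then have "\<not> s \<le> dyad t T n j" unfolding k_def by (intro not_less_Least) auto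
    then show ?thesis unfolding eq Suc dyad_Suc by simp
  qed
qed

text \<open>The reason why rounding up turns stopping times into stopping times: at a grid point,
  having reached the rounded time and having reached the original one are the same event.\<close>

lemma dy_ge_ix_le_iff:
  assumes "t \<le> T" "s \<le> T" "k \<le> 2 ^ n"
  shows "dy_ge_ix t T n s \<le> k \<longleftrightarrow> s \<le> dyad t T n k"
proof
  assume "dy_ge_ix t T n s \<le> k"
  moreover have "s \<le> dyad t T n (dy_ge_ix t T n s)"
    unfolding dy_ge_ix_def by (rule LeastI[of _ "2^n"]) (use assms in simp)
  ultimately show "s \<le> dyad t T n k" using dyad_mono[OF assms(1)] order_trans by blast
qed (auto simp: dy_ge_ix_def intro: Least_le)

lemma tendsto_mesh: "(\<lambda>n. c / 2 ^ n) \<longlonglongrightarrow> (0::real)"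
  using tendsto_mult[OF tendsto_const[of c] LIMSEQ_realpow_zero[of "1/2::real"]] by (simp add: power_divide)

lemma dy_gt_tendsto:
  assumes "t \<le> s" "s < T"
  shows "(\<lambda>n. dy_gt t T n s) \<longlonglongrightarrow> s"
proof (rule tendsto_sandwich[OF _ _ tendsto_const])
  show "(\<lambda>n. s + (T - t) / 2 ^ n) \<longlonglongrightarrow> s" using tendsto_add[OF tendsto_const tendsto_mesh] by force
qed (use dy_gt[OF assms] in \<open>auto intro!: always_eventually less_imp_le\<close>)

lemma mesh_small:
  assumes "e > (0::real)"
  shows "\<exists>n0. \<forall>n\<ge>n0. \<bar>c / 2 ^ n\<bar> < e"
  using tendsto_mesh[of c, THEN LIMSEQ_D, of e] assms by auto

section \<open>Right limits along dyadic times in continuous time\<close>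

locale closed_martingale = prob_space +
  fixes F :: "real \<Rightarrow> 'a measure" and X :: "'a \<Rightarrow> real" and t T :: real
  assumes tT: "t \<le> T"
    and sub: "\<And>s. s \<in> {t..T} \<Longrightarrow> subalgebra M (F s)"
    and space_F: "\<And>s. space (F s) = space M"
    and mono: "\<And>s r. s \<le> r \<Longrightarrow> sets (F s) \<subseteq> sets (F r)"
    and X: "integrable M X"
begin

definition cexp :: "real \<Rightarrow> 'a \<Rightarrow> real" where
  "cexp s = real_cond_exp M (F s) X"

lemma discrete: "discrete_closed_martingale M (\<lambda>k. F (dyad t T n k)) X (2 ^ n)"
  using sub dyad_in[OF tT] mono dyad_mono[OF tT] X by unfold_locales auto

abbreviation U :: "real \<Rightarrow> real \<Rightarrow> nat \<Rightarrow> 'a \<Rightarrow> nat \<Rightarrow> nat" where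
  "U a b n x \<equiv> upcross a b (\<lambda>k. cexp (dyad t T n k) x)"

text \<open>Fatou's lemma for the upcrossing inequality, whose bound does not depend on the grid.
  The result concerns infinitely many grids only; this is enough, since an oscillating path has many
  upcrossings on all sufficiently fine grids.\<close>

lemma AE_upcross_bounded:
  assumes ab: "a < b"
  shows "AE x in M. \<exists>C::nat. \<forall>N. \<exists>n\<ge>N. U a b n x (2 ^ n) \<le> C"
proof -
  let ?K = "\<bar>a\<bar> + (\<integral>x. \<bar>X x\<bar> \<partial>M)"
  have meas: "(\<lambda>x. real (U a b n x (2 ^ n))) \<in> borel_measurable M" for n
    using discrete_closed_martingale.upcross_meas[OF discrete[of n], of "2^n" a b]
    unfolding discrete_closed_martingale.cexp_def[OF discrete] cexp_def by simp
  have bd: "ennreal (b - a) * (\<integral>\<^sup>+x. ennreal (real (U a b n x (2 ^ n))) \<partial>M) \<le> ennreal ?K" for n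
    using discrete_closed_martingale.upcross_expectation[OF discrete[of n] ab]
    unfolding discrete_closed_martingale.cexp_def[OF discrete] cexp_def .
  have bd': "(\<integral>\<^sup>+x. ennreal (real (U a b n x (2 ^ n))) \<partial>M) \<le> ennreal (1 / (b - a)) * ennreal ?K" for n
  proof -
    have "(\<integral>\<^sup>+x. ennreal (real (U a b n x (2 ^ n))) \<partial>M) =
        ennreal (1 / (b - a)) * (ennreal (b - a) * (\<integral>\<^sup>+x. ennreal (real (U a b n x (2 ^ n))) \<partial>M))"
      using ab by (simp add: mult.assoc[symmetric] ennreal_mult[symmetric])
    also have "\<dots> \<le> ennreal (1 / (b - a)) * ennreal ?K" by (rule mult_left_mono[OF bd]) simp
    finally show ?thesis .
  qed
  have "(\<integral>\<^sup>+x. liminf (\<lambda>n. ennreal (real (U a b n x (2 ^ n)))) \<partial>M) \<le> liminf (\<lambda>n. \<integral>\<^sup>+x. ennreal (real (U a b n x (2 ^ n))) \<partial>M)"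
    using meas by (intro nn_integral_liminf) auto
  also have "\<dots> \<le> liminf (\<lambda>n::nat. ennreal (1 / (b - a)) * ennreal ?K)" by (rule Liminf_mono) (use bd' in auto)
  also have "\<dots> < \<infinity>" by (simp add: Liminf_const ennreal_mult_less_top)
  finally have "(\<integral>\<^sup>+x. liminf (\<lambda>n. ennreal (real (U a b n x (2 ^ n)))) \<partial>M) \<noteq> \<infinity>" by simp
  then have "AE x in M. liminf (\<lambda>n. ennreal (real (U a b n x (2 ^ n)))) \<noteq> \<infinity>"
    using meas by (intro nn_integral_PInf_AE) auto
  then show ?thesis
  proof eventually_elim
    case (elim x)
    show ?case
    proof (rule ccontr)
      assume neg: "\<not> ?thesis"
      have "ennreal (real C) \<le> liminf (\<lambda>n. ennreal (real (U a b n x (2 ^ n))))" for C :: nat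
      proof -
        have "\<exists>N. \<forall>n\<ge>N. \<not> U a b n x (2 ^ n) \<le> C" using neg by blast
        then obtain N where "\<forall>n\<ge>N. C < U a b n x (2 ^ n)" by (auto simp: not_le)
        then show ?thesis
          by (intro Liminf_bounded) (auto simp: eventually_sequentially intro!: exI[of _ N] ennreal_leI less_imp_le)
      qed
      then have "\<not> liminf (\<lambda>n. ennreal (real (U a b n x (2 ^ n)))) < of_nat C" for C :: nat
        by (simp add: ennreal_of_nat_eq_real_of_nat not_less)
      then have "liminf (\<lambda>n. ennreal (real (U a b n x (2 ^ n)))) = top"
        using ennreal_Ex_less_of_nat less_top by blast
      with elim show False by simp
    qed
  qed
qed

text \<open>Points are chosen backwards in time, ever nearer to \<open>s\<close>: a value of at
  least \<open>b\<close> and, left of it, one of at most \<open>a\<close> add an upcrossing before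
  those already found. All chosen points persist on finer grids.\<close>

lemma upcross_of_oscillation:
  assumes ab: "a < b" and s: "t \<le> s" "s < T"
    and oa: "\<And>s'. s < s' \<Longrightarrow> \<exists>q\<in>dyads t T. s < q \<and> q < s' \<and> cexp q x \<le> a"
    and ob: "\<And>s'. s < s' \<Longrightarrow> \<exists>q\<in>dyads t T. s < q \<and> q < s' \<and> b \<le> cexp q x"
  shows "\<exists>N. \<forall>n\<ge>N. C \<le> U a b n x (2 ^ n)"
proof -
  have lt: "dyad t T n k < dyad t T n l \<Longrightarrow> k < l" for n k l
    using dyad_mono[OF tT, of l k n] by (meson leD leI)
  \<comment> \<open>The induction remembers the leftmost point chosen so far. On grid
    \<open>n\<close> it has index \<open>k0 * 2 ^ (n - n0)\<close>, and at least \<open>C\<close>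
    upcrossings are completed after it.\<close>
  have "\<exists>n0 k0. k0 \<le> 2 ^ n0 \<and> s < dyad t T n0 k0 \<and>
    (\<forall>n\<ge>n0. U a b n x (k0 * 2 ^ (n - n0)) + C \<le> U a b n x (2 ^ n))"
  proof (induction C)
    case 0
    show ?case
      by (rule exI[of _ 0], rule exI[of _ 1]) (use s in \<open>auto simp: dyad_def\<close>)
  next
    case (Suc C)
    then obtain n0 k0 where k0: "k0 \<le> 2 ^ n0" "s < dyad t T n0 k0"
      "\<And>n. n \<ge> n0 \<Longrightarrow> U a b n x (k0 * 2 ^ (n - n0)) + C \<le> U a b n x (2 ^ n)" by blast
    obtain n1 k1 where q1: "k1 \<le> 2 ^ n1" "s < dyad t T n1 k1" "dyad t T n1 k1 < dyad t T n0 k0" "b \<le> cexp (dyad t T n1 k1) x"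
      using ob[OF k0(2)] by (auto simp: dyads_def)
    obtain n2 k2 where q2: "k2 \<le> 2 ^ n2" "s < dyad t T n2 k2" "dyad t T n2 k2 < dyad t T n1 k1" "cexp (dyad t T n2 k2) x \<le> a"
      using oa[OF q1(2)] by (auto simp: dyads_def)
    define n' where "n' = max n0 (max n1 n2)"
    define k' where "k' = k2 * 2 ^ (n' - n2)"
    have d': "dyad t T n' k' = dyad t T n2 k2" unfolding k'_def by (rule dyad_refine[symmetric]) (simp add: n'_def)
    have k': "k' \<le> 2 ^ n'"
    proof -
      have "k' \<le> 2 ^ n2 * 2 ^ (n' - n2)" unfolding k'_def using q2(1) by (rule mult_right_mono) simp
      also have "\<dots> = 2 ^ n'" by (simp add: n'_def flip: power_add)
      finally show ?thesis .
    qed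
    have "U a b n x (k' * 2 ^ (n - n')) + Suc C \<le> U a b n x (2 ^ n)" if n: "n \<ge> n'" for n
    proof -
      have ge: "n \<ge> n0" "n \<ge> n1" "n \<ge> n2" using n unfolding n'_def by auto
      have e2: "dyad t T n (k' * 2 ^ (n - n')) = dyad t T n2 k2"
        using dyad_refine[OF n, of t T k'] d' by simp
      have e1: "dyad t T n (k1 * 2 ^ (n - n1)) = dyad t T n1 k1"
        using dyad_refine[OF ge(2), of t T k1] by simp
      have e0: "dyad t T n (k0 * 2 ^ (n - n0)) = dyad t T n0 k0"
        using dyad_refine[OF ge(1), of t T k0] by simp
      have "Suc (U a b n x (k' * 2 ^ (n - n'))) \<le> U a b n x (k1 * 2 ^ (n - n1))"
        by (rule upcross_between[OF ab lt[of n]]) (use e1 e2 q1 q2 in auto)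
      also have "\<dots> \<le> U a b n x (k0 * 2 ^ (n - n0))"
        by (rule upcross_mono[OF less_imp_le[OF lt[of n]]]) (use e1 e0 q1 in auto)
      finally show ?thesis using k0(3)[OF ge(1)] by simp
    qed
    then show ?case using k' q2(2) d' by (intro exI[of _ n'] exI[of _ k']) auto
  qed
  then obtain n0 k0 where "\<forall>n\<ge>n0. U a b n x (k0 * 2 ^ (n - n0)) + C \<le> U a b n x (2 ^ n)" by blast
  then show ?thesis by (meson add_leD2)
qed

text \<open>The maximal inequality bounds the probability of reaching the level \<open>Suc l\<close>
  uniformly over the grids. These are nested, so continuity of the measure gives the same bound for
  all dyadic times together, and it tends to zero as \<open>l\<close> grows.\<close>

lemma AE_bounded: "AE x in M. \<exists>C. \<forall>q\<in>dyads t T. \<bar>cexp q x\<bar> \<le> C"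
proof -
  define E where "E l n = {x\<in>space M. \<exists>k\<le>2^n. real (Suc l) \<le> \<bar>cexp (dyad t T n k) x\<bar>}" for l n
  have [measurable]: "cexp s \<in> borel_measurable M" if "s \<in> {t..T}" for s
    unfolding cexp_def by simp
  have Emeas: "E l n \<in> sets M" for l n
  proof -
    have "E l n = (\<Union>k\<in>{..2^n}. {x\<in>space M. real (Suc l) \<le> \<bar>cexp (dyad t T n k) x\<bar>})"
      unfolding E_def by auto
    then show ?thesis unfolding cexp_def by auto
  qed
  have Eincr: "incseq (E l)" for l
  proof (rule incseq_SucI, safe)
    fix n x assume "x \<in> E l n"
    then obtain k where k: "x \<in> space M" "k \<le> 2 ^ n" "real (Suc l) \<le> \<bar>cexp (dyad t T n k) x\<bar>" by (auto simp: E_def)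
    then show "x \<in> E l (Suc n)"
      using dyad_refine[of n "Suc n" t T k] unfolding E_def by (auto intro!: exI[of _ "k * 2"])
  qed
  let ?K = "\<integral>x. \<bar>X x\<bar> \<partial>M"
  have PE: "real (Suc l) * prob (E l n) \<le> ?K" for l n
    using discrete_closed_martingale.maximal_inequality[OF discrete[of n], of "real (Suc l)"]
    unfolding discrete_closed_martingale.cexp_def[OF discrete] E_def cexp_def by simp
  have PU: "real (Suc l) * prob (\<Union>n. E l n) \<le> ?K" for l
  proof (rule LIMSEQ_le_const2)
    show "(\<lambda>n. real (Suc l) * prob (E l n)) \<longlonglongrightarrow> real (Suc l) * prob (\<Union>n. E l n)"
      by (intro tendsto_mult tendsto_const finite_Lim_measure_incseq) (use Emeas Eincr in auto)
  qed (use PE in auto)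
  define B where "B = (\<Inter>l. \<Union>n. E l n)"
  have BM: "B \<in> sets M" unfolding B_def using Emeas by auto
  have "prob B \<le> ?K / real (Suc l)" for l
  proof -
    have "prob B \<le> prob (\<Union>n. E l n)" unfolding B_def using Emeas by (intro finite_measure_mono) auto
    then have "real (Suc l) * prob B \<le> real (Suc l) * prob (\<Union>n. E l n)" by (rule mult_left_mono) simp
    with PU[of l] have "prob B * real (Suc l) \<le> ?K" by (simp only: mult.commute)
    then show ?thesis by (simp only: pos_le_divide_eq of_nat_0_less_iff zero_less_Suc)
  qed
  then have "prob B \<le> 0"
    using LIMSEQ_le_const[OF tendsto_mult[OF tendsto_const[of ?K] LIMSEQ_inverse_real_of_nat], of "prob B"]
    by (auto simp: divide_inverse)
  then have "B \<in> null_sets M" using BM measure_nonneg[of M B] by (auto simp: null_sets_def emeasure_eq_measure)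
  from AE_not_in[OF this] show ?thesis using AE_space
  proof eventually_elim
    case (elim x)
    then obtain l where l: "\<And>n. x \<notin> E l n" by (auto simp: B_def)
    have "\<bar>cexp q x\<bar> \<le> real (Suc l)" if "q \<in> dyads t T" for q
    proof -
      obtain n k where "q = dyad t T n k" "k \<le> 2 ^ n" using \<open>q \<in> _\<close> by (auto simp: dyads_def)
      then have "\<not> real (Suc l) \<le> \<bar>cexp q x\<bar>" using l[of n] elim(2) unfolding E_def by blast
      then show ?thesis by simp
    qed
    then show ?case by blast
  qed
qed

definition right_lim :: "'a \<Rightarrow> bool" where
  "right_lim x \<longleftrightarrow> (\<forall>s\<in>{t..<T}. \<exists>l. ((\<lambda>q. cexp q x) \<longlongrightarrow> l) (at s within (dyads t T \<inter> {s<..})))"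

lemma AE_right_lim: "AE x in M. right_lim x"
proof -
  have "AE x in M. \<forall>a b::rat. a < b \<longrightarrow> (\<exists>C::nat. \<forall>N. \<exists>n\<ge>N. U (of_rat a) (of_rat b) n x (2 ^ n) \<le> C)"
    unfolding AE_all_countable by (auto intro!: AE_upcross_bounded simp: of_rat_less)
  with AE_bounded show ?thesis
  proof eventually_elim
    case (elim x)
    from elim(1) obtain C where C: "\<forall>q\<in>dyads t T. \<bar>cexp q x\<bar> \<le> C" by blast
    show ?case unfolding right_lim_def
    proof
      fix s assume s: "s \<in> {t..<T}"
      let ?F = "at s within (dyads t T \<inter> {s<..})"
      show "\<exists>l. ((\<lambda>q. cexp q x) \<longlongrightarrow> l) ?F"
      proof (rule tendsto_of_no_oscillation)
        show "eventually (\<lambda>q. \<bar>cexp q x\<bar> \<le> C) ?F"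
          using C by (auto simp: eventually_at intro!: exI[of _ 1])
        fix a b :: rat assume ab: "a < b"
        show "eventually (\<lambda>q. of_rat a \<le> cexp q x) ?F \<or> eventually (\<lambda>q. cexp q x \<le> of_rat b) ?F"
        proof (rule ccontr)
          assume neg: "\<not> ?thesis"
          have oa: "\<exists>q\<in>dyads t T. s < q \<and> q < s' \<and> cexp q x \<le> of_rat a" if "s < s'" for s'
          proof (rule ccontr)
            assume "\<not> ?thesis"
            then have "eventually (\<lambda>q. of_rat a \<le> cexp q x) ?F"
              unfolding eventually_at using that by (intro exI[of _ "s' - s"]) (force simp: dist_real_def)
            with neg show False by blast
          qed
          have ob: "\<exists>q\<in>dyads t T. s < q \<and> q < s' \<and> of_rat b \<le> cexp q x" if "s < s'" for s'
          proof (rule ccontr)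
            assume "\<not> ?thesis"
            then have "eventually (\<lambda>q. cexp q x \<le> of_rat b) ?F"
              unfolding eventually_at using that by (intro exI[of _ "s' - s"]) (force simp: dist_real_def)
            with neg show False by blast
          qed
          obtain C' where C': "\<forall>N. \<exists>n\<ge>N. U (of_rat a) (of_rat b) n x (2 ^ n) \<le> C'"
            using elim(2) ab by blast
          obtain N where "\<forall>n\<ge>N. Suc C' \<le> U (of_rat a) (of_rat b) n x (2 ^ n)"
            using upcross_of_oscillation[of "of_rat a" "of_rat b" s x "Suc C'"] oa ob s ab by (auto simp: of_rat_less)
          with C' show False by (meson Suc_n_not_le_n le_trans)
        qed
      qed
    qed
  qed
qed

text \<open>The version is the right limit along dyadic times. Right-continuity of the filtration
  makes it measurable at \<open>s\<close>, uniform integrability identifies its integrals over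
  events of \<open>F s\<close>, and by \<open>null\<close> paths may be altered on a null set
  without losing adaptedness.\<close>

theorem right_continuous_version:
  assumes rc: "\<And>s. s \<in> {t..<T} \<Longrightarrow> sets (F s) = (\<Inter>r\<in>{s<..T}. sets (F r))"
    and null: "null_sets M \<subseteq> sets (F t)"
  shows "\<exists>Y. (\<forall>s\<in>{t..T}. Y s \<in> borel_measurable (F s)) \<and>
    (\<forall>s\<in>{t..T}. AE x in M. real_cond_exp M (F s) X x = Y s x) \<and>
    (\<forall>x\<in>space M. right_cont_on t T (\<lambda>s. Y s x))"
proof -
  obtain N where N: "N \<in> null_sets M" "{x\<in>space M. \<not> right_lim x} \<subseteq> N"
    using AE_right_lim by (auto simp: eventually_ae_filter)
  have NF: "N \<in> sets (F s)" if "s \<in> {t..T}" for s using N(1) null mono[of t s] that by auto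
  have good: "right_lim x" if "x \<in> space M - N" for x using that N(2) by auto
  \<comment> \<open>On the exceptional set the path is set to zero, which is right-continuous; at
    \<open>T\<close> there is nothing to the right, so the conditional expectation itself is
    taken.\<close>
  define Y where "Y s x = (if x \<in> N then 0 else if s < T then lim (\<lambda>n. cexp (dy_gt t T n s) x) else cexp s x)" for s x
  have cexp_meas: "cexp s \<in> borel_measurable (F r)" if "s \<in> {t..T}" "s \<le> r" for s r
    using mono[OF that(2)] space_F
    by (intro borel_measurable_subalgebra[of "F s" "F r"]) (auto simp: cexp_def)
  have lim_dy: "(\<lambda>n. cexp (dy_gt t T n s) x) \<longlonglongrightarrow> l"
    if s: "s \<in> {t..<T}" and l: "((\<lambda>q. cexp q x) \<longlongrightarrow> l) (at s within (dyads t T \<inter> {s<..}))" for s x l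
  proof (rule filterlim_compose[OF l])
    show "filterlim (\<lambda>n. dy_gt t T n s) (at s within (dyads t T \<inter> {s<..})) sequentially"
      unfolding filterlim_at using s dy_gt_tendsto[of t s T] dy_gt[of t s T] by (auto intro!: always_eventually) (metis order_less_irrefl)
  qed
  have Y_lim: "((\<lambda>q. cexp q x) \<longlongrightarrow> Y s x) (at s within (dyads t T \<inter> {s<..}))"
    if s: "s \<in> {t..<T}" and x: "x \<in> space M - N" for s x
  proof -
    obtain l where l: "((\<lambda>q. cexp q x) \<longlongrightarrow> l) (at s within (dyads t T \<inter> {s<..}))"
      using good[OF x] s unfolding right_lim_def by blast
    have "lim (\<lambda>n. cexp (dy_gt t T n s) x) = l" using lim_dy[OF s l] by (rule limI)
    then show ?thesis using l x s by (simp add: Y_def)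
  qed
  have Y_seq: "(\<lambda>n. cexp (dy_gt t T n s) x) \<longlonglongrightarrow> Y s x" if "s \<in> {t..<T}" "x \<in> space M - N" for s x
    using lim_dy[OF that(1) Y_lim[OF that]] .
  have Y_meas: "Y s \<in> borel_measurable (F s)" if s: "s \<in> {t..T}" for s
  proof (cases "s < T")
    case False
    then have "Y s = (\<lambda>x. if x \<in> N then 0 else cexp s x)" by (auto simp: Y_def)
    then show ?thesis using cexp_meas[OF s order_refl] NF[OF s] by simp
  next
    case True
    have "Y s \<in> borel_measurable (F r)" if r: "r \<in> {s<..T}" for r
    proof -
      \<comment> \<open>After finitely many terms the dyadic times stay before \<open>r\<close>, so
        the limit is measurable with respect to \<open>F r\<close> for every \<open>r > s\<close>,
        hence with respect to \<open>F s\<close>.\<close>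
      obtain n0 where n0: "\<And>n. n \<ge> n0 \<Longrightarrow> \<bar>(T - t) / 2 ^ n\<bar> < r - s"
        using mesh_small[of "r - s" "T - t"] r by auto
      have [measurable]: "cexp (dy_gt t T (n + n0) s) \<in> borel_measurable (F r)" for n
        using dy_gt[of t s T "n + n0"] s True n0[of "n + n0"] by (intro cexp_meas) auto
      have [measurable]: "N \<in> sets (F r)" using NF[of r] r s by auto
      have "(\<lambda>x. if x \<in> N then 0 else lim (\<lambda>n. cexp (dy_gt t T (n + n0) s) x)) \<in> borel_measurable (F r)"
        by measurable
      moreover have "Y s x = (if x \<in> N then 0 else lim (\<lambda>n. cexp (dy_gt t T (n + n0) s) x))" if "x \<in> space (F r)" for x
      proof (cases "x \<in> N")
        case False
        have "(\<lambda>n. cexp (dy_gt t T (n + n0) s) x) \<longlonglongrightarrow> Y s x"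
          using Y_seq[of s x] s True False that space_F by (intro LIMSEQ_ignore_initial_segment) auto
        then show ?thesis using False limI by metis
      qed (simp add: Y_def)
      ultimately show ?thesis by (simp cong: measurable_cong)
    qed
    then show ?thesis using rc[of s] s True space_F
      by (auto simp: measurable_def)
  qed
  have Y_AE: "AE x in M. real_cond_exp M (F s) X x = Y s x" if s: "s \<in> {t..T}" for s
  proof (cases "s < T")
    case False
    from AE_not_in[OF N(1)] show ?thesis by eventually_elim (use False in \<open>auto simp: Y_def cexp_def\<close>)
  next
    case True
    note d = dy_gt[of t s T]
    have din: "dy_gt t T n s \<in> {t..T}" for n using d[of n] s True by auto
    have ei: "integrable M (cexp (dy_gt t T n s))" for n
      unfolding cexp_def using sigma_finite_subalgebra.real_cond_exp_int(1)[OF sigma_finite_subalgebraI[OF sub[OF din]] X] .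
    have YM: "Y s \<in> borel_measurable M"
      using measurable_from_subalg[OF sub[OF s] Y_meas[OF s]] .
    have conv: "AE x in M. (\<lambda>n. cexp (dy_gt t T n s) x) \<longlonglongrightarrow> Y s x"
      using AE_not_in[OF N(1)] AE_space by eventually_elim (use Y_seq s True in auto)
    have ui: "\<exists>c\<ge>0. \<forall>n. (\<integral>x. max 0 (\<bar>cexp (dy_gt t T n s) x\<bar> - c) \<partial>M) \<le> d" if "d > 0" for d
    proof -
      obtain c where c: "c \<ge> 0" "(\<integral>x. max 0 (\<bar>X x\<bar> - c) \<partial>M) \<le> d"
        using excess_small[OF X \<open>d > 0\<close>] by auto
      have "(\<integral>x. max 0 (\<bar>cexp (dy_gt t T n s) x\<bar> - c) \<partial>M) \<le> (\<integral>x. max 0 (\<bar>X x\<bar> - c) \<partial>M)" for n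
        using cond_exp_excess[OF sub[OF din[of n]] X sets.top, of c] unfolding cexp_def
        by (simp add: set_lebesgue_integral_def space_F cong: Bochner_Integration.integral_cong)
      with c show ?thesis by (meson order_trans)
    qed
    note V = vitali_excess[OF ei YM conv ui]
    interpret sigma_finite_subalgebra M "F s" by (rule sigma_finite_subalgebraI[OF sub[OF s]])
    show ?thesis
    proof (rule real_cond_exp_charact)
      fix B assume B: "B \<in> sets (F s)"
      have BM: "B \<in> sets M" using B subalg by (auto simp: subalgebra_def)
      have Bn: "B \<in> sets (F (dy_gt t T n s))" for n using mono[of s "dy_gt t T n s"] d(1)[of n] s True B by auto
      have "(\<integral>x\<in>B. cexp (dy_gt t T n s) x \<partial>M) = (\<integral>x\<in>B. X x \<partial>M)" for n
        unfolding cexp_def using sigma_finite_subalgebra.real_cond_exp_intA[OF sigma_finite_subalgebraI[OF sub[OF din]] X Bn] by simp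
      with set_integral_tendsto_L1[OF ei V(1) V(2) BM]
      show "(\<integral>x\<in>B. X x \<partial>M) = (\<integral>x\<in>B. Y s x \<partial>M)" by (simp add: LIMSEQ_const_iff)
    qed (use X V Y_meas[OF s] in auto)
  qed
  have Y_rc: "right_cont_on t T (\<lambda>s. Y s x)" if x: "x \<in> space M" for x
    unfolding right_cont_on_def
  proof
    fix s assume s: "s \<in> {t..<T}"
    show "((\<lambda>s. Y s x) \<longlongrightarrow> Y s x) (at_right s)"
    proof (cases "x \<in> N")
      case True
      then show ?thesis by (simp add: Y_def)
    next
      case False
      then have xg: "x \<in> space M - N" using x by simp
      show ?thesis
      proof (rule tendstoI)
        fix d :: real assume d: "d > 0"
        from tendstoD[OF Y_lim[OF s xg], of "d / 2"] d
        obtain h where h: "h > 0" "\<And>q. q \<in> dyads t T \<Longrightarrow> s < q \<Longrightarrow> q < s + h \<Longrightarrow> dist (cexp q x) (Y s x) < d / 2"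
          by (auto simp: eventually_at dist_real_def)
        have "dist (Y r x) (Y s x) < d" if r: "s < r" "r < min T (s + h)" for r
        proof -
          have rT: "r \<in> {t..<T}" using r s by auto
          have l: "(\<lambda>n. dist (cexp (dy_gt t T n r) x) (Y s x)) \<longlonglongrightarrow> dist (Y r x) (Y s x)"
            by (intro tendsto_dist Y_seq[OF rT xg] tendsto_const)
          \<comment> \<open>\<open>Y r x\<close> is itself a limit of values at dyadic times after
            \<open>r\<close>; on fine grids these times still lie before \<open>s + h\<close>, where
            all dyadic values are within \<open>d / 2\<close> of \<open>Y s x\<close>.\<close>
          obtain n0 where n0: "\<And>n. n \<ge> n0 \<Longrightarrow> \<bar>(T - t) / 2 ^ n\<bar> < s + h - r"
            using mesh_small[of "s + h - r" "T - t"] r by auto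
          have "dist (cexp (dy_gt t T n r) x) (Y s x) \<le> d / 2" if "n \<ge> n0" for n
            using h(2)[of "dy_gt t T n r"] dy_gt[of t r T n] rT r n0[OF that] by (intro less_imp_le) auto
          then have "dist (Y r x) (Y s x) \<le> d / 2" by (intro LIMSEQ_le_const2[OF l]) auto
          then show ?thesis using d by simp
        qed
        then show "\<forall>\<^sub>F r in at_right s. dist (Y r x) (Y s x) < d"
          unfolding eventually_at_right_field using s h(1) by (intro exI[of _ "min T (s + h)"]) auto
      qed
    qed
  qed
  show ?thesis using Y_meas Y_AE Y_rc by blast
qed

end

section \<open>Stopping times rounded up to dyadic grids, and optional stopping\<close>

lemma dy_ge_ix_sets:
  assumes tT: "t \<le> T"
    and space_F: "\<And>s. space (F s) = \<Omega>"
    and mono: "\<And>s r. s \<le> r \<Longrightarrow> sets (F s) \<subseteq> sets (F r)"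
    and \<tau>: "stopping_time F \<tau>" "\<tau> \<in> \<Omega> \<rightarrow> {t..T}"
    and k: "k \<le> 2 ^ n"
  shows "{x\<in>\<Omega>. dy_ge_ix t T n (\<tau> x) \<le> k} \<in> sets (F (dyad t T n k))"
    and "{x\<in>\<Omega>. dy_ge_ix t T n (\<tau> x) = k} \<in> sets (F (dyad t T n k))"
proof -
  have le: "{x\<in>\<Omega>. dy_ge_ix t T n (\<tau> x) \<le> k} \<in> sets (F (dyad t T n k))" if k: "k \<le> 2 ^ n" for k
  proof -
    have "{x\<in>\<Omega>. dy_ge_ix t T n (\<tau> x) \<le> k} = {x\<in>space (F (dyad t T n k)). \<tau> x \<le> dyad t T n k}"
      unfolding space_F using dy_ge_ix_le_iff[OF tT _ k] funcset_mem[OF \<tau>(2)] by fastforce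
    then show ?thesis using stopping_timeD[OF \<tau>(1), of "dyad t T n k"] by (simp add: pred_def)
  qed
  then show "{x\<in>\<Omega>. dy_ge_ix t T n (\<tau> x) \<le> k} \<in> sets (F (dyad t T n k))" using k .
  show "{x\<in>\<Omega>. dy_ge_ix t T n (\<tau> x) = k} \<in> sets (F (dyad t T n k))"
  proof (cases k)
    case 0
    then show ?thesis using le[OF k] by simp
  next
    case (Suc j)
    have "{x\<in>\<Omega>. dy_ge_ix t T n (\<tau> x) = k} = {x\<in>\<Omega>. dy_ge_ix t T n (\<tau> x) \<le> k} - {x\<in>\<Omega>. dy_ge_ix t T n (\<tau> x) \<le> j}"
      using Suc by auto
    moreover have "{x\<in>\<Omega>. dy_ge_ix t T n (\<tau> x) \<le> j} \<in> sets (F (dyad t T n k))"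
      using le[of j] mono[OF dyad_mono[OF tT, of j k n]] Suc k by auto
    ultimately show ?thesis using le[OF k] by auto
  qed
qed

lemma integral_random_index:
  fixes g :: "nat \<Rightarrow> 'a \<Rightarrow> real" and \<kappa> :: "'a \<Rightarrow> nat"
  assumes \<kappa>: "\<And>x. x \<in> space M \<Longrightarrow> \<kappa> x \<le> m"
    and B: "\<And>k. k \<le> m \<Longrightarrow> {x\<in>space M. \<kappa> x = k} \<in> sets M"
    and g: "\<And>k. k \<le> m \<Longrightarrow> integrable M (g k)"
  shows "(\<integral>x. g (\<kappa> x) x \<partial>M) = (\<Sum>k\<le>m. \<integral>x\<in>{x\<in>space M. \<kappa> x = k}. g k x \<partial>M)"
    and "integrable M (\<lambda>x. g (\<kappa> x) x)"
proof -
  let ?B = "\<lambda>k. {x\<in>space M. \<kappa> x = k}"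
  have decomp: "g (\<kappa> x) x = (\<Sum>k\<le>m. indicat_real (?B k) x *\<^sub>R g k x)" if "x \<in> space M" for x
  proof -
    have "indicat_real (?B k) x = (if \<kappa> x = k then 1 else 0)" for k using that by auto
    then show ?thesis using \<kappa>[OF that] by (simp add: if_distrib[of "\<lambda>y. y * _"] cong: if_cong)
  qed
  have i: "integrable M (\<lambda>x. indicat_real (?B k) x *\<^sub>R g k x)" if "k \<le> m" for k
    using B[OF that] g[OF that] by (rule integrable_mult_indicator)
  have "(\<integral>x. g (\<kappa> x) x \<partial>M) = (\<integral>x. (\<Sum>k\<le>m. indicat_real (?B k) x *\<^sub>R g k x) \<partial>M)"
    by (rule Bochner_Integration.integral_cong[OF refl decomp])
  also have "\<dots> = (\<Sum>k\<le>m. \<integral>x\<in>?B k. g k x \<partial>M)"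
    unfolding set_lebesgue_integral_def using i by (intro Bochner_Integration.integral_sum) auto
  finally show "(\<integral>x. g (\<kappa> x) x \<partial>M) = (\<Sum>k\<le>m. \<integral>x\<in>?B k. g k x \<partial>M)" .
  have "integrable M (\<lambda>x. \<Sum>k\<le>m. indicat_real (?B k) x *\<^sub>R g k x)"
    using i by (intro Bochner_Integration.integrable_sum) auto
  then show "integrable M (\<lambda>x. g (\<kappa> x) x)"
    by (simp only: Bochner_Integration.integrable_cong[OF refl decomp])
qed

text \<open>Round the stopping time up to dyadic grids. On the event \<open>B n k\<close> the
  stopped value is a conditional expectation of \<open>Y T\<close>, which gives the mean exactly
  and, by Jensen's inequality, uniform integrability; right-continuity then allows the passage to
  the limit.\<close>

theorem (in prob_space) optional_stopping:
  fixes F :: "real \<Rightarrow> 'a measure" and Y :: "real \<Rightarrow> 'a \<Rightarrow> real"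
  assumes tT: "t \<le> T"
    and sub: "\<And>s. s \<in> {t..T} \<Longrightarrow> subalgebra M (F s)"
    and space_F: "\<And>s. space (F s) = space M"
    and mono: "\<And>s r. s \<le> r \<Longrightarrow> sets (F s) \<subseteq> sets (F r)"
    and Y_int: "\<And>s. s \<in> {t..T} \<Longrightarrow> integrable M (Y s)"
    and mart: "\<And>s. s \<in> {t..T} \<Longrightarrow> AE x in M. real_cond_exp M (F s) (Y T) x = Y s x"
    and rc: "\<And>x. x \<in> space M \<Longrightarrow> right_cont_on t T (\<lambda>s. Y s x)"
    and \<tau>: "stopping_time F \<tau>" "\<tau> \<in> space M \<rightarrow> {t..T}"
  shows "integrable M (\<lambda>x. Y (\<tau> x) x)" "(\<integral>x. Y (\<tau> x) x \<partial>M) = (\<integral>x. Y T x \<partial>M)"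
proof -
  define \<kappa> where "\<kappa> n x = dy_ge_ix t T n (\<tau> x)" for n x
  have T: "T \<in> {t..T}" using tT by simp
  have \<tau>in: "t \<le> \<tau> x" "\<tau> x \<le> T" if "x \<in> space M" for x using \<tau>(2) that by auto
  have \<kappa>le: "\<kappa> n x \<le> 2 ^ n" if "x \<in> space M" for n x unfolding \<kappa>_def using dy_ge_ix \<tau>in[OF that] by auto
  define B where "B n k = {x\<in>space M. \<kappa> n x = k}" for n k
  have BF: "B n k \<in> sets (F (dyad t T n k))" if k: "k \<le> 2 ^ n" for n k
    using dy_ge_ix_sets(2)[OF tT space_F mono \<tau> k] by (simp add: B_def \<kappa>_def)
  have BM: "B n k \<in> sets M" if "k \<le> 2 ^ n" for n k
    using BF[OF that] sub[OF dyad_in[OF tT that]] by (auto simp: subalgebra_def)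
  define f where "f n x = Y (dyad t T n (\<kappa> n x)) x" for n x
  have dint: "(\<integral>x. g (\<kappa> n x) x \<partial>M) = (\<Sum>k\<le>2^n. \<integral>x\<in>B n k. g k x \<partial>M)" "integrable M (\<lambda>x. g (\<kappa> n x) x)"
    if gi: "\<And>k. k \<le> 2 ^ n \<Longrightarrow> integrable M (g k)" for g :: "nat \<Rightarrow> 'a \<Rightarrow> real" and n
    using integral_random_index[OF \<kappa>le BM[unfolded B_def] gi] unfolding B_def by auto
  have f_int: "integrable M (f n)" for n
    unfolding f_def using dint(2)[of n "\<lambda>k. Y (dyad t T n k)"] Y_int dyad_in[OF tT] by auto
  have Y_eq: "(\<integral>x\<in>B n k. Y (dyad t T n k) x \<partial>M) = (\<integral>x\<in>B n k. Y T x \<partial>M)"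
    and Y_exc: "(\<integral>x\<in>B n k. max 0 (\<bar>Y (dyad t T n k) x\<bar> - c) \<partial>M) \<le> (\<integral>x\<in>B n k. max 0 (\<bar>Y T x\<bar> - c) \<partial>M)"
    if k: "k \<le> 2 ^ n" for n k c
  proof -
    note d = dyad_in[OF tT k]
    interpret sigma_finite_subalgebra M "F (dyad t T n k)" by (rule sigma_finite_subalgebraI[OF sub[OF d]])
    have YM: "Y (dyad t T n k) \<in> borel_measurable M" using Y_int[OF d] by auto
    have "(\<integral>x\<in>B n k. Y (dyad t T n k) x \<partial>M) = (\<integral>x\<in>B n k. real_cond_exp M (F (dyad t T n k)) (Y T) x \<partial>M)"
      using mart[OF d] BM[OF k] YM by (intro set_lebesgue_integral_cong_AE) auto
    then show "(\<integral>x\<in>B n k. Y (dyad t T n k) x \<partial>M) = (\<integral>x\<in>B n k. Y T x \<partial>M)"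
      using real_cond_exp_intA[OF Y_int[OF T] BF[OF k]] by simp
    have "(\<integral>x\<in>B n k. max 0 (\<bar>Y (dyad t T n k) x\<bar> - c) \<partial>M) = (\<integral>x\<in>B n k. max 0 (\<bar>real_cond_exp M (F (dyad t T n k)) (Y T) x\<bar> - c) \<partial>M)"
      using mart[OF d] BM[OF k] YM by (intro set_lebesgue_integral_cong_AE) auto
    then show "(\<integral>x\<in>B n k. max 0 (\<bar>Y (dyad t T n k) x\<bar> - c) \<partial>M) \<le> (\<integral>x\<in>B n k. max 0 (\<bar>Y T x\<bar> - c) \<partial>M)"
      using cond_exp_excess[OF sub[OF d] Y_int[OF T] BF[OF k]] by simp
  qed
  have f_mean: "(\<integral>x. f n x \<partial>M) = (\<integral>x. Y T x \<partial>M)" for n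
  proof -
    have "(\<integral>x. f n x \<partial>M) = (\<Sum>k\<le>2^n. \<integral>x\<in>B n k. Y (dyad t T n k) x \<partial>M)"
      unfolding f_def using dint(1)[of n "\<lambda>k. Y (dyad t T n k)"] Y_int dyad_in[OF tT] by auto
    also have "\<dots> = (\<Sum>k\<le>2^n. \<integral>x\<in>B n k. Y T x \<partial>M)" by (intro sum.cong refl Y_eq) auto
    also have "\<dots> = (\<integral>x. Y T x \<partial>M)" using dint(1)[of n "\<lambda>k. Y T"] Y_int[OF T] by simp
    finally show ?thesis .
  qed
  have f_ui: "\<exists>c\<ge>0. \<forall>n. (\<integral>x. max 0 (\<bar>f n x\<bar> - c) \<partial>M) \<le> d" if d: "d > 0" for d
  proof -
    obtain c where c: "c \<ge> 0" "(\<integral>x. max 0 (\<bar>Y T x\<bar> - c) \<partial>M) \<le> d"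
      using excess_small[OF Y_int[OF T] d] by auto
    have "(\<integral>x. max 0 (\<bar>f n x\<bar> - c) \<partial>M) \<le> d" for n
    proof -
      have "(\<integral>x. max 0 (\<bar>f n x\<bar> - c) \<partial>M) = (\<Sum>k\<le>2^n. \<integral>x\<in>B n k. max 0 (\<bar>Y (dyad t T n k) x\<bar> - c) \<partial>M)"
        unfolding f_def using dint(1)[of n "\<lambda>k x. max 0 (\<bar>Y (dyad t T n k) x\<bar> - c)"] Y_int dyad_in[OF tT] integrable_excess by auto
      also have "\<dots> \<le> (\<Sum>k\<le>2^n. \<integral>x\<in>B n k. max 0 (\<bar>Y T x\<bar> - c) \<partial>M)"
        by (intro sum_mono Y_exc) auto
      also have "\<dots> = (\<integral>x. max 0 (\<bar>Y T x\<bar> - c) \<partial>M)"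
        using dint(1)[of n "\<lambda>k x. max 0 (\<bar>Y T x\<bar> - c)"] integrable_excess[OF Y_int[OF T]] by simp
      finally show ?thesis using c(2) by simp
    qed
    with c(1) show ?thesis by blast
  qed
  have lim: "(\<lambda>n. f n x) \<longlonglongrightarrow> Y (\<tau> x) x" if x: "x \<in> space M" for x
  proof (cases "\<tau> x < T")
    case False
    then have "\<tau> x = T" using \<tau>in[OF x] by simp
    moreover have "dyad t T n (\<kappa> n x) = T" for n
      using dy_ge_ix(1)[OF \<tau>in[OF x], of n] dyad_in[OF tT \<kappa>le[OF x], of n] \<open>\<tau> x = T\<close> unfolding \<kappa>_def by auto
    ultimately show ?thesis unfolding f_def by simp
  next
    case True
    have "((\<lambda>s. Y s x) \<longlongrightarrow> Y (\<tau> x) x) (at_right (\<tau> x))"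
      using rc[OF x] True \<tau>in[OF x] unfolding right_cont_on_def by auto
    then have *: "continuous (at (\<tau> x) within {\<tau> x<..}) (\<lambda>s. Y s x)" by (simp add: continuous_within)
    \<comment> \<open>The rounded time may equal \<open>\<tau> x\<close>, which the filter
      \<open>at_right\<close> excludes, so the point itself has to be added.\<close>
    have "continuous (at (\<tau> x) within {\<tau> x..}) (\<lambda>s. Y s x)"
      using * by (simp add: continuous_within_topological) (metis atLeast_iff greaterThan_iff order_le_less)
    then have c: "(\<lambda>n. Y (r n) x) \<longlonglongrightarrow> Y (\<tau> x) x" if "\<And>n. \<tau> x \<le> r n" "r \<longlonglongrightarrow> \<tau> x" for r
      using that unfolding continuous_within_sequentially by (auto simp: o_def)
    have "(\<lambda>n. dyad t T n (\<kappa> n x)) \<longlonglongrightarrow> \<tau> x"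
    proof (rule tendsto_sandwich[OF _ _ tendsto_const])
      show "(\<lambda>n. \<tau> x + (T - t) / 2 ^ n) \<longlonglongrightarrow> \<tau> x" using tendsto_add[OF tendsto_const tendsto_mesh] by force
    qed (use dy_ge_ix[OF \<tau>in[OF x]] in \<open>auto simp: \<kappa>_def\<close>)
    then show ?thesis unfolding f_def
      using dy_ge_ix(1)[OF \<tau>in[OF x]] by (intro c) (auto simp: \<kappa>_def)
  qed
  have meas: "(\<lambda>x. Y (\<tau> x) x) \<in> borel_measurable M"
    by (rule borel_measurable_LIMSEQ_real[OF lim]) (use f_int in auto)
  note V = vitali_excess[OF f_int meas AE_I2[OF lim] f_ui]
  show "integrable M (\<lambda>x. Y (\<tau> x) x)" using V by simp
  have "(\<lambda>n. \<integral>x\<in>space M. f n x \<partial>M) \<longlonglongrightarrow> (\<integral>x\<in>space M. Y (\<tau> x) x \<partial>M)"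
    using V by (intro set_integral_tendsto_L1 f_int) auto
  moreover have "(\<integral>x\<in>space M. h x \<partial>M) = (\<integral>x. h x \<partial>M)" for h :: "'a \<Rightarrow> real"
    unfolding set_lebesgue_integral_def by (intro Bochner_Integration.integral_cong) auto
  ultimately show "(\<integral>x. Y (\<tau> x) x \<partial>M) = (\<integral>x. Y T x \<partial>M)" by (simp add: f_mean LIMSEQ_const_iff)
qed

subsection \<open>The controlled game\<close>

lemma concat_at_concat_at: "s \<le> r \<Longrightarrow> concat_at s \<nu> (concat_at r \<nu> \<nu>') = concat_at r \<nu> \<nu>'"
  unfolding concat_at_def by (auto simp: fun_eq_iff)

lemma mix_on_same [simp]: "mix_on A \<nu> \<nu> = \<nu>"
  unfolding mix_on_def by (auto simp: fun_eq_iff)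

lemma paste_apply:
  assumes "disjoint_family A" "\<omega> \<in> A j"
  shows "paste \<nu>s A (r, \<omega>) = \<nu>s j (r, \<omega>)"
proof -
  have "(THE j. \<omega> \<in> A j) = j" using assms by (intro the_equality) (auto simp: disjoint_family_on_def)
  then show ?thesis by (simp add: paste_def)
qed

locale game =
  fixes G :: "('w, 'u, 'v, 'z::metric_space) target_game"
    and K :: "real \<Rightarrow> 'z \<Rightarrow> real"
    and L :: "real \<Rightarrow> 'z \<Rightarrow> ('w, 'u, 'v) strategy \<Rightarrow> ('w, 'v) control \<Rightarrow> real \<Rightarrow> 'w \<Rightarrow> real"
  assumes setting: "game_setting G"
    and C1: "C1 G" and C2: "C2 G" and C3: "C3 G" and C4: "C4 G" and C5: "C5 G"
    and Z1: "Z1 G" and Z2: "Z2 G" and Z4: "Z4 G K"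
    and I1: "I1 G" and I2: "I2 G L"
    and R1: "R1 G K" and R2: "R2 G"
begin

abbreviation "T \<equiv> horizon G"
abbreviation "P \<equiv> Prob G"
abbreviation "F \<equiv> Filt G"
abbreviation "V \<equiv> Vctrls G"
abbreviation "Zp \<equiv> Zproc G"

lemma T_pos: "0 < T"
  and prob_P: "prob_space P"
  and filtration_F: "filtration (space P) F"
  and sub: "s \<in> {0..T} \<Longrightarrow> subalgebra P (F s)"
  and usual: "usual_conditions G"
  and loss_meas [measurable]: "loss G \<in> borel_measurable borel"
  using setting unfolding game_setting_def by auto

lemma Z_adapted: "t \<in> {0..T} \<Longrightarrow> s \<in> {t..T} \<Longrightarrow> u \<in> strats G \<Longrightarrow> \<nu> \<in> V \<Longrightarrow> Zp t z u \<nu> s \<in> F s \<rightarrow>\<^sub>M borel"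
  and Z_cadlag: "t \<in> {0..T} \<Longrightarrow> u \<in> strats G \<Longrightarrow> \<nu> \<in> V \<Longrightarrow> x \<in> space P \<Longrightarrow> cadlag_on t T (\<lambda>s. Zp t z u \<nu> s x)"
  and loss_int: "t \<in> {0..T} \<Longrightarrow> u \<in> strats G \<Longrightarrow> \<nu> \<in> V \<Longrightarrow> integrable P (\<lambda>x. loss G (Zp t z u \<nu> T x))"
  using setting unfolding game_setting_def adapted_on_def by auto

sublocale prob_space P by (rule prob_P)

lemma space_F: "space (F s) = space P"
  using filtration_F by (simp add: filtration_def)

lemma mono_F: "s \<le> r \<Longrightarrow> sets (F s) \<subseteq> sets (F r)"
  using filtration_F by (simp add: filtration_def)

lemma sets_F: "s \<in> {0..T} \<Longrightarrow> A \<in> sets (F s) \<Longrightarrow> A \<in> sets P"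
  using sub by (auto simp: subalgebra_def)

lemma null_F: "s \<in> {0..T} \<Longrightarrow> null_sets P \<subseteq> sets (F s)"
  using usual mono_F[of 0 s] unfolding usual_conditions_def by auto

lemma sigma_sub: "s \<in> {0..T} \<Longrightarrow> sigma_finite_subalgebra P (F s)"
  by (intro sigma_finite_subalgebraI sub)

lemma meas_mono: "s \<le> r \<Longrightarrow> f \<in> F s \<rightarrow>\<^sub>M N \<Longrightarrow> f \<in> F r \<rightarrow>\<^sub>M N"
  using mono_F[of s r] space_F[of s] space_F[of r] by (auto simp: measurable_def)

lemma exp_loss_meas [measurable]: "exp_loss G s t z u \<nu> \<in> borel_measurable (F s)"
  unfolding exp_loss_def by simp

lemma exp_loss_measP: "exp_loss G s t z u \<nu> \<in> borel_measurable P"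
  unfolding exp_loss_def by simp

lemma exp_loss_int:
  assumes "t \<in> {0..T}" "s \<in> {0..T}" "u \<in> strats G" "\<nu> \<in> V"
  shows "integrable P (exp_loss G s t z u \<nu>)"
  unfolding exp_loss_def
  using sigma_finite_subalgebra.real_cond_exp_int(1)[OF sigma_sub loss_int] assms by blast

lemma exp_loss_set_integral:
  assumes "t \<in> {0..T}" "s \<in> {0..T}" "u \<in> strats G" "\<nu> \<in> V" "B \<in> sets (F s)"
  shows "(\<integral>x\<in>B. exp_loss G s t z u \<nu> x \<partial>P) = (\<integral>x\<in>B. loss G (Zp t z u \<nu> T x) \<partial>P)"
  unfolding exp_loss_def
  using sigma_finite_subalgebra.real_cond_exp_intA[OF sigma_sub loss_int] assms by metis

text \<open>The indicator of an event of \<open>F s\<close> can be pulled out of the conditional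
  expectation.\<close>

lemma cond_exp_local:
  assumes s: "s \<in> {0..T}" and f: "integrable P f" and g: "integrable P g" and A: "A \<in> sets (F s)"
    and eq: "AE x in P. x \<in> A \<longrightarrow> f x = g x"
  shows "AE x in P. x \<in> A \<longrightarrow> real_cond_exp P (F s) f x = real_cond_exp P (F s) g x"
proof -
  interpret sigma_finite_subalgebra P "F s" by (rule sigma_sub[OF s])
  have AP: "A \<in> sets P" using sets_F[OF s A] .
  have mf[measurable]: "f \<in> borel_measurable P" "g \<in> borel_measurable P" using f g by auto
  have ind: "indicat_real A \<in> borel_measurable (F s)" using A by simp
  have i: "integrable P (\<lambda>x. indicat_real A x * f x)" "integrable P (\<lambda>x. indicat_real A x * g x)"
    using integrable_mult_indicator[OF AP f] integrable_mult_indicator[OF AP g] by auto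
  have "AE x in P. real_cond_exp P (F s) (\<lambda>x. indicat_real A x * f x) x = real_cond_exp P (F s) (\<lambda>x. indicat_real A x * g x) x"
    using eq AP by (intro real_cond_exp_cong) (auto elim!: eventually_mono simp: indicator_def)
  moreover have "AE x in P. real_cond_exp P (F s) (\<lambda>x. indicat_real A x * f x) x = indicat_real A x * real_cond_exp P (F s) f x"
    by (rule real_cond_exp_mult[OF ind mf(1) i(1)])
  moreover have "AE x in P. real_cond_exp P (F s) (\<lambda>x. indicat_real A x * g x) x = indicat_real A x * real_cond_exp P (F s) g x"
    by (rule real_cond_exp_mult[OF ind mf(2) i(2)])
  ultimately show ?thesis by eventually_elim auto
qed

text \<open>By (Z1) only the controls after the start of the process matter, and by
  \<open>cond_exp_local\<close> only on \<open>A\<close>. This evaluates a pasted strategy piece by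
  piece.\<close>

lemma exp_loss_cong_strat:
  assumes t: "t \<in> {0..T}" and s: "s \<in> {0..T}" and u: "u1 \<in> strats G" "u2 \<in> strats G" and \<nu>: "\<nu> \<in> V"
    and A: "A \<in> sets (F s)"
    and eq: "\<And>x r. x \<in> A \<Longrightarrow> r \<in> {t<..T} \<Longrightarrow> u1 \<nu> (r, x) = u2 \<nu> (r, x)"
  shows "AE x in P. x \<in> A \<longrightarrow> exp_loss G s t z u1 \<nu> x = exp_loss G s t z u2 \<nu> x"
  unfolding exp_loss_def
proof (rule cond_exp_local[OF s loss_int[OF t u(1) \<nu>] loss_int[OF t u(2) \<nu>] A])
  have "AE x in P. x \<in> agree G t T (u1 \<nu>) (u2 \<nu>) \<longrightarrow> Zp t z u1 \<nu> T x = Zp t z u2 \<nu> T x"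
    using Z1 t u \<nu> unfolding Z1_def by auto
  then show "AE x in P. x \<in> A \<longrightarrow> loss G (Zp t z u1 \<nu> T x) = loss G (Zp t z u2 \<nu> T x)"
    using AE_space by eventually_elim (use eq in \<open>auto simp: agree_def\<close>)
qed

lemma exp_loss_cong_ctrl:
  assumes t: "t \<in> {0..T}" and s: "s \<in> {0..T}" and u: "u \<in> strats G" and \<nu>: "\<nu>1 \<in> V" "\<nu>2 \<in> V"
    and A: "A \<in> sets (F s)"
    and eq: "\<And>x r. x \<in> A \<Longrightarrow> r \<in> {0<..T} \<Longrightarrow> \<nu>1 (r, x) = \<nu>2 (r, x)"
  shows "AE x in P. x \<in> A \<longrightarrow> exp_loss G s t z u \<nu>1 x = exp_loss G s t z u \<nu>2 x"
  unfolding exp_loss_def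
proof (rule cond_exp_local[OF s loss_int[OF t u \<nu>(1)] loss_int[OF t u \<nu>(2)] A])
  have "AE x in P. x \<in> agree G 0 T \<nu>1 \<nu>2 \<longrightarrow> Zp t z u \<nu>1 T x = Zp t z u \<nu>2 T x"
    using Z2 t u \<nu> unfolding Z2_def by auto
  then show "AE x in P. x \<in> A \<longrightarrow> loss G (Zp t z u \<nu>1 T x) = loss G (Zp t z u \<nu>2 T x)"
    using AE_space by eventually_elim (use eq in \<open>auto simp: agree_def\<close>)
qed

lemma concat_ctrl: "s \<in> {0..T} \<Longrightarrow> \<nu>0 \<in> V \<Longrightarrow> \<nu>1 \<in> V \<Longrightarrow> \<nu>2 \<in> V \<Longrightarrow> A \<in> sets (F s) \<Longrightarrow>
    concat_at s \<nu>0 (mix_on A \<nu>1 \<nu>2) \<in> V"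
  using C1 unfolding C1_def by blast

lemma concat_ctrl': "s \<in> {0..T} \<Longrightarrow> \<nu>0 \<in> V \<Longrightarrow> \<nu>1 \<in> V \<Longrightarrow> concat_at s \<nu>0 \<nu>1 \<in> V"
  using concat_ctrl[of s \<nu>0 \<nu>1 \<nu>1 "{}"] by simp

lemma strats_ne: "strats G \<noteq> {}"
proof
  assume "strats G = {}"
  from ess_sup_empty[OF this] have "AE x in P. ess_sup P (strats G)
       (\<lambda>u. ess_inf P V (\<lambda>\<nu> x. ereal (exp_loss G 0 0 undefined u \<nu> x))) x = - \<infinity>" .
  moreover have "AE x in P. ess_sup P (strats G)
       (\<lambda>u. ess_inf P V (\<lambda>\<nu> x. ereal (exp_loss G 0 0 undefined u \<nu> x))) x = ereal (K 0 undefined)"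
    using Z4 T_pos unfolding Z4_def by auto
  ultimately have "AE x in P. False" by eventually_elim auto
  then show False by (simp add: AE_False)
qed

lemma is_ess_inf_empty: "V = {} \<Longrightarrow> is_ess_inf P V X (ess_inf P V X)"
  unfolding ess_inf_def by (rule someI[of _ "\<lambda>_. \<infinity>"]) (auto simp: is_ess_inf_def)

text \<open>An empty set of controls is covered too, because \<open>V_ne\<close> is derived only
  later and with the help of this lemma.\<close>

lemma J_is_ess_inf: "is_ess_inf P V (\<lambda>\<nu> x. ereal (exp_loss G s t z u (h \<nu>) x))
    (ess_inf P V (\<lambda>\<nu> x. ereal (exp_loss G s t z u (h \<nu>) x)))"
proof (cases "V = {}")
  case False
  then show ?thesis using exp_loss_measP by (intro ess_inf_is_ess_inf) auto
qed (rule is_ess_inf_empty)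

lemma Jloss_alt: "Jloss G t z u = ess_inf P V (\<lambda>\<nu> x. ereal (exp_loss G t t z u \<nu> x))"
  unfolding Jloss_def Iloss_def ..

lemma Jloss_is_ess_inf: "is_ess_inf P V (\<lambda>\<nu> x. ereal (exp_loss G t t z u \<nu> x)) (Jloss G t z u)"
  unfolding Jloss_alt using J_is_ess_inf[where h="\<lambda>x. x"] .

lemma Jloss_meas [measurable]: "Jloss G t z u \<in> borel_measurable P"
  using Jloss_is_ess_inf unfolding is_ess_inf_def by blast

lemma K_is_ess_sup:
  assumes "t \<in> {0..T}"
  shows "is_ess_sup P (strats G) (\<lambda>u. Jloss G t z u) (\<lambda>_. ereal (K t z))"
proof -
  have e: "is_ess_sup P (strats G) (\<lambda>u. Jloss G t z u) (ess_sup P (strats G) (\<lambda>u. Jloss G t z u))"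
    using strats_ne by (intro ess_sup_is_ess_sup) auto
  have k: "AE x in P. ess_sup P (strats G) (\<lambda>u. Jloss G t z u) x = ereal (K t z)"
    using Z4 assms unfolding Z4_def Jloss_alt by blast
  show ?thesis unfolding is_ess_sup_def
  proof (intro conjI ballI impI)
    fix u assume "u \<in> strats G"
    then have "AE x in P. Jloss G t z u x \<le> ess_sup P (strats G) (\<lambda>u. Jloss G t z u) x"
      using e unfolding is_ess_sup_def by blast
    with k show "AE x in P. Jloss G t z u x \<le> ereal (K t z)" by eventually_elim auto
  next
    fix Y' :: "'w \<Rightarrow> ereal" assume "Y' \<in> borel_measurable P" "\<forall>u\<in>strats G. AE x in P. Jloss G t z u x \<le> Y' x"
    then have "AE x in P. ess_sup P (strats G) (\<lambda>u. Jloss G t z u) x \<le> Y' x"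
      using e unfolding is_ess_sup_def by blast
    with k show "AE x in P. ereal (K t z) \<le> Y' x" by eventually_elim auto
  qed simp
qed

lemma J_le_K:
  assumes "t \<in> {0..T}" "u \<in> strats G"
  shows "AE x in P. Jloss G t z u x \<le> ereal (K t z)"
  using K_is_ess_sup[OF assms(1)] assms(2) unfolding is_ess_sup_def by blast

lemma V_ne: "V \<noteq> {}"
proof
  assume "V = {}"
  obtain u where u: "u \<in> strats G" using strats_ne by blast
  have "AE x in P. Jloss G 0 undefined u x = \<infinity>" unfolding Jloss_alt by (rule ess_inf_empty) fact
  moreover have "AE x in P. Jloss G 0 undefined u x \<le> ereal (K 0 undefined)" using J_le_K u T_pos by auto
  ultimately have "AE x in P. False" by eventually_elim auto
  then show False by (simp add: AE_False)
qed

lemma Lam_le_K: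
  assumes "t \<in> {0..T}" "(z, p) \<in> Lam G t"
  shows "p \<le> K t z"
proof -
  obtain u where u: "u \<in> strats G" "AE x in P. ereal p \<le> Jloss G t z u x" using assms(2) unfolding Lam_def by auto
  have "AE x in P. p \<le> K t z"
    using u(2) J_le_K[OF assms(1) u(1), of z]
  proof eventually_elim
    case (elim x)
    then have "ereal p \<le> ereal (K t z)" by (rule order_trans)
    then show ?case by simp
  qed
  then show ?thesis by simp
qed

lemma constant_event_fam:
  assumes t: "t \<in> {0..T}" and A: "A \<in> sets (F t)"
  shows "(\<lambda>\<nu>\<in>V. A) \<in> event_fams G t"
  using C4 t A unfolding C4_def by auto

lemma paste_strats:
  assumes t: "t \<in> {0..T}" and u0: "u0 \<in> strats G" and u: "\<And>j::nat. u j \<in> strats G"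
    and A: "\<And>j. A j \<in> event_fams G t"
    and disj: "\<And>\<nu>. \<nu> \<in> V \<Longrightarrow> disjoint_family (\<lambda>j. A j \<nu>)"
    and un: "\<And>\<nu>. \<nu> \<in> V \<Longrightarrow> (\<Union>j. A j \<nu>) = space P"
  shows "\<exists>u'\<in>strats G. \<forall>\<nu>\<in>V. \<forall>r x. (r \<le> t \<longrightarrow> u' \<nu> (r, x) = u0 \<nu> (r, x)) \<and>
    (\<forall>j. x \<in> A j \<nu> \<longrightarrow> t < r \<longrightarrow> u' \<nu> (r, x) = u j \<nu> (r, x))"
proof -
  let ?u = "\<lambda>\<nu>\<in>V. concat_at t (u0 \<nu>) (paste (\<lambda>j. u j \<nu>) (\<lambda>j. A j \<nu>))"
  have "?u \<in> strats G"
    using C2[unfolded C2_def, rule_format, OF t u0, of u A] u A disj un by blast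
  moreover have "(r \<le> t \<longrightarrow> ?u \<nu> (r, x) = u0 \<nu> (r, x)) \<and>
    (\<forall>j. x \<in> A j \<nu> \<longrightarrow> t < r \<longrightarrow> ?u \<nu> (r, x) = u j \<nu> (r, x))" if \<nu>: "\<nu> \<in> V" for \<nu> r x
    using \<nu> paste_apply[OF disj[OF \<nu>]] by (auto simp: concat_at_def)
  ultimately show ?thesis by blast
qed

text \<open>Countably many strategies realise the essential supremum \<open>K t z > p\<close>. Each
  outcome follows the first of them whose value exceeds \<open>p\<close>; this selection is made by
  events of \<open>F t\<close> that do not depend on the control, so (C2) pastes the pieces into one
  strategy.\<close>

lemma Lam_below_K:
  assumes t: "t \<in> {0..T}" and p: "p < K t z"
  shows "(z, p) \<in> Lam G t"
proof -
  obtain u :: "nat \<Rightarrow> ('w, 'u, 'v) strategy" where u: "range u \<subseteq> strats G"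
    "is_ess_sup P (strats G) (\<lambda>u. Jloss G t z u) (\<lambda>x. SUP n. Jloss G t z (u n) x)"
    using ess_sup_countable[of "strats G" "\<lambda>u. Jloss G t z u"] strats_ne by auto
  have uS: "u n \<in> strats G" for n using u(1) by auto
  have supK: "AE x in P. (SUP n. Jloss G t z (u n) x) = ereal (K t z)"
    by (rule is_ess_sup_unique[OF u(2) K_is_ess_sup[OF t]])
  \<comment> \<open>The selected version of \<open>Jloss\<close> is only known to be measurable for
    \<open>P\<close>. A countable infimum of conditional expectations provides a version that is
    measurable at \<open>t\<close>, as the selection requires.\<close>
  have "\<exists>Y. Y \<in> borel_measurable (F t) \<and> (AE x in P. Y x = Jloss G t z (u n) x)" for n
  proof -
    obtain f :: "nat \<Rightarrow> ('w, 'v) control" where f: "range f \<subseteq> V"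
      "is_ess_inf P V (\<lambda>\<nu> x. ereal (exp_loss G t t z (u n) \<nu> x)) (\<lambda>x. INF k. ereal (exp_loss G t t z (u n) (f k) x))"
      using ess_inf_countable[of V "\<lambda>\<nu> x. ereal (exp_loss G t t z (u n) \<nu> x)"] V_ne exp_loss_measP by auto
    have "AE x in P. (INF k. ereal (exp_loss G t t z (u n) (f k) x)) = Jloss G t z (u n) x"
      by (rule is_ess_inf_unique[OF f(2) Jloss_is_ess_inf])
    moreover have "(\<lambda>x. INF k. ereal (exp_loss G t t z (u n) (f k) x)) \<in> borel_measurable (F t)"
      by measurable
    ultimately show ?thesis by blast
  qed
  then obtain Y where Y[measurable]: "\<And>n. Y n \<in> borel_measurable (F t)"
    and YJ: "\<And>n. AE x in P. Y n x = Jloss G t z (u n) x" by metis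
  \<comment> \<open>The default 0 matters only on a null set, since the supremum of the values
    exceeds \<open>p\<close> almost surely.\<close>
  define k where "k x = (if \<exists>n. ereal p < Y n x then LEAST n. ereal p < Y n x else 0)" for x
  have k_meas[measurable]: "k \<in> F t \<rightarrow>\<^sub>M count_space UNIV" unfolding k_def by measurable
  define A where "A j = {x\<in>space (F t). k x = j}" for j
  have AF: "A j \<in> sets (F t)" for j unfolding A_def by measurable
  have "\<exists>u'\<in>strats G. \<forall>\<nu>\<in>V. \<forall>r x. (r \<le> t \<longrightarrow> u' \<nu> (r, x) = u 0 \<nu> (r, x)) \<and>
      (\<forall>j. x \<in> (\<lambda>\<nu>\<in>V. A j) \<nu> \<longrightarrow> t < r \<longrightarrow> u' \<nu> (r, x) = u j \<nu> (r, x))"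
    by (rule paste_strats[OF t uS[of 0] uS constant_event_fam[OF t AF]])
      (auto simp: disjoint_family_on_def A_def space_F)
  then obtain u' where u': "u' \<in> strats G" "\<And>\<nu> r x j. \<nu> \<in> V \<Longrightarrow> x \<in> A j \<Longrightarrow> t < r \<Longrightarrow> u' \<nu> (r, x) = u j \<nu> (r, x)"
    by auto
  have "AE x in P. ereal p \<le> ereal (exp_loss G t t z u' \<nu> x)" if \<nu>: "\<nu> \<in> V" for \<nu>
  proof -
    have "AE x in P. \<forall>j. x \<in> A j \<longrightarrow> exp_loss G t t z u' \<nu> x = exp_loss G t t z (u j) \<nu> x"
      unfolding AE_all_countable using u' \<nu> uS t AF by (auto intro!: exp_loss_cong_strat)
    moreover have "AE x in P. \<forall>j. Jloss G t z (u j) x \<le> ereal (exp_loss G t t z (u j) \<nu> x)"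
      unfolding AE_all_countable using Jloss_is_ess_inf[of t z] \<nu> unfolding is_ess_inf_def by blast
    moreover have "AE x in P. \<forall>j. Y j x = Jloss G t z (u j) x"
      unfolding AE_all_countable using YJ by blast
    ultimately show ?thesis using supK AE_space
    proof eventually_elim
      case (elim x)
      have "ereal p < (SUP n. Jloss G t z (u n) x)" using elim(4) p by simp
      then have ex: "\<exists>n. ereal p < Y n x" using elim(3) by (auto simp: less_SUP_iff)
      then have "ereal p < Y (k x) x" unfolding k_def by (auto intro: LeastI)
      moreover have "x \<in> A (k x)" using elim(5) by (simp add: A_def space_F)
      ultimately show ?case using elim(1,2,3) by (metis less_imp_le order_trans)
    qed
  qed
  then have "AE x in P. ereal p \<le> Jloss G t z u' x"
    using Jloss_is_ess_inf[of t z u'] unfolding is_ess_inf_def by auto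
  then show ?thesis unfolding Lam_def using u'(1) by blast
qed

section \<open>The submartingale of conditional lower values\<close>

definition Sinf :: "real \<Rightarrow> 'z \<Rightarrow> ('w, 'u, 'v) strategy \<Rightarrow> ('w, 'v) control \<Rightarrow> real \<Rightarrow> 'w \<Rightarrow> ereal" where
  "Sinf t z u \<nu> s = ess_inf P V (\<lambda>\<nu>' x. ereal (exp_loss G s t z u (concat_at s \<nu> \<nu>') x))"

lemma Sinf_is_ess_inf: "is_ess_inf P V (\<lambda>\<nu>' x. ereal (exp_loss G s t z u (concat_at s \<nu> \<nu>') x)) (Sinf t z u \<nu> s)"
  unfolding Sinf_def using J_is_ess_inf[where h="concat_at s \<nu>"] .

lemma Sinf_le: "\<nu>' \<in> V \<Longrightarrow> AE x in P. Sinf t z u \<nu> s x \<le> ereal (exp_loss G s t z u (concat_at s \<nu> \<nu>') x)"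
  using Sinf_is_ess_inf[of s t z u \<nu>] unfolding is_ess_inf_def by blast

text \<open>Given two continuations, each is followed on the part of \<open>F s\<close> where its
  conditional loss is the smaller one; (C1) admits the mixture, and by (Z2) it attains the smaller
  value on either part.\<close>

lemma Sinf_directed:
  assumes t: "t \<in> {0..T}" and s: "s \<in> {t..T}" and u: "u \<in> strats G" and \<nu>: "\<nu> \<in> V"
  shows "\<exists>f::nat \<Rightarrow> ('w, 'v) control. range f \<subseteq> V \<and>
    (AE x in P. decseq (\<lambda>n. exp_loss G s t z u (concat_at s \<nu> (f n)) x) \<and>
     (\<lambda>n. ereal (exp_loss G s t z u (concat_at s \<nu> (f n)) x)) \<longlonglongrightarrow> Sinf t z u \<nu> s x)"
  unfolding Sinf_def
proof (rule ess_inf_directed[OF exp_loss_measP V_ne])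
  fix \<nu>1 \<nu>2 assume v: "\<nu>1 \<in> V" "\<nu>2 \<in> V"
  have s0: "s \<in> {0..T}" using t s by auto
  let ?e = "\<lambda>\<nu>'. exp_loss G s t z u (concat_at s \<nu> \<nu>')"
  define A where "A = {x\<in>space (F s). ?e \<nu>1 x \<le> ?e \<nu>2 x}"
  have A: "A \<in> sets (F s)" unfolding A_def by measurable
  define k where "k = concat_at s \<nu> (mix_on A \<nu>1 \<nu>2)"
  have kV: "k \<in> V" unfolding k_def by (rule concat_ctrl[OF s0 \<nu> v A])
  have kk: "concat_at s \<nu> k = k" unfolding k_def by (rule concat_at_concat_at) simp
  have "AE x in P. x \<in> A \<longrightarrow> ?e k x = ?e \<nu>1 x"
    unfolding kk by (rule exp_loss_cong_ctrl[OF t s0 u kV concat_ctrl'[OF s0 \<nu> v(1)] A])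
      (auto simp: k_def concat_at_def mix_on_def)
  moreover have "AE x in P. x \<in> space (F s) - A \<longrightarrow> ?e k x = ?e \<nu>2 x"
    unfolding kk by (rule exp_loss_cong_ctrl[OF t s0 u kV concat_ctrl'[OF s0 \<nu> v(2)]])
      (use A in \<open>auto simp: k_def concat_at_def mix_on_def\<close>)
  ultimately have "AE x in P. ?e k x \<le> ?e \<nu>1 x \<and> ?e k x \<le> ?e \<nu>2 x"
    using AE_space by eventually_elim (auto simp: A_def space_F)
  then show "\<exists>k\<in>V. AE x in P. ?e k x \<le> ?e \<nu>1 x \<and> ?e k x \<le> ?e \<nu>2 x" using kV by blast
qed

lemma Sinf_le_K:
  assumes t: "t \<in> {0..T}" and s: "s \<in> {t..T}" and u: "u \<in> strats G" and \<nu>: "\<nu> \<in> V"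
  shows "AE x in P. Sinf t z u \<nu> s x \<le> ereal (K s (Zp t z u \<nu> s x))"
proof -
  have s0: "s \<in> {0..T}" using t s by auto
  have "AE x in P. Sinf t z u \<nu> s x \<le> ereal (K s (Zp t z u \<nu> s x)) + ereal (2 * \<epsilon>)" if \<epsilon>: "\<epsilon> > 0" for \<epsilon>
  proof -
    obtain B zs where B: "(\<Union>j. B j) = UNIV" and R: "\<And>j::nat. AE x in P. Zp t z u \<nu> s x \<in> B j \<longrightarrow>
          Sinf t z u \<nu> s x \<le> Jloss G s (zs j) (strat_after G s u \<nu>) x + ereal \<epsilon> \<and>
          K s (zs j) - \<epsilon> \<le> K s (Zp t z u \<nu> s x)"
      using R1[unfolded R1_def, rule_format, OF t s \<epsilon>, of z] u \<nu> unfolding Sinf_def[symmetric]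
      by (smt (verit, ccfv_threshold) eventually_mono)
    have sa: "strat_after G s u \<nu> \<in> strats G" using C3 s0 u \<nu> unfolding C3_def by blast
    have "AE x in P. \<forall>j. Zp t z u \<nu> s x \<in> B j \<longrightarrow>
          Sinf t z u \<nu> s x \<le> Jloss G s (zs j) (strat_after G s u \<nu>) x + ereal \<epsilon> \<and>
          K s (zs j) - \<epsilon> \<le> K s (Zp t z u \<nu> s x)"
      unfolding AE_all_countable using R by blast
    moreover have "AE x in P. \<forall>j. Jloss G s (zs j) (strat_after G s u \<nu>) x \<le> ereal (K s (zs j))"
      unfolding AE_all_countable using J_le_K[OF s0 sa] by blast
    ultimately show ?thesis
    proof eventually_elim
      case (elim x)
      obtain j where j: "Zp t z u \<nu> s x \<in> B j" using B by blast
      have "Sinf t z u \<nu> s x \<le> Jloss G s (zs j) (strat_after G s u \<nu>) x + ereal \<epsilon>" using elim(1) j by blast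
      also have "\<dots> \<le> ereal (K s (zs j)) + ereal \<epsilon>" using elim(2) by (intro add_right_mono) blast
      also have "\<dots> \<le> ereal (K s (Zp t z u \<nu> s x)) + ereal (2 * \<epsilon>)"
        using elim(1)[rule_format, OF j] by simp
      finally show ?case .
    qed
  qed
  then have "AE x in P. \<forall>n::nat. Sinf t z u \<nu> s x \<le> ereal (K s (Zp t z u \<nu> s x)) + ereal (2 * inverse (real (Suc n)))"
    unfolding AE_all_countable by auto
  then show ?thesis
  proof eventually_elim
    case (elim x)
    have "(\<lambda>n. ereal (K s (Zp t z u \<nu> s x) + 2 * inverse (real (Suc n)))) \<longlonglongrightarrow> ereal (K s (Zp t z u \<nu> s x) + 2 * 0)"
      by (intro tendsto_ereal tendsto_add tendsto_mult tendsto_const LIMSEQ_inverse_real_of_nat)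
    then have "Sinf t z u \<nu> s x \<le> ereal (K s (Zp t z u \<nu> s x) + 2 * 0)"
      by (rule LIMSEQ_le_const) (use elim in auto)
    then show ?case by simp
  qed
qed

text \<open>The control is fixed up to time \<open>t\<close>, because the strategy may depend on it there and only the controls
  with a common past form a directed family. By (C3) the resulting infimum is that of a strategy, hence at most \<open>K t z\<close>.\<close>

lemma K_ge_of_expected_loss:
  assumes t: "t \<in> {0..T}" and u: "u \<in> strats G"
    and le: "\<And>\<nu>. \<nu> \<in> V \<Longrightarrow> c \<le> (\<integral>x. loss G (Zp t z u \<nu> T x) \<partial>P)"
  shows "c \<le> K t z"
proof -
  obtain \<nu> where \<nu>: "\<nu> \<in> V" using V_ne by blast
  have tt: "t \<in> {t..T}" using t by auto
  let ?el = "\<lambda>\<nu>'. exp_loss G t t z u (concat_at t \<nu> \<nu>')"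
  obtain f :: "nat \<Rightarrow> ('w, 'v) control" where f: "range f \<subseteq> V"
    and lim: "AE x in P. decseq (\<lambda>n. ?el (f n) x) \<and> (\<lambda>n. ereal (?el (f n) x)) \<longlonglongrightarrow> Sinf t z u \<nu> t x"
    using Sinf_directed[OF t tt u \<nu>, of z] by blast
  have fV: "f n \<in> V" for n using f by auto
  have cV: "concat_at t \<nu> (f n) \<in> V" for n by (rule concat_ctrl'[OF t \<nu> fV])
  have Z0: "Zp t z' u' \<nu>' t x = z'" if "x \<in> space P" "u' \<in> strats G" "\<nu>' \<in> V" for z' u' \<nu>' x
    using setting t that unfolding game_setting_def by auto
  have SK: "AE x in P. Sinf t z u \<nu> t x \<le> ereal (K t z)"
    using Sinf_le_K[OF t tt u \<nu>, of z] AE_space by eventually_elim (use Z0 u \<nu> in auto)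
  have xi: "integrable P (?el (f n))" for n by (rule exp_loss_int[OF t t u cV])
  have x_mean: "c \<le> (\<integral>x. ?el (f n) x \<partial>P)" for n
  proof -
    have "(\<integral>x. ?el (f n) x \<partial>P) = (\<integral>x. loss G (Zp t z u (concat_at t \<nu> (f n)) T x) \<partial>P)"
      unfolding exp_loss_def
      using sigma_finite_subalgebra.real_cond_exp_int(2)[OF sigma_sub[OF t] loss_int[OF t u cV]] .
    with le[OF cV] show ?thesis by simp
  qed
  \<comment> \<open>The sequence decreases to a limit of at most \<open>K t z\<close>, so its first
    member dominates the positive parts above \<open>K t z\<close>; the negative parts only help the
    estimate.\<close>
  have "(\<lambda>n. \<integral>x. max 0 (?el (f n) x - K t z) \<partial>P) \<longlonglongrightarrow> (\<integral>x. 0 \<partial>P)"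
  proof (rule integral_dominated_convergence[where w="\<lambda>x. \<bar>?el (f 0) x\<bar> + \<bar>K t z\<bar>"])
    show "AE x in P. (\<lambda>n. max 0 (?el (f n) x - K t z)) \<longlonglongrightarrow> 0"
      using lim SK
    proof eventually_elim
      case (elim x)
      show ?case
      proof (rule LIMSEQ_I)
        fix e :: real assume e: "e > 0"
        have "Sinf t z u \<nu> t x < ereal (K t z + e)" using elim(2) e by (auto intro: le_less_trans)
        then have "\<forall>\<^sub>F n in sequentially. ereal (?el (f n) x) < ereal (K t z + e)"
          using elim(1) by (auto dest: order_tendstoD(2))
        then show "\<exists>no. \<forall>n\<ge>no. norm (max 0 (?el (f n) x - K t z) - 0) < e"
          unfolding eventually_sequentially using e by (auto simp: max_def) (smt (verit))
      qed
    qed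
    show "AE x in P. norm (max 0 (?el (f n) x - K t z)) \<le> \<bar>?el (f 0) x\<bar> + \<bar>K t z\<bar>" for n
      using lim
    proof eventually_elim
      case (elim x)
      then have "?el (f n) x \<le> ?el (f 0) x" by (auto simp: decseq_def)
      then show ?case by auto
    qed
    show "(\<lambda>x. max 0 (?el (f n) x - K t z)) \<in> borel_measurable P" for n
      using exp_loss_measP by measurable
  qed (use xi in auto)
  then have l: "(\<lambda>n. K t z + (\<integral>x. max 0 (?el (f n) x - K t z) \<partial>P)) \<longlonglongrightarrow> K t z + 0"
    by (intro tendsto_add tendsto_const) simp
  have "c \<le> K t z + (\<integral>x. max 0 (?el (f n) x - K t z) \<partial>P)" for n
  proof -
    have mi: "integrable P (\<lambda>x. max 0 (?el (f n) x - K t z))" using xi[of n] by auto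
    have "(\<integral>x. ?el (f n) x \<partial>P) \<le> (\<integral>x. K t z + max 0 (?el (f n) x - K t z) \<partial>P)"
      using xi[of n] mi by (intro integral_mono) auto
    also have "\<dots> = K t z + (\<integral>x. max 0 (?el (f n) x - K t z) \<partial>P)"
      using mi by (simp add: prob_space)
    finally show ?thesis using x_mean[of n] by simp
  qed
  then show ?thesis using LIMSEQ_le_const[OF l] by auto
qed


subsection \<open>The two halves of the dynamic programming principle\<close>

text \<open>Limits of decreasing minimising sequences turn \<open>Sinf\<close> into a real-valued
  adapted process \<open>S\<close>. The first member of each sequence bounds it from above and the
  process \<open>N\<close> of (I1) from below, so it is integrable and
  \<open>martingale_below_submartingale\<close> applies.\<close>

lemma martingale_below_K:
  assumes t: "t \<in> {0..T}" and u: "u \<in> strats G" and \<nu>: "\<nu> \<in> V"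
  shows "\<exists>X. integrable P X \<and>
    (\<forall>q\<in>dyads t T. AE x in P. real_cond_exp P (F q) X x \<le> K q (Zp t z u \<nu> q x)) \<and>
    (AE x in P. ereal (real_cond_exp P (F t) X x) = Sinf t z u \<nu> t x)"
proof -
  have tT: "t \<le> T" using t by simp
  have in0: "s \<in> {0..T}" if "s \<in> {t..T}" for s using that t by auto
  obtain N where N: "class_D G t N"
    "\<And>s. s \<in> {t..T} \<Longrightarrow> AE x in P. ereal (N s x) \<le> Sinf t z u \<nu> s x"
    using I1[unfolded I1_def, rule_format, OF t u \<nu>, of z] unfolding Sinf_def by blast
  have N_ui: "\<exists>c\<ge>0. \<forall>\<tau>. stopping_time F \<tau> \<and> \<tau> \<in> space P \<rightarrow> {t..T} \<longrightarrow>
      integrable P (\<lambda>x. N (\<tau> x) x) \<and> (\<integral>x. max 0 (\<bar>N (\<tau> x) x\<bar> - c) \<partial>P) \<le> e" if "e > 0" for e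
    using uniformly_integrable_excess[OF N(1)[unfolded class_D_def] that]
    unfolding stop_times_def by auto
  have N_int: "integrable P (N s)" if "s \<in> {t..T}" for s
  proof -
    obtain c where "\<forall>\<tau>. stopping_time F \<tau> \<and> \<tau> \<in> space P \<rightarrow> {t..T} \<longrightarrow> integrable P (\<lambda>x. N (\<tau> x) x)"
      using N_ui[of 1] by auto
    from this[rule_format, of "\<lambda>_. s"] show ?thesis using that by (auto simp: stopping_time_const)
  qed
  let ?el = "\<lambda>s \<nu>'. exp_loss G s t z u (concat_at s \<nu> \<nu>')"
  have "\<forall>s. \<exists>f::nat \<Rightarrow> ('w, 'v) control. s \<in> {t..T} \<longrightarrow> range f \<subseteq> V \<and>
    (AE x in P. decseq (\<lambda>n. ?el s (f n) x) \<and> (\<lambda>n. ereal (?el s (f n) x)) \<longlonglongrightarrow> Sinf t z u \<nu> s x)"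
    using Sinf_directed[OF t _ u \<nu>, of _ z] by blast
  \<comment> \<open>One sequence is selected for each of the uncountably many times; no
    compatibility between different times is claimed.\<close>
  from choice[OF this] obtain f :: "real \<Rightarrow> nat \<Rightarrow> ('w, 'v) control" where f: "\<And>s. s \<in> {t..T} \<Longrightarrow> range (f s) \<subseteq> V"
    "\<And>s. s \<in> {t..T} \<Longrightarrow> AE x in P. decseq (\<lambda>n. ?el s (f s n) x) \<and> (\<lambda>n. ereal (?el s (f s n) x)) \<longlonglongrightarrow> Sinf t z u \<nu> s x"
    by blast
  define S where "S s x = lim (\<lambda>n. ?el s (f s n) x)" for s x
  have cV: "concat_at s \<nu> (f s n) \<in> V" if "s \<in> {t..T}" for s n
    using f(1)[OF that] concat_ctrl'[OF in0[OF that] \<nu>] by auto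
  have xi: "integrable P (?el s (f s n))" if "s \<in> {t..T}" for s n
    by (rule exp_loss_int[OF t in0[OF that] u cV[OF that]])
  have S: "AE x in P. (\<lambda>n. ?el s (f s n) x) \<longlonglongrightarrow> S s x \<and> ereal (S s x) = Sinf t z u \<nu> s x \<and>
      (\<forall>n. \<bar>?el s (f s n) x\<bar> \<le> \<bar>?el s (f s 0) x\<bar> + \<bar>N s x\<bar>) \<and> N s x \<le> S s x" if s: "s \<in> {t..T}" for s
    using f(2)[OF s] N(2)[OF s]
  proof eventually_elim
    case (elim x)
    have dec: "?el s (f s n) x \<le> ?el s (f s 0) x" for n using elim(1) by (auto simp: decseq_def)
    have ge: "Sinf t z u \<nu> s x \<le> ereal (?el s (f s n) x)" for n
      using elim(1) by (intro decseq_ge) (auto simp: decseq_def)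
    obtain r where r: "Sinf t z u \<nu> s x = ereal r" using elim(2) ge[of 0] by (cases "Sinf t z u \<nu> s x") auto
    have lim: "(\<lambda>n. ?el s (f s n) x) \<longlonglongrightarrow> r" using elim(1) r by simp
    then have "S s x = r" unfolding S_def by (rule limI)
    moreover have "N s x \<le> ?el s (f s n) x" for n using elim(2) ge[of n] r by simp
    ultimately show ?case using lim r dec elim(2) by (auto simp: abs_le_iff) (smt (verit))+
  qed
  have S_meas: "S s \<in> borel_measurable (F s)" for s unfolding S_def by measurable
  have S_measP: "S s \<in> borel_measurable P" if "s \<in> {t..T}" for s
    using measurable_from_subalg[OF sub[OF in0[OF that]] S_meas] .
  have S_int: "integrable P (S s)" if s: "s \<in> {t..T}" for s
  proof (rule Bochner_Integration.integrable_bound)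
    show "integrable P (\<lambda>x. \<bar>?el s (f s 0) x\<bar> + \<bar>N s x\<bar>)" using xi[OF s, of 0] N_int[OF s] by auto
    show "AE x in P. norm (S s x) \<le> norm (\<bar>?el s (f s 0) x\<bar> + \<bar>N s x\<bar>)"
      using S[OF s]
    proof eventually_elim
      case (elim x)
      then have "(\<lambda>n. \<bar>?el s (f s n) x\<bar>) \<longlonglongrightarrow> \<bar>S s x\<bar>" by (auto intro: tendsto_rabs)
      then have "\<bar>S s x\<bar> \<le> \<bar>?el s (f s 0) x\<bar> + \<bar>N s x\<bar>" by (rule LIMSEQ_le_const2) (use elim in auto)
      then show ?case by simp
    qed
  qed (rule S_measP[OF s])
  have submart: "(\<integral>x\<in>B. S s x \<partial>P) \<le> (\<integral>x\<in>B. S r x \<partial>P)"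
    if sr: "t \<le> s" "s \<le> r" "r \<le> T" and B: "B \<in> sets (F s)" for s r B
  proof -
    have s: "s \<in> {t..T}" and r: "r \<in> {t..T}" using sr by auto
    have BP: "B \<in> sets P" using sets_F[OF in0[OF s] B] .
    have Br: "B \<in> sets (F r)" using mono_F[OF sr(2)] B by blast
    have le: "(\<integral>x\<in>B. S s x \<partial>P) \<le> (\<integral>x\<in>B. ?el r (f r n) x \<partial>P)" for n
    proof -
      \<comment> \<open>A control that follows \<open>\<nu>\<close> up to \<open>r\<close> does so
        up to \<open>s\<close>, hence competes in the infimum at \<open>s\<close>. This is the
        submartingale inequality before the passage to the limit in \<open>n\<close>.\<close>
      have c: "concat_at s \<nu> (concat_at r \<nu> (f r n)) = concat_at r \<nu> (f r n)" by (rule concat_at_concat_at[OF sr(2)])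
      have "AE x in P. Sinf t z u \<nu> s x \<le> ereal (exp_loss G s t z u (concat_at r \<nu> (f r n)) x)"
        using Sinf_le[OF cV[OF r, of n], of t z u \<nu> s] unfolding c .
      with S[OF s] have ae: "AE x in P. S s x \<le> exp_loss G s t z u (concat_at r \<nu> (f r n)) x"
        by eventually_elim (metis ereal_less_eq(3))
      have "(\<integral>x\<in>B. S s x \<partial>P) \<le> (\<integral>x\<in>B. exp_loss G s t z u (concat_at r \<nu> (f r n)) x \<partial>P)"
        using ae by (intro set_integral_mono_real S_int s exp_loss_int[OF t in0[OF s] u cV[OF r]] BP) auto
      also have "\<dots> = (\<integral>x\<in>B. ?el r (f r n) x \<partial>P)"
        using exp_loss_set_integral[OF t in0[OF s] u cV[OF r] B] exp_loss_set_integral[OF t in0[OF r] u cV[OF r] Br] by simp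
      finally show ?thesis .
    qed
    have "(\<lambda>n. \<integral>x\<in>B. ?el r (f r n) x \<partial>P) \<longlonglongrightarrow> (\<integral>x\<in>B. S r x \<partial>P)"
      unfolding set_lebesgue_integral_def
    proof (rule integral_dominated_convergence[where w="\<lambda>x. \<bar>?el r (f r 0) x\<bar> + \<bar>N r x\<bar>"])
      show "AE x in P. (\<lambda>n. indicat_real B x *\<^sub>R ?el r (f r n) x) \<longlonglongrightarrow> indicat_real B x *\<^sub>R S r x"
        using S[OF r] by eventually_elim (auto intro!: tendsto_intros)
      show "AE x in P. norm (indicat_real B x *\<^sub>R ?el r (f r n) x) \<le> \<bar>?el r (f r 0) x\<bar> + \<bar>N r x\<bar>" for n
        using S[OF r] by eventually_elim (auto simp: indicator_def)
      show "(\<lambda>x. indicat_real B x *\<^sub>R ?el r (f r n) x) \<in> borel_measurable P" for n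
        using BP exp_loss_measP by measurable
      show "(\<lambda>x. indicat_real B x *\<^sub>R S r x) \<in> borel_measurable P"
        using BP S_measP[OF r] by measurable
    qed (use xi[OF r] N_int[OF r] in auto)
    then show ?thesis using le by (intro LIMSEQ_le_const) auto
  qed
  have "\<exists>X. integrable P X \<and>
    (\<forall>n k. k \<le> 2 ^ n \<longrightarrow> (AE x in P. real_cond_exp P (F (dyad t T n k)) X x \<le> S (dyad t T n k) x)) \<and>
    (AE x in P. real_cond_exp P (F t) X x = S t x)"
  proof (rule martingale_below_submartingale[OF tT sub[OF in0] space_F mono_F S_meas S_int submart _ N_int N_ui])
    show "AE x in P. N s x \<le> S s x" if "s \<in> {t..T}" for s using S[OF that] by eventually_elim auto
  qed
  then obtain X where X: "integrable P X"
    "\<And>n k. k \<le> 2 ^ n \<Longrightarrow> AE x in P. real_cond_exp P (F (dyad t T n k)) X x \<le> S (dyad t T n k) x"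
    "AE x in P. real_cond_exp P (F t) X x = S t x" by blast
  have "AE x in P. real_cond_exp P (F q) X x \<le> K q (Zp t z u \<nu> q x)" if q: "q \<in> dyads t T" for q
  proof -
    obtain n k where nk: "q = dyad t T n k" "k \<le> 2 ^ n" using q by (auto simp: dyads_def)
    have qT: "q \<in> {t..T}" using dyad_in[OF tT nk(2)] nk(1) by simp
    show ?thesis using X(2)[OF nk(2), folded nk(1)] S[OF qT] Sinf_le_K[OF t qT u \<nu>, of z]
    proof eventually_elim
      case (elim x)
      then have "ereal (S q x) \<le> ereal (K q (Zp t z u \<nu> q x))" by metis
      then show ?case using elim(1) by simp
    qed
  qed
  moreover have "AE x in P. ereal (real_cond_exp P (F t) X x) = Sinf t z u \<nu> t x"
    using X(3) S[of t] tT by (auto elim!: AE_mp)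
  ultimately show ?thesis using X(1) by blast
qed

lemma closed_martingale_F:
  assumes "t \<in> {0..T}" "integrable P X"
  shows "closed_martingale P F X t T"
  by unfold_locales (use assms sub space_F mono_F in auto)

text \<open>The closed martingale may start above \<open>p\<close>. Subtracting
  \<open>Y t x - p\<close>, which is almost surely nonnegative, from time \<open>t\<close> on and
  taking the constant \<open>p\<close> before yields a martingale on all of \<open>[0,T]\<close>
  that equals \<open>p\<close> at \<open>t\<close> and only lies lower.\<close>

lemma right_continuous_martingale:
  assumes t: "t \<in> {0..T}" and X: "integrable P X"
    and ge: "AE x in P. p \<le> real_cond_exp P (F t) X x"
  shows "\<exists>M\<in>marts G t p. \<forall>s\<in>{t..T}. AE x in P. M s x \<le> real_cond_exp P (F s) X x"
proof -
  have tin: "t \<in> {t..T}" using t by simp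
  have in0: "s \<in> {0..T}" if "s \<in> {t..T}" for s using that t by auto
  have rc: "sets (F s) = (\<Inter>r\<in>{s<..T}. sets (F r))" if "s \<in> {t..<T}" for s
    using usual that t unfolding usual_conditions_def by auto
  obtain Y where Y: "\<And>s. s \<in> {t..T} \<Longrightarrow> Y s \<in> borel_measurable (F s)"
    "\<And>s. s \<in> {t..T} \<Longrightarrow> AE x in P. real_cond_exp P (F s) X x = Y s x"
    "\<And>x. x \<in> space P \<Longrightarrow> right_cont_on t T (\<lambda>s. Y s x)"
    using closed_martingale.right_continuous_version[OF closed_martingale_F[OF t X] rc null_F[OF t]] by blast
  have YP: "Y s \<in> borel_measurable P" if "s \<in> {t..T}" for s
    using measurable_from_subalg[OF sub[OF in0[OF that]] Y(1)[OF that]] .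
  have Yi: "integrable P (Y s)" if s: "s \<in> {t..T}" for s
  proof -
    have "integrable P (real_cond_exp P (F s) X)"
      using sigma_finite_subalgebra.real_cond_exp_int(1)[OF sigma_sub[OF in0[OF s]] X] .
    then show ?thesis using Y(2)[OF s] YP[OF s]
      by (subst integrable_cong_AE[of _ _ "real_cond_exp P (F s) X"]) (auto elim: AE_mp)
  qed
  define M where "M s x = (if s < t then p else Y s x - (Y t x - p))" for s x
  have Mi: "integrable P (M s)" if "s \<le> T" for s
    using Yi[of s] Yi[OF tin] that unfolding M_def by (cases "s < t") auto
  have Mm: "M s \<in> borel_measurable (F s)" if "s \<le> T" for s
  proof (cases "s < t")
    case True
    then show ?thesis unfolding M_def by simp
  next
    case False
    have "Y t \<in> borel_measurable (F s)" using meas_mono[OF _ Y(1)[OF tin]] False by auto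
    then show ?thesis using Y(1)[of s] False that unfolding M_def by simp
  qed
  have mart1: "AE x in P. real_cond_exp P (F s) (M r) x = M s x" if sr: "t \<le> s" "s \<le> r" "r \<le> T" for s r
  proof -
    have s: "s \<in> {t..T}" and r: "r \<in> {t..T}" using sr by auto
    interpret sigma_finite_subalgebra P "F s" by (rule sigma_sub[OF in0[OF s]])
    have Ytm: "(\<lambda>x. Y t x - p) \<in> borel_measurable (F s)"
      using meas_mono[OF sr(1) Y(1)[OF tin]] by measurable
    have Yti: "integrable P (\<lambda>x. Y t x - p)" using Yi[OF tin] by auto
    have subF: "subalgebra (F r) (F s)" unfolding subalgebra_def using space_F mono_F[OF sr(2)] by auto
    have "M r = (\<lambda>x. Y r x - (Y t x - p))" using sr by (auto simp: M_def)
    then have "AE x in P. real_cond_exp P (F s) (M r) x = real_cond_exp P (F s) (Y r) x - real_cond_exp P (F s) (\<lambda>x. Y t x - p) x"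
      using real_cond_exp_diff[OF Yi[OF r] Yti] by simp
    moreover have "AE x in P. real_cond_exp P (F s) (\<lambda>x. Y t x - p) x = Y t x - p"
      by (rule real_cond_exp_F_meas[OF Yti Ytm])
    moreover have "AE x in P. real_cond_exp P (F s) (Y r) x = real_cond_exp P (F s) (real_cond_exp P (F r) X) x"
      using Y(2)[OF r] YP[OF r] by (intro real_cond_exp_cong) auto
    moreover have "AE x in P. real_cond_exp P (F s) (real_cond_exp P (F r) X) x = real_cond_exp P (F s) X x"
      by (rule real_cond_exp_nested_subalg[OF sub[OF in0[OF r]] subF X])
    ultimately show ?thesis using Y(2)[OF s] by eventually_elim (use sr in \<open>simp add: M_def\<close>)
  qed
  have mart: "AE x in P. real_cond_exp P (F s) (M r) x = M s x" if sr: "0 \<le> s" "s \<le> r" "r \<le> T" for s r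
  proof -
    have s0: "s \<in> {0..T}" using sr by auto
    interpret sigma_finite_subalgebra P "F s" by (rule sigma_sub[OF s0])
    have c: "AE x in P. real_cond_exp P (F s) (\<lambda>_. p) x = p" by (rule real_cond_exp_F_meas) auto
    consider "t \<le> s" | "r < t" | "s < t" "t \<le> r" by linarith
    then show ?thesis
    proof cases
      case 1
      then show ?thesis using mart1 sr by blast
    next
      case 2
      then have "M r = (\<lambda>_. p)" "M s = (\<lambda>_. p)" using sr by (auto simp: M_def)
      then show ?thesis using c by simp
    next
      \<comment> \<open>Here the two times lie on different sides of \<open>t\<close>; conditioning
        on \<open>F t\<close> in between produces the constant \<open>p\<close>.\<close>
      case 3
      have subF: "subalgebra (F t) (F s)" unfolding subalgebra_def using space_F mono_F[of s t] 3 by auto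
      have "AE x in P. real_cond_exp P (F s) (real_cond_exp P (F t) (M r)) x = real_cond_exp P (F s) (M r) x"
        by (rule real_cond_exp_nested_subalg[OF sub[OF t] subF Mi[OF sr(3)]])
      moreover have "AE x in P. real_cond_exp P (F s) (real_cond_exp P (F t) (M r)) x = real_cond_exp P (F s) (\<lambda>_. p) x"
      proof (rule real_cond_exp_cong)
        show "AE x in P. real_cond_exp P (F t) (M r) x = p"
          using mart1[of t r] 3 sr by (auto simp: M_def)
      qed auto
      ultimately show ?thesis using c by eventually_elim (use 3 in \<open>simp add: M_def\<close>)
    qed
  qed
  have M_rc: "right_cont_on 0 T (\<lambda>s. M s x)" if x: "x \<in> space P" for x
    unfolding right_cont_on_def
  proof
    fix s assume s: "s \<in> {0..<T}"
    show "((\<lambda>s. M s x) \<longlongrightarrow> M s x) (at_right s)"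
    proof (cases "s < t")
      case True
      have "\<forall>\<^sub>F r in at_right s. M r x = M s x"
        unfolding eventually_at_right_field using True by (intro exI[of _ t]) (auto simp: M_def)
      then show ?thesis by (rule tendsto_eventually)
    next
      case False
      then have "((\<lambda>s. Y s x) \<longlongrightarrow> Y s x) (at_right s)" using Y(3)[OF x] s by (auto simp: right_cont_on_def)
      then have "((\<lambda>s. Y s x - (Y t x - p)) \<longlongrightarrow> M s x) (at_right s)"
        using False by (auto simp: M_def intro!: tendsto_intros)
      moreover have "\<forall>\<^sub>F r in at_right s. Y r x - (Y t x - p) = M r x"
        unfolding eventually_at_right_field using False by (intro exI[of _ "s + 1"]) (auto simp: M_def)
      ultimately show ?thesis by (rule Lim_transform_eventually)
    qed
  qed
  have "M \<in> marts G t p"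
    unfolding marts_def adapted_on_def using Mm Mi mart M_rc t by (auto simp: M_def)
  moreover have "AE x in P. M s x \<le> real_cond_exp P (F s) X x" if s: "s \<in> {t..T}" for s
    using Y(2)[OF s] Y(2)[OF tin] ge by eventually_elim (use s in \<open>auto simp: M_def\<close>)
  ultimately show ?thesis by blast
qed

text \<open>Dyadic times tending to \<open>s\<close> from the right are the approximating sequence.
  The second coordinate is lowered by \<open>inverse (real (Suc n))\<close> because
  \<open>Lam_below_K\<close> needs a value strictly below \<open>K\<close>. For \<open>s = T\<close>
  the constant sequence serves, as \<open>T\<close> is dyadic.\<close>

lemma Lam_bar_of_le_K:
  assumes t: "t \<in> {0..T}" and s: "s \<in> {t..T}"
    and le: "\<And>q. q \<in> dyads t T \<Longrightarrow> m q \<le> K q (\<zeta> q)"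
    and rc: "s < T \<Longrightarrow> (\<zeta> \<longlongrightarrow> \<zeta> s) (at_right s)" "s < T \<Longrightarrow> (m \<longlongrightarrow> m s) (at_right s)"
  shows "(\<zeta> s, m s) \<in> Lam_bar G s"
proof -
  define q where "q n = (if s < T then dy_gt t T n s else T)" for n
  have d: "s < dy_gt t T n s" "dy_gt t T n s \<le> T" "dy_gt t T n s \<in> dyads t T" if "s < T" for n
    using dy_gt[of t s T n] s that by auto
  note T = T_in_dyads[of T t]
  have qd: "q n \<in> dyads t T" and qs: "s \<le> q n" "q n \<le> T" for n
    using d T s by (auto simp: q_def less_imp_le)
  have q0: "q n \<in> {0..T}" for n using qs[of n] s t by auto
  have L: "(\<lambda>n. (q n, \<zeta> (q n), m (q n) - inverse (real (Suc n)))) \<longlonglongrightarrow> (s, \<zeta> s, m s - 0)"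
  proof (cases "s < T")
    case True
    have q: "filterlim q (at_right s) sequentially"
    proof -
      have "q = (\<lambda>n. dy_gt t T n s)" using True by (simp add: q_def fun_eq_iff)
      then show ?thesis unfolding filterlim_at using dy_gt_tendsto[of t s T] s True d(1)
        by (auto intro!: always_eventually) (metis order_less_irrefl)
    qed
    show ?thesis
      by (intro tendsto_Pair tendsto_diff LIMSEQ_inverse_real_of_nat filterlim_compose[OF rc(1)[OF True] q] filterlim_compose[OF rc(2)[OF True] q])
        (use q in \<open>simp add: filterlim_at\<close>)
  next
    case False
    then have "q = (\<lambda>_. s)" using s by (auto simp: q_def)
    then show ?thesis by (intro tendsto_Pair tendsto_diff LIMSEQ_inverse_real_of_nat) auto
  qed
  have "(\<zeta> (q n), m (q n) - inverse (real (Suc n))) \<in> Lam G (q n)" for n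
  proof (rule Lam_below_K[OF q0])
    have "0 < inverse (real (Suc n))" by simp
    then show "m (q n) - inverse (real (Suc n)) < K (q n) (\<zeta> (q n))" using le[OF qd, of n] by linarith
  qed
  then have "\<exists>tn \<zeta>n mn. (\<lambda>n. (tn n, \<zeta>n n, mn n)) \<longlonglongrightarrow> (s, \<zeta> s, m s) \<and>
      (\<forall>n. tn n \<in> {s..T} \<and> (\<zeta>n n, mn n) \<in> Lam G (tn n))"
    using L qs by (intro exI[of _ q] exI[of _ "\<lambda>n. \<zeta> (q n)"] exI[of _ "\<lambda>n. m (q n) - inverse (real (Suc n))"]) simp
  then show ?thesis unfolding Lam_bar_def by simp
qed

text \<open>The strategy is the one that witnesses \<open>(z, p) \<in> Lam G t\<close>. One null set
  serves all dyadic times, and off it the argument is pathwise, so it applies at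
  \<open>\<tau> x\<close> for every stopping time.\<close>

theorem GDP1:
  assumes t: "t \<in> {0..T}" and zp: "(z, p) \<in> Lam G t"
  shows "\<exists>u\<in>strats G. \<exists>M \<in> V \<rightarrow> marts G t p. \<forall>\<nu>\<in>V. \<forall>\<tau>\<in>stop_times G t. AE x in P.
    (Zp t z u \<nu> (\<tau> x) x, M \<nu> (\<tau> x) x) \<in> Lam_bar G (\<tau> x)"
proof -
  obtain u where u: "u \<in> strats G" and J: "AE x in P. ereal p \<le> Jloss G t z u x"
    using zp unfolding Lam_def by auto
  have "\<exists>M\<in>marts G t p. \<forall>q\<in>dyads t T. AE x in P. M q x \<le> K q (Zp t z u \<nu> q x)" if \<nu>: "\<nu> \<in> V" for \<nu>
  proof -
    obtain X where X: "integrable P X"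
      "\<And>q. q \<in> dyads t T \<Longrightarrow> AE x in P. real_cond_exp P (F q) X x \<le> K q (Zp t z u \<nu> q x)"
      "AE x in P. ereal (real_cond_exp P (F t) X x) = Sinf t z u \<nu> t x"
      using martingale_below_K[OF t u \<nu>, of z] by blast
    have "AE x in P. ereal p \<le> Sinf t z u \<nu> t x"
    proof -
      have "AE x in P. ereal p \<le> ereal (exp_loss G t t z u (concat_at t \<nu> \<nu>') x)" if "\<nu>' \<in> V" for \<nu>'
      proof -
        have "AE x in P. Jloss G t z u x \<le> ereal (exp_loss G t t z u (concat_at t \<nu> \<nu>') x)"
          using Jloss_is_ess_inf[of t z u] concat_ctrl'[OF t \<nu> that] unfolding is_ess_inf_def by blast
        with J show ?thesis by eventually_elim (rule order_trans)
      qed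
      then show ?thesis using Sinf_is_ess_inf[of t t z u \<nu>] unfolding is_ess_inf_def by auto
    qed
    with X(3) have "AE x in P. p \<le> real_cond_exp P (F t) X x"
      by eventually_elim (metis ereal_less_eq(3))
    then obtain M where M: "M \<in> marts G t p" "\<And>s. s \<in> {t..T} \<Longrightarrow> AE x in P. M s x \<le> real_cond_exp P (F s) X x"
      using right_continuous_martingale[OF t X(1)] by blast
    have "AE x in P. M q x \<le> K q (Zp t z u \<nu> q x)" if q: "q \<in> dyads t T" for q
    proof -
      have "q \<in> {t..T}" using q t dyad_in[of t T] by (auto simp: dyads_def)
      from M(2)[OF this] X(2)[OF q] show ?thesis by eventually_elim (rule order_trans)
    qed
    with M(1) show ?thesis by blast
  qed
  then obtain M where M: "\<And>\<nu>. \<nu> \<in> V \<Longrightarrow> M \<nu> \<in> marts G t p"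
    "\<And>\<nu> q. \<nu> \<in> V \<Longrightarrow> q \<in> dyads t T \<Longrightarrow> AE x in P. M \<nu> q x \<le> K q (Zp t z u \<nu> q x)" by metis
  have "AE x in P. (Zp t z u \<nu> (\<tau> x) x, M \<nu> (\<tau> x) x) \<in> Lam_bar G (\<tau> x)"
    if \<nu>: "\<nu> \<in> V" and \<tau>: "\<tau> \<in> stop_times G t" for \<nu> \<tau>
  proof -
    have "AE x in P. \<forall>q\<in>dyads t T. M \<nu> q x \<le> K q (Zp t z u \<nu> q x)"
      using M(2)[OF \<nu>] countable_dyads by (simp add: AE_ball_countable)
    then show ?thesis using AE_space
    proof eventually_elim
      case (elim x)
      have s: "\<tau> x \<in> {t..T}" using \<tau> elim(2) unfolding stop_times_def by auto
      have "right_cont_on t T (\<lambda>s. Zp t z u \<nu> s x)"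
        using Z_cadlag[OF t u \<nu> elim(2)] unfolding cadlag_on_def by blast
      moreover have "right_cont_on 0 T (\<lambda>s. M \<nu> s x)" using M(1)[OF \<nu>] elim(2) unfolding marts_def by auto
      ultimately show ?case
        using Lam_bar_of_le_K[OF t s, of "\<lambda>q. M \<nu> q x" "\<lambda>q. Zp t z u \<nu> q x"] elim(1) s t
        unfolding right_cont_on_def by auto
    qed
  qed
  then show ?thesis using u M(1) by (intro bexI[of _ u] bexI[of _ M]) auto
qed

end

text \<open>The set in (R2) is defined by a supremum over uncountably many times and need not be an
  event. Its outer measure still bounds every event contained in it up to a null set.\<close>

lemma (in finite_measure) measure_le_of_AE_subset:
  assumes H: "H \<in> sets M" and sub: "AE x in M. x \<in> H \<longrightarrow> x \<in> B"
    and B: "outer_measure_of M B \<le> ennreal \<eta>" and \<eta>: "\<eta> \<ge> 0"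
  shows "measure M H \<le> \<eta>"
proof -
  obtain N where N: "N \<in> null_sets M" "{x\<in>space M. \<not> (x \<in> H \<longrightarrow> x \<in> B)} \<subseteq> N"
    using sub by (auto simp: eventually_ae_filter)
  have "H - N \<subseteq> B" using N(2) sets.sets_into_space[OF H] by auto
  have "emeasure M H = emeasure M (H - N)" using emeasure_Diff_null_set[OF N(1) H] by simp
  also have "\<dots> = outer_measure_of M (H - N)" using H N(1) by (intro outer_measure_of_eq[symmetric]) auto
  also have "\<dots> \<le> outer_measure_of M B" by (rule outer_measure_of_mono[OF \<open>H - N \<subseteq> B\<close>])
  also have "\<dots> \<le> ennreal \<eta>" by (rule B)
  finally show ?thesis using \<eta> by (simp add: emeasure_eq_measure)
qed

context game begin

lemma time_fam_stop:
  assumes "t \<in> {0..T}" "\<tau> \<in> time_fams G t" "\<nu> \<in> V"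
  shows "\<tau> \<nu> \<in> stop_times G t"
proof -
  have "\<forall>t\<in>{0..T}. time_fams G t \<subseteq> V \<rightarrow>\<^sub>E stop_times G t"
    using setting unfolding game_setting_def by (elim conjE)
  then have "\<tau> \<in> V \<rightarrow>\<^sub>E stop_times G t" using assms(1,2) by blast
  then show ?thesis using assms(3) by (rule PiE_mem)
qed

lemma mart_fam_mart:
  assumes "t \<in> {0..T}" "M \<in> mart_fams G t p" "\<nu> \<in> V"
  shows "M \<nu> \<in> marts G t p"
proof -
  have "\<forall>t\<in>{0..T}. \<forall>p. mart_fams G t p \<subseteq> V \<rightarrow>\<^sub>E marts G t p"
    using setting unfolding game_setting_def by (elim conjE)
  then have "M \<in> V \<rightarrow>\<^sub>E marts G t p" using assms(1,2) by blast
  then show ?thesis using assms(3) by (rule PiE_mem)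
qed

lemma stopped_martingale_mean:
  assumes t: "t \<in> {0..T}" and M: "M \<in> marts G t p" and \<tau>: "\<tau> \<in> stop_times G t"
  shows "integrable P (\<lambda>x. M (\<tau> x) x)" "(\<integral>x. M (\<tau> x) x \<partial>P) = p"
proof -
  have in0: "s \<in> {0..T}" if "s \<in> {t..T}" for s using that t by auto
  have tT: "t \<le> T" and tin: "t \<in> {t..T}" using t by auto
  have Mi: "integrable P (M s)" if "s \<in> {t..T}" for s
    using M in0[OF that] unfolding marts_def by auto
  have mart: "AE x in P. real_cond_exp P (F s) (M T) x = M s x" if "s \<in> {t..T}" for s
    using M in0[OF that] T_pos unfolding marts_def by auto
  have rc: "right_cont_on t T (\<lambda>s. M s x)" if "x \<in> space P" for x
    using M that t unfolding marts_def right_cont_on_def by auto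
  have \<tau>': "stopping_time F \<tau>" "\<tau> \<in> space P \<rightarrow> {t..T}" using \<tau> unfolding stop_times_def by auto
  note * = optional_stopping[OF tT sub[OF in0] space_F mono_F Mi mart rc \<tau>']
  show "integrable P (\<lambda>x. M (\<tau> x) x)" by (rule *)
  have MT: "integrable P (M T)" using M T_pos unfolding marts_def by auto
  have "(\<integral>x. M T x \<partial>P) = (\<integral>x. real_cond_exp P (F t) (M T) x \<partial>P)"
    using sigma_finite_subalgebra.real_cond_exp_int(2)[OF sigma_sub[OF t] MT] by simp
  also have "\<dots> = (\<integral>x. p \<partial>P)"
  proof (rule integral_cong_AE)
    have "AE x in P. M t x = p" using M unfolding marts_def by auto
    with mart[OF tin] show "AE x in P. real_cond_exp P (F t) (M T) x = p" by eventually_elim simp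
  qed auto
  finally show "(\<integral>x. M (\<tau> x) x \<partial>P) = p" using * by (simp add: prob_space)
qed

text \<open>(C2) with a partition whose member 0 is the whole space and whose other members are
  empty.\<close>

lemma strat_concat_strats:
  assumes t: "t \<in> {0..T}" and u: "u \<in> strats G" "u' \<in> strats G"
  shows "strat_concat G t u u' \<in> strats G"
proof -
  define A where "A j = (\<lambda>\<nu>\<in>V. if j = (0::nat) then space P else {})" for j
  have "A j \<in> event_fams G t" for j
    unfolding A_def by (rule constant_event_fam[OF t]) (auto simp flip: space_F[of t])
  then have "(\<lambda>\<nu>\<in>V. concat_at t (u \<nu>) (paste (\<lambda>j. u' \<nu>) (\<lambda>j. A j \<nu>))) \<in> strats G"
    using C2[unfolded C2_def, rule_format, OF t u(1), of "\<lambda>j. u'" A] u(2)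
    by (auto simp: A_def disjoint_family_on_def split: if_splits)
  then show ?thesis unfolding strat_concat_def by (simp add: paste_def)
qed

text \<open>(I2) is applied with \<open>w\<close> itself as the continuation: on \<open>A\<close>
  the concatenation of \<open>u\<close> and \<open>w\<close> at \<open>s\<close> coincides with
  \<open>w\<close>, since \<open>w\<close> follows \<open>u\<close> up to \<open>s\<close>
  there.\<close>

lemma exp_loss_ge_L:
  assumes t: "t \<in> {0..T}" and s: "s \<in> {t..T}" and u: "u \<in> strats G" and w: "w \<in> strats G" and \<nu>: "\<nu> \<in> V"
    and A: "A \<in> sets (F s)"
    and eq: "\<And>x r. x \<in> A \<Longrightarrow> r \<le> s \<Longrightarrow> w \<nu> (r, x) = u \<nu> (r, x)"
  shows "AE x in P. x \<in> A \<longrightarrow> L t z u \<nu> s x \<le> exp_loss G s t z w \<nu> x"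
proof -
  have s0: "s \<in> {0..T}" using s t by auto
  let ?X = "\<lambda>u' x. ereal (exp_loss G s t z (strat_concat G s u u') \<nu> x)"
  have "is_ess_inf P (strats G) ?X (ess_inf P (strats G) ?X)"
    using strats_ne exp_loss_measP by (intro ess_inf_is_ess_inf) auto
  then have "AE x in P. ess_inf P (strats G) ?X x \<le> ?X w x" using w unfolding is_ess_inf_def by blast
  moreover have "AE x in P. ereal (L t z u \<nu> s x) \<le> ess_inf P (strats G) ?X x"
    using I2[unfolded I2_def, rule_format, OF t u, of z] \<nu> s by blast
  moreover have "AE x in P. x \<in> A \<longrightarrow> exp_loss G s t z (strat_concat G s u w) \<nu> x = exp_loss G s t z w \<nu> x"
    by (rule exp_loss_cong_strat[OF t s0 strat_concat_strats[OF s0 u w] w \<nu> A])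
      (use eq \<nu> in \<open>auto simp: strat_concat_def concat_at_def\<close>)
  ultimately show ?thesis
  proof eventually_elim
    case (elim x)
    show ?case
    proof
      assume "x \<in> A"
      moreover have "ereal (L t z u \<nu> s x) \<le> ?X w x" using elim(1,2) by (rule order_trans[rotated])
      ultimately show "L t z u \<nu> s x \<le> exp_loss G s t z w \<nu> x" using elim(3) by simp
    qed
  qed
qed

text \<open>Whether the rounded index is \<open>k\<close> is decided by the events
  \<open>\<tau> \<nu> x \<le> dyad t T n j\<close> with \<open>j \<le> k\<close>, and (C5) makes
  each of them depend, up to a null set, only on the control until that grid time.\<close>

lemma dy_index_agree:
  assumes t: "t \<in> {0..T}" and \<tau>: "\<tau> \<in> time_fams G t" and k: "k \<le> 2 ^ n" and \<nu>: "\<nu>1 \<in> V" "\<nu>2 \<in> V"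
  shows "AE x in P. x \<in> agree G 0 (dyad t T n k) \<nu>1 \<nu>2 \<longrightarrow>
    (dy_ge_ix t T n (\<tau> \<nu>1 x) = k \<longleftrightarrow> dy_ge_ix t T n (\<tau> \<nu>2 x) = k)"
proof -
  have tT: "t \<le> T" using t by simp
  have \<tau>in: "\<tau> \<nu> x \<in> {t..T}" if "\<nu> \<in> V" "x \<in> space P" for \<nu> x
    using time_fam_stop[OF t \<tau> that(1)] that(2) unfolding stop_times_def by auto
  have "AE x in P. x \<in> agree G 0 (dyad t T n k) \<nu>1 \<nu>2 \<longrightarrow>
      (\<tau> \<nu>1 x \<le> dyad t T n j \<longleftrightarrow> \<tau> \<nu>2 x \<le> dyad t T n j)" if j: "j \<le> k" for j
  proof -
    have d: "dyad t T n j \<in> {t..T}" using dyad_in[OF tT, of j n] j k by simp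
    have "AE x in P. x \<in> {x. \<tau> \<nu>1 x \<le> dyad t T n j} \<inter> agree G 0 (dyad t T n j) \<nu>1 \<nu>2 \<longleftrightarrow>
        x \<in> {x. \<tau> \<nu>2 x \<le> dyad t T n j} \<inter> agree G 0 (dyad t T n j) \<nu>1 \<nu>2"
      using C5[unfolded C5_def, rule_format, OF t \<tau> \<nu> d] .
    then show ?thesis
    proof eventually_elim
      case (elim x)
      have "x \<in> agree G 0 (dyad t T n k) \<nu>1 \<nu>2 \<Longrightarrow> x \<in> agree G 0 (dyad t T n j) \<nu>1 \<nu>2"
        using dyad_mono[OF tT j, of n] by (auto simp: agree_def)
      with elim show ?case by auto
    qed
  qed
  then have "AE x in P. \<forall>j. j \<le> k \<longrightarrow> x \<in> agree G 0 (dyad t T n k) \<nu>1 \<nu>2 \<longrightarrow>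
      (\<tau> \<nu>1 x \<le> dyad t T n j \<longleftrightarrow> \<tau> \<nu>2 x \<le> dyad t T n j)"
    unfolding AE_all_countable by auto
  then show ?thesis using AE_space
  proof eventually_elim
    case (elim x)
    have le: "dy_ge_ix t T n (\<tau> \<nu> x) \<le> j \<longleftrightarrow> \<tau> \<nu> x \<le> dyad t T n j" if "j \<le> k" "\<nu> \<in> V" for j \<nu>
      using dy_ge_ix_le_iff[OF tT, of "\<tau> \<nu> x" j n] \<tau>in[OF that(2) elim(2)] that k by auto
    have iff: "dy_ge_ix t T n (\<tau> \<nu> x) = k \<longleftrightarrow>
        \<tau> \<nu> x \<le> dyad t T n k \<and> (\<forall>j<k. \<not> \<tau> \<nu> x \<le> dyad t T n j)" if "\<nu> \<in> V" for \<nu>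
    proof -
      have "dy_ge_ix t T n (\<tau> \<nu> x) = k \<longleftrightarrow> dy_ge_ix t T n (\<tau> \<nu> x) \<le> k \<and> (\<forall>j<k. \<not> dy_ge_ix t T n (\<tau> \<nu> x) \<le> j)"
        by (meson le_eq_less_or_eq leD not_le order_refl)
      then show ?thesis using le that by auto
    qed
    show ?case unfolding iff[OF \<nu>(1)] iff[OF \<nu>(2)] using elim(1) by auto
  qed
qed

lemma event_fam_of_agree:
  assumes t: "t \<in> {0..T}" and A: "\<And>\<nu>. \<nu> \<in> V \<Longrightarrow> A \<nu> \<in> sets (F t)"
    and agree: "\<And>\<nu>1 \<nu>2. \<nu>1 \<in> V \<Longrightarrow> \<nu>2 \<in> V \<Longrightarrow> AE x in P. x \<in> agree G 0 t \<nu>1 \<nu>2 \<longrightarrow> (x \<in> A \<nu>1 \<longleftrightarrow> x \<in> A \<nu>2)"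
  shows "(\<lambda>\<nu>\<in>V. A \<nu>) \<in> event_fams G t"
proof (rule C4[unfolded C4_def, rule_format, OF t])
  show "(\<lambda>\<nu>\<in>V. A \<nu>) \<in> V \<rightarrow>\<^sub>E sets (F t)" using A by auto
  fix \<nu>1 \<nu>2 assume \<nu>: "\<nu>1 \<in> V" "\<nu>2 \<in> V"
  from agree[OF this] show "AE x in P. x \<in> (\<lambda>\<nu>\<in>V. A \<nu>) \<nu>1 \<inter> agree G 0 t \<nu>1 \<nu>2 \<longleftrightarrow> x \<in> (\<lambda>\<nu>\<in>V. A \<nu>) \<nu>2 \<inter> agree G 0 t \<nu>1 \<nu>2"
    by eventually_elim (use \<nu> in auto)
qed

text \<open>(C2) pastes at one deterministic time, so the strategy is built by induction over the
  grid points. Step \<open>k\<close> changes only the paths with rounded index \<open>k\<close>,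
  after the time \<open>dyad t T n k\<close>. The switching events use the state under the original
  \<open>u\<close>, for which (Z2) applies directly.\<close>

lemma switch_strategy:
  fixes uu :: "nat \<Rightarrow> nat \<Rightarrow> ('w, 'u, 'v) strategy" and B :: "nat \<Rightarrow> nat \<Rightarrow> 'z set"
  assumes t: "t \<in> {0..T}" and u: "u \<in> strats G" and \<tau>: "\<tau> \<in> time_fams G t"
    and uu: "\<And>i j. i \<le> 2 ^ n \<Longrightarrow> uu i j \<in> strats G"
    and B: "\<And>i j. i \<le> 2 ^ n \<Longrightarrow> B i j \<in> sets borel"
      "\<And>i. i \<le> 2 ^ n \<Longrightarrow> disjoint_family (B i)" "\<And>i. i \<le> 2 ^ n \<Longrightarrow> (\<Union>j. B i j) = UNIV"
  shows "\<exists>w\<in>strats G. \<forall>\<nu>\<in>V. \<forall>x\<in>space P. \<forall>i r. i \<le> 2 ^ n \<longrightarrow> dy_ge_ix t T n (\<tau> \<nu> x) = i \<longrightarrow>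
    (r \<le> dyad t T n i \<longrightarrow> w \<nu> (r, x) = u \<nu> (r, x)) \<and>
    (\<forall>j. Zp t z u \<nu> (dyad t T n i) x \<in> B i j \<longrightarrow> dyad t T n i < r \<longrightarrow> w \<nu> (r, x) = uu i j \<nu> (r, x))"
proof -
  have tT: "t \<le> T" using t by simp
  define \<kappa> where "\<kappa> \<nu> x = dy_ge_ix t T n (\<tau> \<nu> x)" for \<nu> x
  have \<kappa>_sets: "{x\<in>space P. \<kappa> \<nu> x = k} \<in> sets (F (dyad t T n k))" if "\<nu> \<in> V" "k \<le> 2 ^ n" for \<nu> k
    using dy_ge_ix_sets(2)[OF tT space_F mono_F, where \<tau>="\<tau> \<nu>" and k=k and n=n] time_fam_stop[OF t \<tau> that(1)] that(2)
    unfolding \<kappa>_def stop_times_def by auto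
  have "\<exists>w\<in>strats G. \<forall>\<nu>\<in>V. \<forall>x\<in>space P. \<forall>r. (k \<le> \<kappa> \<nu> x \<longrightarrow> w \<nu> (r, x) = u \<nu> (r, x)) \<and>
    (\<forall>i<k. \<kappa> \<nu> x = i \<longrightarrow> (r \<le> dyad t T n i \<longrightarrow> w \<nu> (r, x) = u \<nu> (r, x)) \<and>
      (\<forall>j. Zp t z u \<nu> (dyad t T n i) x \<in> B i j \<longrightarrow> dyad t T n i < r \<longrightarrow> w \<nu> (r, x) = uu i j \<nu> (r, x)))"
    if "k \<le> Suc (2 ^ n)" for k
    using that
  proof (induction k)
    case 0
    show ?case using u by (intro bexI[of _ u]) auto
  next
    case (Suc k)
    then obtain w where w: "w \<in> strats G"
      "\<And>\<nu> x r. \<nu> \<in> V \<Longrightarrow> x \<in> space P \<Longrightarrow> k \<le> \<kappa> \<nu> x \<Longrightarrow> w \<nu> (r, x) = u \<nu> (r, x)"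
      "\<And>\<nu> x r i. \<nu> \<in> V \<Longrightarrow> x \<in> space P \<Longrightarrow> i < k \<Longrightarrow> \<kappa> \<nu> x = i \<Longrightarrow> r \<le> dyad t T n i \<Longrightarrow> w \<nu> (r, x) = u \<nu> (r, x)"
      "\<And>\<nu> x r i j. \<nu> \<in> V \<Longrightarrow> x \<in> space P \<Longrightarrow> i < k \<Longrightarrow> \<kappa> \<nu> x = i \<Longrightarrow> Zp t z u \<nu> (dyad t T n i) x \<in> B i j \<Longrightarrow>
        dyad t T n i < r \<Longrightarrow> w \<nu> (r, x) = uu i j \<nu> (r, x)"
      by auto
    have k: "k \<le> 2 ^ n" using Suc by simp
    let ?d = "dyad t T n k"
    have dT: "?d \<in> {t..T}" using dyad_in[OF tT k] .
    then have d0: "?d \<in> {0..T}" using t by auto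
    \<comment> \<open>Member 0 collects the paths that do not switch at this time and keeps the
      current \<open>w\<close>; the cells of the state space are shifted by one.\<close>
    define A where "A j \<nu> = (case j of 0 \<Rightarrow> {x\<in>space P. \<kappa> \<nu> x \<noteq> k}
      | Suc j \<Rightarrow> {x\<in>space P. \<kappa> \<nu> x = k} \<inter> {x\<in>space P. Zp t z u \<nu> ?d x \<in> B k j})" for j \<nu>
    have AS: "A j \<nu> \<in> sets (F ?d)" if \<nu>: "\<nu> \<in> V" for j \<nu>
    proof (cases j)
      case 0
      have "{x\<in>space P. \<kappa> \<nu> x \<noteq> k} = space (F ?d) - {x\<in>space P. \<kappa> \<nu> x = k}" by (auto simp: space_F)
      then show ?thesis using \<kappa>_sets[OF \<nu> k] by (simp add: A_def 0 sets.compl_sets)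
    next
      case (Suc i)
      have "{x\<in>space P. Zp t z u \<nu> ?d x \<in> B k i} = Zp t z u \<nu> ?d -` B k i \<inter> space (F ?d)" by (auto simp: space_F)
      also have "\<dots> \<in> sets (F ?d)" by (rule measurable_sets[OF Z_adapted[OF t dT u \<nu>] B(1)[OF k]])
      finally show ?thesis using \<kappa>_sets[OF \<nu> k] by (auto simp: A_def Suc)
    qed
    have AF: "(\<lambda>\<nu>\<in>V. A j \<nu>) \<in> event_fams G ?d" for j
    proof (rule event_fam_of_agree[OF d0 AS])
      fix \<nu>1 \<nu>2 assume \<nu>: "\<nu>1 \<in> V" "\<nu>2 \<in> V"
      have "AE x in P. x \<in> agree G 0 ?d \<nu>1 \<nu>2 \<longrightarrow> Zp t z u \<nu>1 ?d x = Zp t z u \<nu>2 ?d x"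
        using Z2[unfolded Z2_def, rule_format, OF t dT u \<nu>] by (auto elim!: eventually_mono)
      with dy_index_agree[OF t \<tau> k \<nu>]
      show "AE x in P. x \<in> agree G 0 ?d \<nu>1 \<nu>2 \<longrightarrow> (x \<in> A j \<nu>1 \<longleftrightarrow> x \<in> A j \<nu>2)"
        by eventually_elim (auto simp: A_def \<kappa>_def split: nat.splits)
    qed
    have uuS: "(case j of 0 \<Rightarrow> w | Suc i \<Rightarrow> uu k i) \<in> strats G" for j
      using w(1) uu[OF k] by (auto split: nat.splits)
    have disj: "disjoint_family (\<lambda>j. (\<lambda>\<nu>\<in>V. A j \<nu>) \<nu>)" if "\<nu> \<in> V" for \<nu>
      using B(2)[OF k] that unfolding disjoint_family_on_def A_def by (auto split: nat.splits)
    have un: "(\<Union>j. (\<lambda>\<nu>\<in>V. A j \<nu>) \<nu>) = space P" if "\<nu> \<in> V" for \<nu>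
    proof -
      have "x \<in> (\<Union>j. A j \<nu>)" if x: "x \<in> space P" for x
      proof (cases "\<kappa> \<nu> x = k")
        case True
        obtain i where "Zp t z u \<nu> ?d x \<in> B k i" using B(3)[OF k] by blast
        then have "x \<in> A (Suc i) \<nu>" using True x by (simp add: A_def)
        then show ?thesis by blast
      next
        case False
        then have "x \<in> A 0 \<nu>" using x by (simp add: A_def)
        then show ?thesis by blast
      qed
      then show ?thesis using that by (auto simp: A_def split: nat.splits)
    qed
    obtain w' where w': "w' \<in> strats G"
      "\<And>\<nu> r x. \<nu> \<in> V \<Longrightarrow> r \<le> ?d \<Longrightarrow> w' \<nu> (r, x) = w \<nu> (r, x)"
      "\<And>\<nu> r x j. \<nu> \<in> V \<Longrightarrow> x \<in> A j \<nu> \<Longrightarrow> ?d < r \<Longrightarrow> w' \<nu> (r, x) = (case j of 0 \<Rightarrow> w | Suc i \<Rightarrow> uu k i) \<nu> (r, x)"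
      using paste_strats[OF d0 w(1), where u="\<lambda>j. case j of 0 \<Rightarrow> w | Suc i \<Rightarrow> uu k i" and A="\<lambda>j. \<lambda>\<nu>\<in>V. A j \<nu>", OF uuS AF disj un]
      by auto
    have other: "w' \<nu> (r, x) = w \<nu> (r, x)" if "\<nu> \<in> V" "x \<in> space P" "\<kappa> \<nu> x \<noteq> k" for \<nu> x r
      using w'(2)[OF that(1), of r x] w'(3)[OF that(1), of x 0 r] that by (cases "r \<le> ?d") (auto simp: A_def)
    have same: "w' \<nu> (r, x) = uu k j \<nu> (r, x)"
      if "\<nu> \<in> V" "x \<in> space P" "\<kappa> \<nu> x = k" "Zp t z u \<nu> ?d x \<in> B k j" "?d < r" for \<nu> x r j
      using w'(3)[OF that(1), of x "Suc j" r] that by (simp add: A_def)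
    show ?case
    proof (intro bexI[OF _ w'(1)] ballI allI conjI impI)
      fix \<nu> x r assume \<nu>: "\<nu> \<in> V" and x: "x \<in> space P"
      show "w' \<nu> (r, x) = u \<nu> (r, x)" if "Suc k \<le> \<kappa> \<nu> x" using other[OF \<nu> x] w(2)[OF \<nu> x] that by simp
      fix i assume i: "i < Suc k" "\<kappa> \<nu> x = i"
      show "w' \<nu> (r, x) = u \<nu> (r, x)" if "r \<le> dyad t T n i"
        using w'(2)[OF \<nu>, of r x] other[OF \<nu> x] w(2)[OF \<nu> x] w(3)[OF \<nu> x, of i r] i that by (cases "i = k") auto
      show "w' \<nu> (r, x) = uu i j \<nu> (r, x)" if "Zp t z u \<nu> (dyad t T n i) x \<in> B i j" "dyad t T n i < r" for j
        using same[OF \<nu> x] other[OF \<nu> x] w(4)[OF \<nu> x, of i j r] i that by (cases "i = k") auto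
    qed
  qed
  from this[OF order_refl] show ?thesis unfolding \<kappa>_def by (simp add: less_Suc_eq_le) blast
qed

theorem GDP2:
  assumes t: "t \<in> {0..T}" and \<iota>: "\<iota> > 0" and u: "u \<in> strats G" and M: "M \<in> mart_fams G t p" and \<tau>: "\<tau> \<in> time_fams G t"
    and safe: "\<And>\<nu>. \<nu> \<in> V \<Longrightarrow> AE x in P. (Zp t z u \<nu> (\<tau> \<nu> x) x, M \<nu> (\<tau> \<nu> x) x) \<in> Lam_iota G \<iota> (\<tau> \<nu> x)"
    and uiM: "uniformly_integrable P {\<lambda>x. max 0 (M \<nu> (\<tau> \<nu> x) x) | \<nu>. \<nu> \<in> V}"
    and uiL: "uniformly_integrable P {\<lambda>x. max 0 (- L t z u \<nu> (\<tau>' x) x) | \<nu> \<tau>'. \<nu> \<in> V \<and> \<tau>' \<in> stop_times G t}"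
    and \<epsilon>: "\<epsilon> > 0"
  shows "(z, p - \<epsilon>) \<in> Lam G t"
proof -
  have tT: "t \<le> T" using t by simp
  \<comment> \<open>The estimate loses \<open>6 * e\<close>: three for the near-optimal switch, two
    for the tails of the martingale and of \<open>L\<close>, one for the probability of the bad
    event. The seventh makes the inequality in \<open>Lam_below_K\<close> strict.\<close>
  define e where "e = \<epsilon> / 7"
  have e: "e > 0" using \<epsilon> by (simp add: e_def)
  obtain c1 where c1: "c1 \<ge> 0" and c1X: "\<forall>X\<in>{\<lambda>x. max 0 (M \<nu> (\<tau> \<nu> x) x) | \<nu>. \<nu> \<in> V}.
      integrable P X \<and> (\<integral>x. max 0 (\<bar>X x\<bar> - c1) \<partial>P) \<le> e"
    using uniformly_integrable_excess[OF uiM e] by (elim exE conjE)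
  have c1M: "integrable P (\<lambda>x. max 0 (M \<nu> (\<tau> \<nu> x) x)) \<and>
      (\<integral>x. max 0 (\<bar>max 0 (M \<nu> (\<tau> \<nu> x) x)\<bar> - c1) \<partial>P) \<le> e" if "\<nu> \<in> V" for \<nu>
    by (rule bspec[OF c1X]) (use that in blast)
  obtain c2 where c2: "c2 \<ge> 0" and c2X: "\<forall>X\<in>{\<lambda>x. max 0 (- L t z u \<nu> (\<tau>' x) x) | \<nu> \<tau>'. \<nu> \<in> V \<and> \<tau>' \<in> stop_times G t}.
      integrable P X \<and> (\<integral>x. max 0 (\<bar>X x\<bar> - c2) \<partial>P) \<le> e"
    using uniformly_integrable_excess[OF uiL e] by (elim exE conjE)
  have c2L: "integrable P (\<lambda>x. max 0 (- L t z u \<nu> (\<tau>' x) x)) \<and>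
      (\<integral>x. max 0 (\<bar>max 0 (- L t z u \<nu> (\<tau>' x) x)\<bar> - c2) \<partial>P) \<le> e" if "\<nu> \<in> V" "\<tau>' \<in> stop_times G t" for \<nu> \<tau>'
    by (rule bspec[OF c2X]) (use that in blast)
  \<comment> \<open>The largest probability allowed for the bad event: below the tail levels
    \<open>c1\<close> and \<open>c2\<close> it contributes at most \<open>e\<close>. The summand 1
    excludes division by zero.\<close>
  define \<eta> where "\<eta> = e / (c1 + c2 + 1)"
  have \<eta>: "\<eta> > 0" "(c1 + c2) * \<eta> \<le> e"
    using e c1 c2 by (auto simp: \<eta>_def field_simps add_pos_nonneg)
  define Bad where "Bad \<delta> \<nu> \<tau>' = {x\<in>space P. (SUP h\<in>{0..\<delta>}. ennreal (dist (Zp t z u \<nu> (min (\<tau>' x + h) T) x)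
                                         (Zp t z u \<nu> (\<tau>' x) x))) \<ge> ennreal (\<iota> / 2)}" for \<delta> \<nu> \<tau>'
  have "((\<lambda>\<delta>. SUP (\<nu>, \<tau>') \<in> V \<times> stop_times G t. outer_measure_of P (Bad \<delta> \<nu> \<tau>')) \<longlongrightarrow> 0) (at_right 0)"
    using R2[unfolded R2_def, rule_format, OF t u, of "\<iota> / 2" z] \<iota> unfolding Bad_def by simp
  then have "\<forall>\<^sub>F \<delta> in at_right 0. (SUP (\<nu>, \<tau>') \<in> V \<times> stop_times G t. outer_measure_of P (Bad \<delta> \<nu> \<tau>')) < ennreal \<eta>"
    by (rule order_tendstoD(2)) (use \<eta>(1) in simp)
  then obtain \<delta>0 where \<delta>0: "\<delta>0 > 0" "\<And>\<delta>. 0 < \<delta> \<Longrightarrow> \<delta> < \<delta>0 \<Longrightarrow>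
      (SUP (\<nu>, \<tau>') \<in> V \<times> stop_times G t. outer_measure_of P (Bad \<delta> \<nu> \<tau>')) < ennreal \<eta>"
    unfolding eventually_at_right_field by auto
  define \<delta> where "\<delta> = \<delta>0 / 2"
  have \<delta>: "\<delta> > 0" using \<delta>0 by (simp add: \<delta>_def)
  have bad: "outer_measure_of P (Bad \<delta> \<nu> \<tau>') \<le> ennreal \<eta>" if "\<nu> \<in> V" "\<tau>' \<in> stop_times G t" for \<nu> \<tau>'
  proof -
    have "outer_measure_of P (Bad \<delta> \<nu> \<tau>') \<le> (SUP (\<nu>, \<tau>') \<in> V \<times> stop_times G t. outer_measure_of P (Bad \<delta> \<nu> \<tau>'))"
      using that by (intro SUP_upper2[of "(\<nu>, \<tau>')"]) auto
    also have "\<dots> < ennreal \<eta>" using \<delta>0 by (intro \<delta>0(2)) (auto simp: \<delta>_def)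
    finally show ?thesis by simp
  qed
  \<comment> \<open>The radius \<open>\<iota>\<close> is shared equally between the displacement of
    the state and the delay caused by rounding; the second coordinate stays the same. The mesh must
    also be below \<open>\<delta>\<close> for (R2) to control the displacement.\<close>
  obtain n where n: "(T - t) / 2 ^ n < min (\<iota> / 2) \<delta>"
  proof -
    have "min (\<iota> / 2) \<delta> > 0" using \<iota> \<delta> by simp
    then obtain n where "\<bar>(T - t) / 2 ^ n\<bar> < min (\<iota> / 2) \<delta>" using mesh_small by blast
    then show ?thesis using that[of n] abs_ge_self[of "(T - t) / 2 ^ n"] by linarith
  qed
  have n_mesh: "(T - t) / 2 ^ n < \<iota> / 2" using n by (simp only: min_less_iff_conj)
  define d where "d = dyad t T n"
  have dT: "d k \<in> {t..T}" if "k \<le> 2 ^ n" for k unfolding d_def using dyad_in[OF tT that] .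
  have d0: "d k \<in> {0..T}" if "k \<le> 2 ^ n" for k using dT[OF that] t by auto
  \<comment> \<open>The clauses of (R1) used below, gathered in one predicate so that partitions can
    be chosen for all grid points at once.\<close>
  define part where "part k B zs \<longleftrightarrow> range B \<subseteq> sets borel \<and> disjoint_family B \<and> (\<Union>j. B j) = UNIV \<and>
    (\<forall>w\<in>strats G. \<forall>\<nu>\<in>V. \<forall>j. AE x in P. Zp t z w \<nu> (d k) x \<in> B j \<longrightarrow>
       exp_loss G (d k) t z w \<nu> x \<ge> Iloss G (d k) (zs j) w \<nu> x - e \<and>
       K (d k) (Zp t z w \<nu> (d k) x) \<le> K (d k) (zs j) + e)" for k and B :: "nat \<Rightarrow> 'z set" and zs
  have "\<exists>B zs. part k B zs" if k: "k \<le> 2 ^ n" for k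
  proof -
    obtain B :: "nat \<Rightarrow> 'z set" and zs where B: "range B \<subseteq> sets borel" "disjoint_family B" "(\<Union>j. B j) = UNIV"
      and R: "\<And>w \<nu> j. w \<in> strats G \<Longrightarrow> \<nu> \<in> V \<Longrightarrow> AE x in P. Zp t z w \<nu> (d k) x \<in> B j \<longrightarrow>
          exp_loss G (d k) t z w \<nu> x \<ge> Iloss G (d k) (zs j) w \<nu> x - e \<and>
          ess_inf P V (\<lambda>\<nu>' x. ereal (exp_loss G (d k) t z w (concat_at (d k) \<nu> \<nu>') x)) x
            \<le> Jloss G (d k) (zs j) (strat_after G (d k) w \<nu>) x + ereal e \<and>
          K (d k) (zs j) - e \<le> K (d k) (Zp t z w \<nu> (d k) x) \<and>
          K (d k) (Zp t z w \<nu> (d k) x) \<le> K (d k) (zs j) + e"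
      using R1[unfolded R1_def, rule_format, OF t dT[OF k] e, of z] by blast
    have "AE x in P. Zp t z w \<nu> (d k) x \<in> B j \<longrightarrow>
        exp_loss G (d k) t z w \<nu> x \<ge> Iloss G (d k) (zs j) w \<nu> x - e \<and>
        K (d k) (Zp t z w \<nu> (d k) x) \<le> K (d k) (zs j) + e" if "w \<in> strats G" "\<nu> \<in> V" for w \<nu> j
      using R[OF that, of j] by eventually_elim blast
    then show ?thesis using B unfolding part_def by blast
  qed
  then obtain B zs where part: "\<And>k. k \<le> 2 ^ n \<Longrightarrow> part k (B k) (zs k)" by metis
  have B: "\<And>k j. k \<le> 2 ^ n \<Longrightarrow> B k j \<in> sets borel" "\<And>k. k \<le> 2 ^ n \<Longrightarrow> disjoint_family (B k)"
      "\<And>k. k \<le> 2 ^ n \<Longrightarrow> (\<Union>j. B k j) = UNIV"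
    and R: "\<And>k w \<nu> j. k \<le> 2 ^ n \<Longrightarrow> w \<in> strats G \<Longrightarrow> \<nu> \<in> V \<Longrightarrow> AE x in P. Zp t z w \<nu> (d k) x \<in> B k j \<longrightarrow>
          exp_loss G (d k) t z w \<nu> x \<ge> Iloss G (d k) (zs k j) w \<nu> x - e \<and>
          K (d k) (Zp t z w \<nu> (d k) x) \<le> K (d k) (zs k j) + e"
    using part unfolding part_def by blast+
  have "\<exists>v. k \<le> 2 ^ n \<longrightarrow> v \<in> strats G \<and> (AE x in P. ereal (K (d k) (zs k j) - e) \<le> Jloss G (d k) (zs k j) v x)" for k j
    using Lam_below_K[OF d0, of k "K (d k) (zs k j) - e" "zs k j"] e unfolding Lam_def by auto
  then obtain uu where uu: "\<And>k j. k \<le> 2 ^ n \<Longrightarrow> uu k j \<in> strats G"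
    "\<And>k j. k \<le> 2 ^ n \<Longrightarrow> AE x in P. ereal (K (d k) (zs k j) - e) \<le> Jloss G (d k) (zs k j) (uu k j) x"
    by metis
  define \<kappa> where "\<kappa> \<nu> x = dy_ge_ix t T n (\<tau> \<nu> x)" for \<nu> x
  have "\<exists>w\<in>strats G. \<forall>\<nu>\<in>V. \<forall>x\<in>space P. \<forall>i r. i \<le> 2 ^ n \<longrightarrow> \<kappa> \<nu> x = i \<longrightarrow>
    (r \<le> d i \<longrightarrow> w \<nu> (r, x) = u \<nu> (r, x)) \<and>
    (\<forall>j. Zp t z u \<nu> (d i) x \<in> B i j \<longrightarrow> d i < r \<longrightarrow> w \<nu> (r, x) = uu i j \<nu> (r, x))"
    unfolding \<kappa>_def d_def by (rule switch_strategy[OF t u \<tau> uu(1) B])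
  then obtain w where w: "w \<in> strats G" and w_eq: "\<forall>\<nu>\<in>V. \<forall>x\<in>space P. \<forall>i r. i \<le> 2 ^ n \<longrightarrow> \<kappa> \<nu> x = i \<longrightarrow>
    (r \<le> d i \<longrightarrow> w \<nu> (r, x) = u \<nu> (r, x)) \<and>
    (\<forall>j. Zp t z u \<nu> (d i) x \<in> B i j \<longrightarrow> d i < r \<longrightarrow> w \<nu> (r, x) = uu i j \<nu> (r, x))"
    by (elim bexE)
  have w_before: "w \<nu> (r, x) = u \<nu> (r, x)"
    if "\<nu> \<in> V" "x \<in> space P" "\<kappa> \<nu> x \<le> 2 ^ n" "r \<le> d (\<kappa> \<nu> x)" for \<nu> x r
    using w_eq[rule_format, OF that(1,2,3) refl, of r] that(4) by blast
  have w_after: "w \<nu> (r, x) = uu (\<kappa> \<nu> x) j \<nu> (r, x)"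
    if "\<nu> \<in> V" "x \<in> space P" "\<kappa> \<nu> x \<le> 2 ^ n" "Zp t z u \<nu> (d (\<kappa> \<nu> x)) x \<in> B (\<kappa> \<nu> x) j" "d (\<kappa> \<nu> x) < r" for \<nu> x r j
    using w_eq[rule_format, OF that(1,2,3) refl, of r] that(4,5) by blast
  have "p - 6 * e \<le> (\<integral>x. loss G (Zp t z w \<nu> T x) \<partial>P)" if \<nu>: "\<nu> \<in> V" for \<nu>
  proof -
    have \<tau>st: "\<tau> \<nu> \<in> stop_times G t" by (rule time_fam_stop[OF t \<tau> \<nu>])
    have \<tau>in: "t \<le> \<tau> \<nu> x" "\<tau> \<nu> x \<le> T" if "x \<in> space P" for x using \<tau>st that unfolding stop_times_def by auto
    have \<kappa>le: "\<kappa> \<nu> x \<le> 2 ^ n" if "x \<in> space P" for x unfolding \<kappa>_def using dy_ge_ix(2) \<tau>in[OF that] by auto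
    have st: "stopping_time F (\<tau> \<nu>)" "\<tau> \<nu> \<in> space P \<rightarrow> {t..T}" using \<tau>st unfolding stop_times_def by auto
    define E where "E k = {x\<in>space P. \<kappa> \<nu> x = k}" for k
    have EF: "E k \<in> sets (F (d k))" if "k \<le> 2 ^ n" for k
      using dy_ge_ix_sets(2)[OF tT space_F mono_F st that] unfolding E_def \<kappa>_def d_def .
    have EP: "E k \<in> sets P" if "k \<le> 2 ^ n" for k by (rule sets_F[OF d0[OF that] EF[OF that]])
    define \<sigma> where "\<sigma> x = d (\<kappa> \<nu> x)" for x
    have \<sigma>st: "\<sigma> \<in> stop_times G t"
    proof -
      have "stopping_time F \<sigma>" unfolding \<sigma>_def d_def \<kappa>_def
        by (rule stopping_time_dyad[OF tT space_F mono_F])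
          (use \<kappa>le \<kappa>_def dy_ge_ix_sets(1)[OF tT space_F mono_F st] in auto)
      then show ?thesis unfolding stop_times_def \<sigma>_def using \<kappa>le dT by auto
    qed
    have \<sigma>ge: "\<tau> \<nu> x \<le> \<sigma> x" "\<sigma> x \<le> \<tau> \<nu> x + (T - t) / 2 ^ n" if "x \<in> space P" for x
      unfolding \<sigma>_def d_def \<kappa>_def using dy_ge_ix(1,3)[OF \<tau>in[OF that]] by auto
    \<comment> \<open>The loss under \<open>w\<close> conditioned at the rounded time, assembled
      from the grid times; its mean is the expected loss.\<close>
    define W where "W x = exp_loss G (d (\<kappa> \<nu> x)) t z w \<nu> x" for x
    have ei: "integrable P (exp_loss G (d k) t z w \<nu>)" if "k \<le> 2 ^ n" for k
      by (rule exp_loss_int[OF t d0[OF that] w \<nu>])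
    have Wi: "integrable P W"
      unfolding W_def using integral_random_index(2)[OF \<kappa>le EP[unfolded E_def], of "\<lambda>k. exp_loss G (d k) t z w \<nu>"] ei by auto
    have W_mean: "(\<integral>x. W x \<partial>P) = (\<integral>x. loss G (Zp t z w \<nu> T x) \<partial>P)"
    proof -
      have "(\<integral>x. W x \<partial>P) = (\<Sum>k\<le>2^n. \<integral>x\<in>E k. exp_loss G (d k) t z w \<nu> x \<partial>P)"
        unfolding W_def E_def using integral_random_index(1)[OF \<kappa>le EP[unfolded E_def], of "\<lambda>k. exp_loss G (d k) t z w \<nu>"] ei by auto
      also have "\<dots> = (\<Sum>k\<le>2^n. \<integral>x\<in>E k. loss G (Zp t z w \<nu> T x) \<partial>P)"
        by (intro sum.cong refl exp_loss_set_integral[OF t d0 w \<nu> EF]) auto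
      also have "\<dots> = (\<integral>x. loss G (Zp t z w \<nu> T x) \<partial>P)"
        unfolding E_def using integral_random_index(1)[OF \<kappa>le EP[unfolded E_def], of "\<lambda>k x. loss G (Zp t z w \<nu> T x)"] loss_int[OF t w \<nu>, of z] by auto
      finally show ?thesis .
    qed
    \<comment> \<open>The three errors: \<open>K\<close> at the state against \<open>K\<close> at
      the base point, the near-optimality of \<open>uu k j\<close> at the base point, and the loss
      from the state against the loss from the base point.\<close>
    have low1: "AE x in P. x \<in> E k \<longrightarrow> K (d k) (Zp t z u \<nu> (d k) x) - 3 * e \<le> exp_loss G (d k) t z w \<nu> x" if k: "k \<le> 2 ^ n" for k
    proof -
      have zz: "AE x in P. x \<in> agree G t (d k) (w \<nu>) (u \<nu>) \<longrightarrow> Zp t z w \<nu> (d k) x = Zp t z u \<nu> (d k) x"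
        using Z1[unfolded Z1_def, rule_format, OF t dT[OF k] \<nu> w u] by auto
      have il: "AE x in P. x \<in> E k \<inter> {x\<in>space P. Zp t z u \<nu> (d k) x \<in> B k j} \<longrightarrow>
          exp_loss G (d k) (d k) (zs k j) w \<nu> x = exp_loss G (d k) (d k) (zs k j) (uu k j) \<nu> x" for j
      proof (rule exp_loss_cong_strat[OF d0[OF k] d0[OF k] w uu(1)[OF k] \<nu>])
        have "{x\<in>space P. Zp t z u \<nu> (d k) x \<in> B k j} = Zp t z u \<nu> (d k) -` B k j \<inter> space (F (d k))" by (auto simp: space_F)
        also have "\<dots> \<in> sets (F (d k))" by (rule measurable_sets[OF Z_adapted[OF t dT[OF k] u \<nu>] B(1)[OF k]])
        finally show "E k \<inter> {x\<in>space P. Zp t z u \<nu> (d k) x \<in> B k j} \<in> sets (F (d k))" using EF[OF k] by auto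
      next
        fix x r assume "x \<in> E k \<inter> {x\<in>space P. Zp t z u \<nu> (d k) x \<in> B k j}" "r \<in> {d k<..T}"
        then show "w \<nu> (r, x) = uu k j \<nu> (r, x)" using w_after[OF \<nu>, of x j r] k by (auto simp: E_def)
      qed
      have "AE x in P. \<forall>j. x \<in> E k \<inter> {x\<in>space P. Zp t z u \<nu> (d k) x \<in> B k j} \<longrightarrow>
          exp_loss G (d k) (d k) (zs k j) w \<nu> x = exp_loss G (d k) (d k) (zs k j) (uu k j) \<nu> x"
        unfolding AE_all_countable using il by blast
      moreover have "AE x in P. \<forall>j. Zp t z w \<nu> (d k) x \<in> B k j \<longrightarrow>
          exp_loss G (d k) t z w \<nu> x \<ge> Iloss G (d k) (zs k j) w \<nu> x - e \<and>
          K (d k) (Zp t z w \<nu> (d k) x) \<le> K (d k) (zs k j) + e"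
        unfolding AE_all_countable using R[OF k w \<nu>] by blast
      moreover have "AE x in P. \<forall>j. ereal (K (d k) (zs k j) - e) \<le> Jloss G (d k) (zs k j) (uu k j) x"
        unfolding AE_all_countable using uu(2)[OF k] by blast
      moreover have "AE x in P. \<forall>j. Jloss G (d k) (zs k j) (uu k j) x \<le> ereal (exp_loss G (d k) (d k) (zs k j) (uu k j) \<nu> x)"
        unfolding AE_all_countable using Jloss_is_ess_inf \<nu> unfolding is_ess_inf_def by blast
      ultimately show ?thesis using zz AE_space
      proof eventually_elim
        case (elim x)
        show ?case
        proof
          assume x: "x \<in> E k"
          obtain j where j: "Zp t z u \<nu> (d k) x \<in> B k j" using B(3)[OF k] by blast
          have "x \<in> agree G t (d k) (w \<nu>) (u \<nu>)" using w_before[OF \<nu> elim(6)] x k by (auto simp: agree_def E_def)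
          then have zeq: "Zp t z w \<nu> (d k) x = Zp t z u \<nu> (d k) x" using elim(5) by blast
          have "ereal (K (d k) (zs k j) - e) \<le> ereal (exp_loss G (d k) (d k) (zs k j) (uu k j) \<nu> x)"
            using elim(3,4) order_trans by blast
          then have "K (d k) (zs k j) - e \<le> Iloss G (d k) (zs k j) w \<nu> x"
            using elim(1) x j elim(6) by (auto simp: Iloss_def)
          then show "K (d k) (Zp t z u \<nu> (d k) x) - 3 * e \<le> exp_loss G (d k) t z w \<nu> x"
            using elim(2)[rule_format, of j] j zeq by auto
        qed
      qed
    qed
    have low2: "AE x in P. x \<in> E k \<longrightarrow> L t z u \<nu> (d k) x \<le> exp_loss G (d k) t z w \<nu> x" if k: "k \<le> 2 ^ n" for k
      by (rule exp_loss_ge_L[OF t dT[OF k] u w \<nu> EF[OF k]]) (use w_before[OF \<nu>] k in \<open>auto simp: E_def\<close>)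
    \<comment> \<open>Off the bad set the state at \<open>\<sigma> x\<close> with the old second
      coordinate is still inside the \<open>\<iota>\<close>-ball, so it belongs to
      \<open>Lam\<close> at the rounded time and \<open>Lam_le_K\<close> applies.\<close>
    have good: "AE x in P. x \<notin> Bad \<delta> \<nu> (\<tau> \<nu>) \<longrightarrow> M \<nu> (\<tau> \<nu> x) x \<le> K (\<sigma> x) (Zp t z u \<nu> (\<sigma> x) x)"
      using safe[OF \<nu>] AE_space
    proof eventually_elim
      case (elim x)
      show ?case
      proof
        assume nb: "x \<notin> Bad \<delta> \<nu> (\<tau> \<nu>)"
        have \<sigma>T: "\<sigma> x \<in> {0..T}" unfolding \<sigma>_def by (rule d0[OF \<kappa>le[OF elim(2)]])
        let ?h = "\<sigma> x - \<tau> \<nu> x"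
        have h: "?h \<in> {0..\<delta>}" using \<sigma>ge[OF elim(2)] n by auto
        have "ennreal (dist (Zp t z u \<nu> (min (\<tau> \<nu> x + ?h) T) x) (Zp t z u \<nu> (\<tau> \<nu> x) x))
            \<le> (SUP h\<in>{0..\<delta>}. ennreal (dist (Zp t z u \<nu> (min (\<tau> \<nu> x + h) T) x) (Zp t z u \<nu> (\<tau> \<nu> x) x)))"
          by (rule SUP_upper[OF h])
        also have "\<dots> < ennreal (\<iota> / 2)" using nb elim(2) by (auto simp: Bad_def not_le)
        finally have "dist (Zp t z u \<nu> (\<sigma> x) x) (Zp t z u \<nu> (\<tau> \<nu> x) x) < \<iota> / 2"
          using \<sigma>T by (simp add: ennreal_less_iff min_absorb1)
        moreover have "\<bar>\<tau> \<nu> x - \<sigma> x\<bar> < \<iota> / 2" using \<sigma>ge[OF elim(2)] n_mesh by linarith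
        ultimately have "(Zp t z u \<nu> (\<sigma> x) x, M \<nu> (\<tau> \<nu> x) x) \<in> Lam G (\<sigma> x)"
          using elim(1) \<sigma>T unfolding Lam_iota_def by (auto simp: dist_commute)
        then show "M \<nu> (\<tau> \<nu> x) x \<le> K (\<sigma> x) (Zp t z u \<nu> (\<sigma> x) x)" by (rule Lam_le_K[OF \<sigma>T])
      qed
    qed
    have "AE x in P. \<forall>k. k \<le> 2 ^ n \<longrightarrow> x \<in> E k \<longrightarrow>
        K (d k) (Zp t z u \<nu> (d k) x) - 3 * e \<le> exp_loss G (d k) t z w \<nu> x \<and> L t z u \<nu> (d k) x \<le> exp_loss G (d k) t z w \<nu> x"
      unfolding AE_all_countable
    proof
      fix k
      show "AE x in P. k \<le> 2 ^ n \<longrightarrow> x \<in> E k \<longrightarrow>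
        K (d k) (Zp t z u \<nu> (d k) x) - 3 * e \<le> exp_loss G (d k) t z w \<nu> x \<and> L t z u \<nu> (d k) x \<le> exp_loss G (d k) t z w \<nu> x"
      proof (cases "k \<le> 2 ^ n")
        case True
        from low1[OF True] low2[OF True] show ?thesis by eventually_elim blast
      qed simp
    qed
    then have low: "AE x in P. K (\<sigma> x) (Zp t z u \<nu> (\<sigma> x) x) - 3 * e \<le> W x \<and> L t z u \<nu> (\<sigma> x) x \<le> W x"
      using AE_space
    proof eventually_elim
      case (elim x)
      then show ?case using \<kappa>le[OF elim(2)] unfolding W_def \<sigma>_def by (auto simp: E_def)
    qed
    have M\<tau>: "integrable P (\<lambda>x. M \<nu> (\<tau> \<nu> x) x)" "(\<integral>x. M \<nu> (\<tau> \<nu> x) x \<partial>P) = p"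
      using stopped_martingale_mean[OF t mart_fam_mart[OF t M \<nu>] \<tau>st] by auto
    have [measurable]: "W \<in> borel_measurable P" "(\<lambda>x. M \<nu> (\<tau> \<nu> x) x) \<in> borel_measurable P" using Wi M\<tau>(1) by auto
    \<comment> \<open>The set \<open>Bad\<close> need not be measurable, so integrals are split
      along the event where the good estimate fails; it lies in \<open>Bad\<close> almost
      surely.\<close>
    define H where "H = {x\<in>space P. W x < M \<nu> (\<tau> \<nu> x) x - 3 * e}"
    have HP: "H \<in> sets P" unfolding H_def by measurable
    have "AE x in P. x \<in> H \<longrightarrow> x \<in> Bad \<delta> \<nu> (\<tau> \<nu>)"
      using good low by eventually_elim (auto simp: H_def)
    then have PH: "measure P H \<le> \<eta>"
      using measure_le_of_AE_subset[OF HP _ bad[OF \<nu> \<tau>st]] \<eta>(1) by simp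
    let ?m = "\<lambda>x. max 0 (M \<nu> (\<tau> \<nu> x) x)" and ?l = "\<lambda>x. max 0 (- L t z u \<nu> (\<sigma> x) x)"
    note cm = c1M[OF \<nu>] and cl = c2L[OF \<nu> \<sigma>st]
    have mH: "(\<integral>x\<in>H. \<bar>?m x\<bar> \<partial>P) \<le> e + c1 * \<eta>"
      using set_integral_le_excess[OF cm[THEN conjunct1] HP c1] cm mult_left_mono[OF PH c1] by linarith
    have lH: "(\<integral>x\<in>H. \<bar>?l x\<bar> \<partial>P) \<le> e + c2 * \<eta>"
      using set_integral_le_excess[OF cl[THEN conjunct1] HP c2] cl mult_left_mono[OF PH c2] by linarith
    have iH: "integrable P (\<lambda>x. indicat_real H x *\<^sub>R \<bar>?m x\<bar>)" "integrable P (\<lambda>x. indicat_real H x *\<^sub>R \<bar>?l x\<bar>)"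
      using cm cl by (auto intro!: integrable_mult_indicator[OF HP] simp del: real_scaleR_def)
    \<comment> \<open>On \<open>H\<close> the positive part cancels the martingale and the remaining
      negative part of \<open>L\<close> bounds \<open>W\<close> from below; off \<open>H\<close> the
      inequality defines \<open>H\<close>.\<close>
    have "(\<integral>x. (M \<nu> (\<tau> \<nu> x) x - 3 * e) - (indicat_real H x *\<^sub>R \<bar>?m x\<bar> + indicat_real H x *\<^sub>R \<bar>?l x\<bar>) \<partial>P) \<le> (\<integral>x. W x \<partial>P)"
    proof (rule integral_mono_AE)
      show "AE x in P. (M \<nu> (\<tau> \<nu> x) x - 3 * e) - (indicat_real H x *\<^sub>R \<bar>?m x\<bar> + indicat_real H x *\<^sub>R \<bar>?l x\<bar>) \<le> W x"
        using low AE_space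
      proof eventually_elim
        case (elim x)
        show ?case
        proof (cases "x \<in> H")
          case True
          then have "indicat_real H x *\<^sub>R \<bar>?m x\<bar> = ?m x" "indicat_real H x *\<^sub>R \<bar>?l x\<bar> = ?l x" by simp_all
          moreover have "M \<nu> (\<tau> \<nu> x) x \<le> ?m x" "- L t z u \<nu> (\<sigma> x) x \<le> ?l x" by simp_all
          ultimately show ?thesis using elim(1) e by linarith
        next
          case False
          then show ?thesis using elim by (simp add: H_def)
        qed
      qed
    qed (use iH M\<tau> Wi in auto)
    also have "(\<integral>x. (M \<nu> (\<tau> \<nu> x) x - 3 * e) - (indicat_real H x *\<^sub>R \<bar>?m x\<bar> + indicat_real H x *\<^sub>R \<bar>?l x\<bar>) \<partial>P) =
        (\<integral>x. M \<nu> (\<tau> \<nu> x) x - 3 * e \<partial>P) - ((\<integral>x\<in>H. \<bar>?m x\<bar> \<partial>P) + (\<integral>x\<in>H. \<bar>?l x\<bar> \<partial>P))"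
      unfolding set_lebesgue_integral_def using iH M\<tau>(1)
      by (subst Bochner_Integration.integral_diff Bochner_Integration.integral_add; auto)+
    also have "(\<integral>x. M \<nu> (\<tau> \<nu> x) x - 3 * e \<partial>P) = p - 3 * e"
      using M\<tau> by (simp add: prob_space)
    finally have "p - 3 * e - ((\<integral>x\<in>H. \<bar>?m x\<bar> \<partial>P) + (\<integral>x\<in>H. \<bar>?l x\<bar> \<partial>P)) \<le> (\<integral>x. W x \<partial>P)" .
    moreover have "c1 * \<eta> + c2 * \<eta> \<le> e" using \<eta>(2) by (simp add: distrib_right)
    ultimately show ?thesis using mH lH W_mean by linarith
  qed
  then have "p - 6 * e \<le> K t z" by (rule K_ge_of_expected_loss[OF t w])
  then show ?thesis using e by (intro Lam_below_K[OF t]) (simp add: e_def)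
qed

end

theorem theorem2p1:
  fixes G :: "('w, 'u, 'v, 'z::metric_space) target_game"
    and K :: "real \<Rightarrow> 'z \<Rightarrow> real"
    and L :: "real \<Rightarrow> 'z \<Rightarrow> ('w, 'u, 'v) strategy \<Rightarrow> ('w, 'v) control \<Rightarrow> real \<Rightarrow> 'w \<Rightarrow> real"
    and t :: real and z :: 'z and p :: real
  assumes "game_setting G"
    and "t \<in> {0..horizon G}"
    and "C1 G" and "C2 G" and "C3 G" and "C4 G" and "C5 G" and "C6 G"
    and "Z1 G" and "Z2 G" and "Z3 G" and "Z4 G K"
    and "I1 G" and "I2 G L"
    and "R1 G K" and "R2 G"
  shows
    "((z, p) \<in> Lam G t \<longrightarrow>
        (\<exists>u\<in>strats G. \<exists>M \<in> Vctrls G \<rightarrow> marts G t p.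
           \<forall>\<nu>\<in>Vctrls G. \<forall>\<tau>\<in>stop_times G t. AE \<omega> in Prob G.
             (Zproc G t z u \<nu> (\<tau> \<omega>) \<omega>, M \<nu> (\<tau> \<omega>) \<omega>) \<in> Lam_bar G (\<tau> \<omega>)))
     \<and>
     (\<forall>\<iota>>0. \<forall>u\<in>strats G. \<forall>M\<in>mart_fams G t p. \<forall>\<tau>\<in>time_fams G t.
        (\<forall>\<nu>\<in>Vctrls G. AE \<omega> in Prob G.
           (Zproc G t z u \<nu> (\<tau> \<nu> \<omega>) \<omega>, M \<nu> (\<tau> \<nu> \<omega>) \<omega>) \<in> Lam_iota G \<iota> (\<tau> \<nu> \<omega>)) \<and>
        uniformly_integrable (Prob G)
          {\<lambda>\<omega>. max 0 (M \<nu> (\<tau> \<nu> \<omega>) \<omega>) | \<nu>. \<nu> \<in> Vctrls G} \<and>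
        uniformly_integrable (Prob G)
          {\<lambda>\<omega>. max 0 (- L t z u \<nu> (\<tau>' \<omega>) \<omega>) | \<nu> \<tau>'. \<nu> \<in> Vctrls G \<and> \<tau>' \<in> stop_times G t} \<longrightarrow>
        (\<forall>\<epsilon>>0. (z, p - \<epsilon>) \<in> Lam G t))"
proof -
  interpret game G K L using assms by unfold_locales
  show ?thesis
  proof (intro conjI impI allI ballI)
    show "\<exists>u\<in>strats G. \<exists>M \<in> Vctrls G \<rightarrow> marts G t p.
      \<forall>\<nu>\<in>Vctrls G. \<forall>\<tau>\<in>stop_times G t. AE \<omega> in Prob G.
        (Zproc G t z u \<nu> (\<tau> \<omega>) \<omega>, M \<nu> (\<tau> \<omega>) \<omega>) \<in> Lam_bar G (\<tau> \<omega>)"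
      if "(z, p) \<in> Lam G t"
      by (rule GDP1[OF assms(2) that])
  next
    fix \<iota> u M \<tau> and \<epsilon> :: real
    assume \<iota>: "\<iota> > 0" and u: "u \<in> strats G" and M: "M \<in> mart_fams G t p" and \<tau>: "\<tau> \<in> time_fams G t"
      and \<epsilon>: "\<epsilon> > 0"
      and hyp: "(\<forall>\<nu>\<in>Vctrls G. AE \<omega> in Prob G.
           (Zproc G t z u \<nu> (\<tau> \<nu> \<omega>) \<omega>, M \<nu> (\<tau> \<nu> \<omega>) \<omega>) \<in> Lam_iota G \<iota> (\<tau> \<nu> \<omega>)) \<and>
        uniformly_integrable (Prob G)
          {\<lambda>\<omega>. max 0 (M \<nu> (\<tau> \<nu> \<omega>) \<omega>) | \<nu>. \<nu> \<in> Vctrls G} \<and>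
        uniformly_integrable (Prob G)
          {\<lambda>\<omega>. max 0 (- L t z u \<nu> (\<tau>' \<omega>) \<omega>) | \<nu> \<tau>'. \<nu> \<in> Vctrls G \<and> \<tau>' \<in> stop_times G t}"
    show "(z, p - \<epsilon>) \<in> Lam G t"
      by (rule GDP2[OF assms(2) \<iota> u M \<tau> bspec[OF hyp[THEN conjunct1]] hyp[THEN conjunct2, THEN conjunct1]
            hyp[THEN conjunct2, THEN conjunct2] \<epsilon>])
  qed
qed

end
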